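(* Let $G$ be a totally disconnected, locally compact group and let $H$ be a finitely generated flat group of automorphisms of $G$. Then the action of $H$ on $\mathrm{nub}^2_G(H)$ is ergodic. If in addition $H_{\mathbf{u}}$ is finitely generated, then $\mathrm{nub}^2_G(H) = \mathrm{nub}_G(H)$.
   Context: Topological groups are Hausdorff; automorphisms of $G$ are group automorphisms that are homeomorphisms. For an automorphism $\alpha$ and a compact open subgroup $U$ of $G$, put $U_+ = \bigcap_{n\ge 0}\alpha^n(U)$, $U_-=\bigcap_{n\le 0}\alpha^n(U)$, $U_{++} = \{g \in G \mid \exists m\in\mathbb{Z}\ \forall n \le m:\ \alpha^n(g)\in U\}$. $U$ is tidy for $\alpha$ if $U=U_+U_-$ and $U_{++}$ is closed; equivalently, $|\alpha(U):\alpha(U)\cap U|$ is minimal among all compact open subgroups. A group $H$ acting on $G$ by automorphisms is flat (on $G$) if some compact open subgroup is tidy for every element of $H$; then $\mathrm{nub}_G(H)$ is the intersection of all compact open subgroups of $G$ tidy for every element of $H$; it is a compact $H$-invariant subgroup of $G$. The uniscalar part $H_{\mathbf{u}}$ of the flat group $H$ is the normal subgroup of those elements leaving invariant a (equivalently, every) compact open subgroup that is tidy for $H$. Define $\mathrm{nub}^2_G(H) := \mathrm{nub}_{\mathrm{nub}_G(H)}(H)$, the nub of the (flat) action of $H$ on the compact group $\mathrm{nub}_G(H)$. Ergodicity of an action by automorphisms on a compact group refers to normalized Haar measure. *)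

theory Defs
  imports
    "HOL-Analysis.Analysis"
    "HOL-Algebra.Coset"
    "HOL-Algebra.Bij"
    "HOL-Algebra.Generated_Groups"
begin

text \<open>
  A topological group is a group \<open>G\<close> together with a topology \<open>T\<close> on its carrier.  A subgroup \<open>N\<close> is
  again a topological group via \<open>G\<lparr>carrier := N\<rparr>\<close> and \<open>subtopology T N\<close>; this is why
  the development is relative to carriers and does not use type classes.
\<close>

definition topological_group :: "('a, 'b) monoid_scheme \<Rightarrow> 'a topology \<Rightarrow> bool" where
  "topological_group G T \<longleftrightarrow>
     group G \<and> topspace T = carrier G \<and> Hausdorff_space T \<and>
     continuous_map (prod_topology T T) T (\<lambda>(x, y). x \<otimes>\<^bsub>G\<^esub> y) \<and>
     continuous_map T T (\<lambda>x. inv\<^bsub>G\<^esub> x)"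

definition totally_disconnected_space :: "'a topology \<Rightarrow> bool" where
  "totally_disconnected_space T \<longleftrightarrow> (\<forall>C. connectedin T C \<longrightarrow> (\<forall>x\<in>C. \<forall>y\<in>C. x = y))"

definition tdlc_group :: "('a, 'b) monoid_scheme \<Rightarrow> 'a topology \<Rightarrow> bool" where
  "tdlc_group G T \<longleftrightarrow>
     topological_group G T \<and> totally_disconnected_space T \<and> locally_compact_space T"

definition top_auto :: "('a, 'b) monoid_scheme \<Rightarrow> 'a topology \<Rightarrow> ('a \<Rightarrow> 'a) set" where
  "top_auto G T = {\<alpha> \<in> auto G. homeomorphic_map T T \<alpha>}"

text \<open>As in \<^const>\<open>AutoGroup\<close>, the elements are extensional functions on the carrier.\<close>

definition TopAutoGroup :: "('a, 'b) monoid_scheme \<Rightarrow> 'a topology \<Rightarrow> ('a \<Rightarrow> 'a) monoid" where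
  "TopAutoGroup G T = (AutoGroup G)\<lparr>carrier := top_auto G T\<rparr>"

definition compact_open_subgroup :: "('a, 'b) monoid_scheme \<Rightarrow> 'a topology \<Rightarrow> 'a set \<Rightarrow> bool" where
  "compact_open_subgroup G T U \<longleftrightarrow> subgroup U G \<and> compactin T U \<and> openin T U"

definition U_plus ::
    "('a, 'b) monoid_scheme \<Rightarrow> 'a topology \<Rightarrow> ('a \<Rightarrow> 'a) \<Rightarrow> 'a set \<Rightarrow> 'a set" where
  "U_plus G T \<alpha> U = (\<Inter>n\<in>{0::int..}. (\<alpha> [^]\<^bsub>TopAutoGroup G T\<^esub> n) ` U)"

definition U_minus ::
    "('a, 'b) monoid_scheme \<Rightarrow> 'a topology \<Rightarrow> ('a \<Rightarrow> 'a) \<Rightarrow> 'a set \<Rightarrow> 'a set" where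
  "U_minus G T \<alpha> U = (\<Inter>n\<in>{..0::int}. (\<alpha> [^]\<^bsub>TopAutoGroup G T\<^esub> n) ` U)"

definition U_plus_plus ::
    "('a, 'b) monoid_scheme \<Rightarrow> 'a topology \<Rightarrow> ('a \<Rightarrow> 'a) \<Rightarrow> 'a set \<Rightarrow> 'a set" where
  "U_plus_plus G T \<alpha> U =
     {g \<in> carrier G. \<exists>m::int. \<forall>n\<le>m. (\<alpha> [^]\<^bsub>TopAutoGroup G T\<^esub> n) g \<in> U}"

text \<open>Tidiness of a compact open subgroup \<open>U\<close> for a single automorphism.\<close>

definition tidy ::
    "('a, 'b) monoid_scheme \<Rightarrow> 'a topology \<Rightarrow> ('a \<Rightarrow> 'a) \<Rightarrow> 'a set \<Rightarrow> bool" where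
  "tidy G T \<alpha> U \<longleftrightarrow>
     compact_open_subgroup G T U \<and>
     U = U_plus G T \<alpha> U <#>\<^bsub>G\<^esub> U_minus G T \<alpha> U \<and>
     closedin T (U_plus_plus G T \<alpha> U)"

definition tidy_subgroups ::
    "('a, 'b) monoid_scheme \<Rightarrow> 'a topology \<Rightarrow> ('a \<Rightarrow> 'a) set \<Rightarrow> 'a set set" where
  "tidy_subgroups G T H = {U. compact_open_subgroup G T U \<and> (\<forall>\<alpha>\<in>H. tidy G T \<alpha> U)}"

definition flat_group ::
    "('a, 'b) monoid_scheme \<Rightarrow> 'a topology \<Rightarrow> ('a \<Rightarrow> 'a) set \<Rightarrow> bool" where
  "flat_group G T H \<longleftrightarrow> subgroup H (TopAutoGroup G T) \<and> tidy_subgroups G T H \<noteq> {}"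

text \<open>
  The intersection with the carrier is redundant for flat \<open>H\<close>; it only prevents an
  empty intersection from being the whole type.
\<close>

definition nub :: "('a, 'b) monoid_scheme \<Rightarrow> 'a topology \<Rightarrow> ('a \<Rightarrow> 'a) set \<Rightarrow> 'a set" where
  "nub G T H = carrier G \<inter> \<Inter> (tidy_subgroups G T H)"

text \<open>
  The group of automorphisms of an \<open>H\<close>-invariant subgroup \<open>N\<close> induced by \<open>H\<close>.  The action of \<open>H\<close> on
  \<open>N\<close> may be unfaithful, but flatness, the nub and ergodicity depend only on this image of \<open>H\<close>.
\<close>

definition restrict_action :: "('a \<Rightarrow> 'a) set \<Rightarrow> 'a set \<Rightarrow> ('a \<Rightarrow> 'a) set" where
  "restrict_action H N = (\<lambda>\<alpha>. restrict \<alpha> N) ` H"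

definition nub2 :: "('a, 'b) monoid_scheme \<Rightarrow> 'a topology \<Rightarrow> ('a \<Rightarrow> 'a) set \<Rightarrow> 'a set" where
  "nub2 G T H =
     (let N = nub G T H in nub (G\<lparr>carrier := N\<rparr>) (subtopology T N) (restrict_action H N))"

definition uniscalar_part ::
    "('a, 'b) monoid_scheme \<Rightarrow> 'a topology \<Rightarrow> ('a \<Rightarrow> 'a) set \<Rightarrow> ('a \<Rightarrow> 'a) set" where
  "uniscalar_part G T H = {\<alpha> \<in> H. \<exists>U \<in> tidy_subgroups G T H. \<alpha> ` U = U}"

definition finitely_generated_subgroup :: "('a, 'b) monoid_scheme \<Rightarrow> 'a set \<Rightarrow> bool" where
  "finitely_generated_subgroup A H \<longleftrightarrow> (\<exists>S. finite S \<and> S \<subseteq> H \<and> H = generate A S)"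

text \<open>
  Normalized Haar measure on a compact group: the unique left-invariant regular Borel probability
  measure.  On a compact Hausdorff space a finite outer regular Borel measure is also inner regular,
  so outer regularity suffices.
\<close>

definition normalized_haar_measure ::
    "('a, 'b) monoid_scheme \<Rightarrow> 'a topology \<Rightarrow> 'a measure \<Rightarrow> bool" where
  "normalized_haar_measure K T \<mu> \<longleftrightarrow>
     space \<mu> = carrier K \<and>
     sets \<mu> = sigma_sets (carrier K) {U. openin T U} \<and>
     emeasure \<mu> (carrier K) = 1 \<and>
     (\<forall>g\<in>carrier K. \<forall>A\<in>sets \<mu>. emeasure \<mu> (g <#\<^bsub>K\<^esub> A) = emeasure \<mu> A) \<and>
     (\<forall>A\<in>sets \<mu>. emeasure \<mu> A = (INF U\<in>{U. openin T U \<and> A \<subseteq> U}. emeasure \<mu> U))"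

text \<open>
  Ergodicity of a set \<open>L\<close> of automorphisms of a compact group \<open>K\<close>.  Since normalized Haar
  measure exists and is unique, the quantifier over \<open>\<mu>\<close> ranges over exactly one measure.
\<close>

definition ergodic_action ::
    "('a, 'b) monoid_scheme \<Rightarrow> 'a topology \<Rightarrow> ('a \<Rightarrow> 'a) set \<Rightarrow> bool" where
  "ergodic_action K T L \<longleftrightarrow>
     (\<forall>\<mu>. normalized_haar_measure K T \<mu> \<longrightarrow>
        (\<forall>A\<in>sets \<mu>. (\<forall>\<alpha>\<in>L. \<alpha> ` A = A) \<longrightarrow> emeasure \<mu> A = 0 \<or> emeasure \<mu> A = 1))"

end

theory Submission
  imports Defs
begin

text \<open>
  Write \<open>K\<close> for the intersection of all \<open>H\<close>-translates of a tidy subgroup \<open>U\<close>, and \<open>Res\<close> for the intersection of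
  all open \<open>H\<close>-invariant subgroups of a compact \<open>H\<close>-invariant group.  In a compact group the tidy subgroups
  are exactly the open invariant ones, so \<open>nub\<^sup>2 = Res nub\<close>.  As \<open>H\<close> is finitely generated, an open
  invariant subgroup of a residual extends to an open invariant subgroup of the whole group; hence residuals have no proper
  open invariant subgroups.  This forces ergodicity: for an invariant set \<open>A\<close> that is neither null nor conull, take
  an open normal \<open>W\<close> of minimal index on whose cosets \<open>A\<close> is not equidistributed.  Its orbit is infinite, and by
  minimality the conditional expectations of the indicator of \<open>A\<close> with respect to the members of the orbit are pairwise
  orthogonal and of equal norm, against Bessel's inequality.

  The second claim follows from \<open>nub = Res K\<close>.  Commutators in \<open>H\<close> are uniscalar because the logarithm of the index
  yields a homogeneous length function on \<open>H\<close>, and such functions vanish on commutators.  A decomposition of \<open>U\<close> into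
  subgroups that each element of \<open>H\<close> expands or contracts, together with Dickson's lemma, yields a finite set of
  elements through which all of \<open>H\<close> is reached along geodesics; it suffices to control a small subgroup of \<open>U\<close> for these
  elements and for generators of the uniscalar part in order to make it tidy for \<open>H\<close>.
\<close>

section \<open>Topological groups with a group of automorphisms\<close>

text \<open>The obstacle in the second claim is that a tidy \<open>W\<close> is not
  \<open>H\<close>-invariant. To compare \<open>x\<close> and its image under \<open>h\<close> with
  respect to \<open>X N\<close>, one would like to spell \<open>h\<close> in generators of
  \<open>H\<close>, but intermediate images of \<open>x\<close> may leave \<open>W\<close>, where
  nothing is controlled. A point reached along a geodesic stays in \<open>W\<close> by the very
  definition, and uniscalar elements map \<open>W\<close> onto itself. So geodesic steps reduce
  \<open>h\<close> to a uniscalar element, for which words are harmless; hence the generators of the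
  uniscalar part. Finitely many steps suffice because, on a subgroup \<open>Q\<close> that each
  element expands or contracts, the translates of \<open>Q\<close> by expanding elements form a
  chain ordered by an index, a natural number; finitely many such pieces give the setting of
  Dickson's lemma. The splitting of \<open>U\<close> into pieces ends because a sum of indices over
  generators of \<open>H\<close> drops. It is compatible with translation only because commutators
  fix \<open>U\<close>, so that \<open>H\<close> acts on intersections of translates through an
  abelian quotient; this is what the length functions are for.\<close>

no_notation subset_mset (infix "<#" 50)

text \<open>\<open>L\<close> is an abstract group acting by functions, with all equations required
  on the carrier only and without faithfulness. The same \<open>L\<close> then acts on every
  invariant subgroup, and no quotient has to be formed there.\<close>

locale taction = group G + L: group L
  for G :: "('a, 'b) monoid_scheme" (structure) and L :: "('a \<Rightarrow> 'a, 'c) monoid_scheme" +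
  fixes T :: "'a topology"
  assumes topspace_T [simp]: "topspace T = carrier G"
    and Hausdorff_T: "Hausdorff_space T"
    and mult_cont: "continuous_map (prod_topology T T) T (\<lambda>(x, y). x \<otimes> y)"
    and inv_cont: "continuous_map T T (\<lambda>x. inv x)"
    and act_mult [simp]: "\<lbrakk>g \<in> carrier L; h \<in> carrier L; x \<in> carrier G\<rbrakk> \<Longrightarrow> (g \<otimes>\<^bsub>L\<^esub> h) x = g (h x)"
    and act_one [simp]: "x \<in> carrier G \<Longrightarrow> \<one>\<^bsub>L\<^esub> x = x"
    and act_hom: "g \<in> carrier L \<Longrightarrow> g \<in> hom G G"
    and act_cont: "g \<in> carrier L \<Longrightarrow> continuous_map T T g"
begin

abbreviation act_inv :: "('a \<Rightarrow> 'a) \<Rightarrow> 'a \<Rightarrow> 'a"  ("inv\<^sub>L _" [81] 80) where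
  "inv\<^sub>L g \<equiv> inv\<^bsub>L\<^esub> g"

abbreviation act_compose :: "('a \<Rightarrow> 'a) \<Rightarrow> ('a \<Rightarrow> 'a) \<Rightarrow> 'a \<Rightarrow> 'a"  (infixl "\<otimes>\<^sub>L" 70) where
  "g \<otimes>\<^sub>L h \<equiv> g \<otimes>\<^bsub>L\<^esub> h"

abbreviation act_pow :: "('a \<Rightarrow> 'a) \<Rightarrow> int \<Rightarrow> 'a \<Rightarrow> 'a"  (infixr "\<up>" 75) where
  "g \<up> i \<equiv> g [^]\<^bsub>L\<^esub> i"

lemma act_closed [simp, intro]: "\<lbrakk>g \<in> carrier L; x \<in> carrier G\<rbrakk> \<Longrightarrow> g x \<in> carrier G"
  using act_hom by (auto simp: hom_def)

lemma act_prod [simp]: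
  "\<lbrakk>g \<in> carrier L; x \<in> carrier G; y \<in> carrier G\<rbrakk> \<Longrightarrow> g (x \<otimes> y) = g x \<otimes> g y"
  using act_hom by (auto simp: hom_def)

lemma act_unit [simp]: "g \<in> carrier L \<Longrightarrow> g \<one> = \<one>"
  using act_hom hom_one is_group by blast

lemma act_m_inv [simp]: "\<lbrakk>g \<in> carrier L; x \<in> carrier G\<rbrakk> \<Longrightarrow> g (inv x) = inv (g x)"
  by (metis act_closed act_prod act_unit inv_closed inv_equality l_inv)

lemma act_inv_left [simp]: "\<lbrakk>g \<in> carrier L; x \<in> carrier G\<rbrakk> \<Longrightarrow> (inv\<^sub>L g) (g x) = x"
  by (metis L.inv_closed L.l_inv act_mult act_one)

lemma act_inv_right [simp]: "\<lbrakk>g \<in> carrier L; x \<in> carrier G\<rbrakk> \<Longrightarrow> g ((inv\<^sub>L g) x) = x"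
  by (metis L.inv_closed L.r_inv act_mult act_one)

lemma act_inj: "g \<in> carrier L \<Longrightarrow> inj_on g (carrier G)"
  by (metis act_inv_left inj_onI)

lemma act_image_closed: "\<lbrakk>g \<in> carrier L; Q \<subseteq> carrier G\<rbrakk> \<Longrightarrow> g ` Q \<subseteq> carrier G"
  by auto

lemma act_image_mem_iff:
  assumes "g \<in> carrier L" "Q \<subseteq> carrier G"
  shows "x \<in> g ` Q \<longleftrightarrow> x \<in> carrier G \<and> (inv\<^sub>L g) x \<in> Q"
  using assms by (force simp: image_iff)

lemma act_inv_image_mem_iff:
  assumes "g \<in> carrier L" "Q \<subseteq> carrier G"
  shows "x \<in> (inv\<^sub>L g) ` Q \<longleftrightarrow> x \<in> carrier G \<and> g x \<in> Q"
  using assms act_image_mem_iff[of "inv\<^sub>L g"] by simp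

lemma act_image_mult:
  "\<lbrakk>g \<in> carrier L; h \<in> carrier L; Q \<subseteq> carrier G\<rbrakk> \<Longrightarrow> (g \<otimes>\<^sub>L h) ` Q = g ` h ` Q"
  by (force simp: image_iff subset_iff)

lemma act_image_one: "Q \<subseteq> carrier G \<Longrightarrow> \<one>\<^bsub>L\<^esub> ` Q = Q"
  by (force simp: image_iff subset_iff)

lemma act_image_inv_left: "\<lbrakk>g \<in> carrier L; Q \<subseteq> carrier G\<rbrakk> \<Longrightarrow> (inv\<^sub>L g) ` g ` Q = Q"
  by (metis L.inv_closed L.l_inv act_image_mult act_image_one)

lemma act_image_inv_right: "\<lbrakk>g \<in> carrier L; Q \<subseteq> carrier G\<rbrakk> \<Longrightarrow> g ` (inv\<^sub>L g) ` Q = Q"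
  by (metis L.inv_closed L.r_inv act_image_mult act_image_one)

lemma act_image_mono_iff:
  "\<lbrakk>g \<in> carrier L; P \<subseteq> carrier G; Q \<subseteq> carrier G\<rbrakk> \<Longrightarrow> g ` P \<subseteq> g ` Q \<longleftrightarrow> P \<subseteq> Q"
  by (metis act_image_inv_left image_mono)

lemma act_image_Int:
  "\<lbrakk>g \<in> carrier L; P \<subseteq> carrier G; Q \<subseteq> carrier G\<rbrakk> \<Longrightarrow> g ` (P \<inter> Q) = g ` P \<inter> g ` Q"
  by (meson act_inj inj_on_image_Int)

lemma act_image_INT:
  assumes "g \<in> carrier L" "I \<noteq> {}" "\<And>i. i \<in> I \<Longrightarrow> A i \<subseteq> carrier G"
  shows "g ` (\<Inter>i\<in>I. A i) = (\<Inter>i\<in>I. g ` A i)"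
proof -
  obtain j where "j \<in> I" using assms(2) by blast
  then show ?thesis by (rule image_INT[OF act_inj[OF assms(1)], rotated]) (use assms(3) in blast)
qed

lemma act_image_carrier: "g \<in> carrier L \<Longrightarrow> g ` carrier G = carrier G"
proof -
  assume g: "g \<in> carrier L"
  have "x \<in> g ` carrier G" if "x \<in> carrier G" for x
    using act_image_mem_iff[OF g order_refl] g that by simp
  then show ?thesis using act_image_closed[OF g order_refl] by blast
qed

lemma act_image_set_mult:
  "\<lbrakk>g \<in> carrier L; A \<subseteq> carrier G; B \<subseteq> carrier G\<rbrakk> \<Longrightarrow> g ` (A <#> B) = g ` A <#> g ` B"
  by (force simp: set_mult_def image_iff subset_iff)

lemma act_image_subgroup:
  assumes "g \<in> carrier L" "subgroup Q G" shows "subgroup (g ` Q) G"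
proof -
  have "group_hom G G g"
    using assms by (simp add: act_hom group_hom.intro group_hom_axioms.intro)
  then show ?thesis using assms(2) group_hom.subgroup_img_is_subgroup by blast
qed

lemma act_image_compact: "\<lbrakk>g \<in> carrier L; compactin T C\<rbrakk> \<Longrightarrow> compactin T (g ` C)"
  using act_cont image_compactin by blast

lemma act_image_open:
  assumes "g \<in> carrier L" "openin T Q" shows "openin T (g ` Q)"
proof -
  have Q: "Q \<subseteq> carrier G" using assms(2) openin_subset by fastforce
  have "g ` Q = {x \<in> topspace T. (inv\<^sub>L g) x \<in> Q}"
    using act_image_mem_iff[OF assms(1) Q] by auto
  then show ?thesis
    using openin_continuous_map_preimage[OF act_cont assms(2)] assms(1) by simp
qed

lemma act_image_closed_set:
  assumes "g \<in> carrier L" "closedin T Q" shows "closedin T (g ` Q)"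
proof -
  have Q: "Q \<subseteq> carrier G" using assms(2) closedin_subset by fastforce
  have "g ` Q = {x \<in> topspace T. (inv\<^sub>L g) x \<in> Q}"
    using act_image_mem_iff[OF assms(1) Q] by auto
  then show ?thesis
    using closedin_continuous_map_preimage[OF act_cont assms(2)] assms(1) by simp
qed

lemma compact_subset_carrier: "compactin T C \<Longrightarrow> C \<subseteq> carrier G"
  using compactin_subset_topspace by fastforce

lemma compact_closed: "compactin T C \<Longrightarrow> closedin T C"
  using Hausdorff_T compactin_imp_closedin by blast

lemma open_subset_carrier: "openin T C \<Longrightarrow> C \<subseteq> carrier G"
  using openin_subset by fastforce

lemma continuous_mult:
  assumes "continuous_map X T f" "continuous_map X T g"
  shows "continuous_map X T (\<lambda>x. f x \<otimes> g x)"
proof -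
  have "continuous_map X (prod_topology T T) (\<lambda>x. (f x, g x))"
    using assms by (simp add: continuous_map_pairwise o_def)
  from continuous_map_compose[OF this mult_cont] show ?thesis by (simp add: o_def)
qed

lemma continuous_inv: "continuous_map X T f \<Longrightarrow> continuous_map X T (\<lambda>x. inv (f x))"
  using continuous_map_compose[OF _ inv_cont] by (simp add: o_def)

lemma continuous_ltrans: "a \<in> carrier G \<Longrightarrow> continuous_map T T (\<lambda>x. a \<otimes> x)"
  by (rule continuous_mult) auto

lemma l_coset_eq_image: "a <# U = (\<lambda>x. a \<otimes> x) ` U"
  by (auto simp: l_coset_def)

lemma set_mult_mem: "x \<in> A <#> B \<longleftrightarrow> (\<exists>a\<in>A. \<exists>b\<in>B. x = a \<otimes> b)"
  by (auto simp: set_mult_def)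

lemma set_mult_eq_UN: "A <#> B = (\<Union>a\<in>A. a <# B)"
  by (auto simp: set_mult_def l_coset_def)

lemma subset_set_mult_left: "\<lbrakk>A \<subseteq> carrier G; \<one> \<in> B\<rbrakk> \<Longrightarrow> A \<subseteq> A <#> B"
  unfolding set_mult_def by force

lemma subset_set_mult_right: "\<lbrakk>B \<subseteq> carrier G; \<one> \<in> A\<rbrakk> \<Longrightarrow> B \<subseteq> A <#> B"
  unfolding set_mult_def by force

lemma act_image_invariant:
  assumes X: "X \<subseteq> carrier G" and sub: "\<And>g. g \<in> carrier L \<Longrightarrow> g ` X \<subseteq> X" and g: "g \<in> carrier L"
  shows "g ` X = X"
proof
  have "g ` (inv\<^sub>L g) ` X \<subseteq> g ` X" using sub[of "inv\<^sub>L g"] g by (intro image_mono) simp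
  then show "X \<subseteq> g ` X" using act_image_inv_right[OF g X] by simp
qed (rule sub[OF g])

lemma act_image_invariant':
  assumes X: "X \<subseteq> carrier G" and sub: "\<And>g. g \<in> carrier L \<Longrightarrow> X \<subseteq> g ` X" and g: "g \<in> carrier L"
  shows "g ` X = X"
proof
  have "g ` X \<subseteq> g ` (inv\<^sub>L g) ` X" using sub[of "inv\<^sub>L g"] g by (intro image_mono) simp
  then show "g ` X \<subseteq> X" using act_image_inv_right[OF g X] by simp
qed (rule sub[OF g])

lemma l_coset_mem_iff:
  "\<lbrakk>a \<in> carrier G; U \<subseteq> carrier G\<rbrakk> \<Longrightarrow> x \<in> a <# U \<longleftrightarrow> x \<in> carrier G \<and> inv a \<otimes> x \<in> U"
  by (force simp: l_coset_def m_assoc[symmetric] subset_iff)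

lemma open_lcoset: assumes "a \<in> carrier G" "openin T U" shows "openin T (a <# U)"
proof -
  have "a <# U = {x \<in> topspace T. inv a \<otimes> x \<in> U}"
    using l_coset_mem_iff[OF assms(1) open_subset_carrier[OF assms(2)]] by auto
  then show ?thesis
    using openin_continuous_map_preimage[OF continuous_ltrans assms(2)] assms(1) by simp
qed

lemma open_set_mult_right:
  assumes "A \<subseteq> carrier G" "openin T U" shows "openin T (A <#> U)"
proof -
  have "openin T (a <# U)" if "a \<in> A" for a using that assms open_lcoset by blast
  then show ?thesis unfolding set_mult_eq_UN by blast
qed

lemma compact_set_mult:
  assumes "compactin T A" "compactin T B" shows "compactin T (A <#> B)"
proof -
  have "A <#> B = (\<lambda>(x, y). x \<otimes> y) ` (A \<times> B)" by (auto simp: set_mult_def image_iff)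
  moreover have "compactin (prod_topology T T) (A \<times> B)"
    using assms by (simp add: compactin_Times)
  ultimately show ?thesis using image_compactin[OF _ mult_cont] by simp
qed

lemma finite_coset_cover:
  assumes C: "compactin T C" and U: "openin T U" "subgroup U G"
  obtains F where "finite F" "F \<subseteq> C" "C \<subseteq> F <#> U"
proof -
  have Cc: "C \<subseteq> carrier G" using C compact_subset_carrier by blast
  have "\<And>V. V \<in> (\<lambda>a. a <# U) ` C \<Longrightarrow> openin T V" using open_lcoset U Cc by blast
  moreover have "C \<subseteq> \<Union>((\<lambda>a. a <# U) ` C)"
  proof
    fix x assume x: "x \<in> C"
    then have "x \<in> x <# U"
      using Cc U(2) subgroup.subset[OF U(2)] by (auto simp: l_coset_mem_iff subgroup.one_closed)
    then show "x \<in> \<Union>((\<lambda>a. a <# U) ` C)" using x by blast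
  qed
  ultimately obtain \<F> where "finite \<F>" "\<F> \<subseteq> (\<lambda>a. a <# U) ` C" "C \<subseteq> \<Union>\<F>"
    using compactinD[OF C, of "(\<lambda>a. a <# U) ` C"] by blast
  then obtain F where F: "finite F" "F \<subseteq> C" "\<F> = (\<lambda>a. a <# U) ` F"
    by (meson finite_subset_image)
  have "C \<subseteq> F <#> U" using \<open>C \<subseteq> \<Union>\<F>\<close> F by (simp add: set_mult_eq_UN)
  then show thesis using that F by blast
qed

lemma lcoset_eq:
  assumes "subgroup U G" "x \<in> a <# U" "a \<in> carrier G" shows "x <# U = a <# U"
  using assms l_repr_independence by blast

lemma finite_cosets:
  assumes C: "compactin T C" and U: "openin T U" "subgroup U G"
  shows "finite ((\<lambda>y. y <# U) ` C)"
proof -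
  obtain F where F: "finite F" "F \<subseteq> C" "C \<subseteq> F <#> U" using finite_coset_cover[OF assms] .
  have "(\<lambda>y. y <# U) ` C \<subseteq> (\<lambda>y. y <# U) ` F"
  proof
    fix Y assume "Y \<in> (\<lambda>y. y <# U) ` C"
    then obtain y where y: "y \<in> C" "Y = y <# U" by blast
    then obtain a where a: "a \<in> F" "y \<in> a <# U" using F(3) unfolding set_mult_eq_UN by blast
    then have "Y = a <# U" using y lcoset_eq[OF U(2) a(2)] F(2) compact_subset_carrier[OF C] by auto
    then show "Y \<in> (\<lambda>y. y <# U) ` F" using a by blast
  qed
  then show ?thesis using F(1) finite_surj by blast
qed

lemma compact_Inter_subset_open:
  assumes "\<C> \<noteq> {}" "\<And>C. C \<in> \<C> \<Longrightarrow> compactin T C" "openin T W" "\<Inter>\<C> \<subseteq> W"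
  obtains \<F> where "finite \<F>" "\<F> \<subseteq> \<C>" "\<F> \<noteq> {}" "\<Inter>\<F> \<subseteq> W"
proof -
  obtain C0 where C0: "C0 \<in> \<C>" using assms(1) by blast
  have "compactin T (C0 - W)"
    using closed_compactin[of T C0 "C0 - W"] assms(2,3) C0 closedin_diff compact_closed by (metis Diff_subset)
  moreover have "\<And>C. C \<in> \<C> \<Longrightarrow> closedin T C" using assms(2) compact_closed by blast
  moreover have "(C0 - W) \<inter> \<Inter>\<C> = {}" using assms(4) by blast
  ultimately obtain \<F> where F: "finite \<F>" "\<F> \<subseteq> \<C>" "(C0 - W) \<inter> \<Inter>\<F> = {}"
    unfolding compactin_fip by meson
  show thesis
    by (rule that[of "insert C0 \<F>"]) (use F C0 in auto)
qed

lemma compact_chain_subset_open: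
  fixes C :: "nat \<Rightarrow> 'a set"
  assumes "\<And>n. compactin T (C n)" "decseq C" "openin T W" "(\<Inter>n. C n) \<subseteq> W"
  obtains n where "C n \<subseteq> W"
proof -
  obtain \<F> where F: "finite \<F>" "\<F> \<subseteq> range C" "\<F> \<noteq> {}" "\<Inter>\<F> \<subseteq> W"
    using compact_Inter_subset_open[of "range C" W] assms by auto
  then obtain N where N: "finite N" "\<F> = C ` N" by (meson finite_subset_image)
  have "C (Max N) \<subseteq> C n" if "n \<in> N" for n
    using assms(2) N(1) that by (simp add: decseq_def)
  then have "C (Max N) \<subseteq> \<Inter>\<F>" using N by blast
  then show thesis using F(4) that by blast
qed

text \<open>The first factors of a fixed \<open>x\<close>, that is, the \<open>a\<close> in
  \<open>A n\<close> with \<open>inv a \<otimes> x\<close> in \<open>B n\<close>, form a decreasing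
  sequence of nonempty compact sets; a common point serves for all \<open>n\<close> at once.\<close>

lemma set_mult_INT_compact:
  fixes A B :: "nat \<Rightarrow> 'a set"
  assumes A: "\<And>n. compactin T (A n)" "decseq A" and B: "\<And>n. compactin T (B n)" "decseq B"
  shows "(\<Inter>n. A n <#> B n) = (\<Inter>n. A n) <#> (\<Inter>n. B n)"
proof
  show "(\<Inter>n. A n) <#> (\<Inter>n. B n) \<subseteq> (\<Inter>n. A n <#> B n)" by (auto simp: set_mult_def)
  show "(\<Inter>n. A n <#> B n) \<subseteq> (\<Inter>n. A n) <#> (\<Inter>n. B n)"
  proof
    fix x assume x: "x \<in> (\<Inter>n. A n <#> B n)"
    have Ac: "A n \<subseteq> carrier G" and Bc: "B n \<subseteq> carrier G" for n
      using A B compact_subset_carrier by blast+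
    have xc: "x \<in> carrier G" using x Ac Bc by (fastforce simp: set_mult_def)
    define C where "C n = A n \<inter> {a \<in> topspace T. inv a \<otimes> x \<in> B n}" for n
    have cl: "closedin T {a \<in> topspace T. inv a \<otimes> x \<in> B n}" for n
      using xc closedin_continuous_map_preimage[OF continuous_mult[OF inv_cont, of "\<lambda>_. x"]]
        compact_closed[OF B(1)] by simp
    have comp: "compactin T (C n)" for n
      unfolding C_def using compact_Int_closedin[OF A(1) cl] .
    have dec: "decseq C"
      using A(2) B(2) unfolding decseq_def C_def by blast
    have ne: "C n \<noteq> {}" for n
    proof -
      have "x \<in> A n <#> B n" using x by blast
      then obtain a b where ab: "a \<in> A n" "b \<in> B n" "x = a \<otimes> b" unfolding set_mult_mem by blast
      moreover have "a \<in> carrier G" "b \<in> carrier G" using ab Ac Bc by blast+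
      ultimately have "a \<in> C n" by (simp add: C_def m_assoc[symmetric])
      then show ?thesis by blast
    qed
    have "(\<Inter>n. C n) \<noteq> {}"
      using compact_chain_subset_open[of C "{}"] comp dec ne by auto
    then obtain a where a: "\<And>n. a \<in> C n" by auto
    have "a \<in> (\<Inter>n. A n)" "inv a \<otimes> x \<in> (\<Inter>n. B n)" "a \<in> carrier G"
      using a by (auto simp: C_def)
    moreover have "x = a \<otimes> (inv a \<otimes> x)" using xc calculation(3) by (simp add: m_assoc[symmetric])
    ultimately show "x \<in> (\<Inter>n. A n) <#> (\<Inter>n. B n)" unfolding set_mult_def by blast
  qed
qed

end

section \<open>Tidy subgroups\<close>

context taction begin

lemma pw_closed [simp, intro]: "h \<in> carrier L \<Longrightarrow> h \<up> i \<in> carrier L"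
  by simp

lemma pw_add:
  assumes "h \<in> carrier L" "x \<in> carrier G"
  shows "(h \<up> i) ((h \<up> j) x) = (h \<up> (i + j)) x"
  using assms by (simp flip: act_mult add: L.int_pow_mult)

lemma pw_0 [simp]: "x \<in> carrier G \<Longrightarrow> (h \<up> 0) x = x"
  by simp

lemma pw_1 [simp]: "h \<in> carrier L \<Longrightarrow> h \<up> 1 = h"
  by (simp add: L.int_pow_1)

lemma pw_minus: "h \<in> carrier L \<Longrightarrow> (inv\<^sub>L h) \<up> i = h \<up> (- i)"
  by (simp add: L.int_pow_inv L.int_pow_neg)

lemma pw_m1: "h \<in> carrier L \<Longrightarrow> h \<up> (-1) = inv\<^sub>L h"
  using L.int_pow_neg[of h 1] by simp

lemma inv_pw: "h \<in> carrier L \<Longrightarrow> inv\<^sub>L (h \<up> i) = h \<up> (- i)"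
  by (simp add: L.int_pow_neg)

definition Plus :: "('a \<Rightarrow> 'a) \<Rightarrow> 'a set \<Rightarrow> 'a set" where
  "Plus h Q = (\<Inter>i\<in>{0::int..}. (h \<up> i) ` Q)"

text \<open>Through the inverse, so that each fact about \<open>Minus\<close> is the one about
  \<open>Plus\<close> for \<open>inv\<^sub>L h\<close>.\<close>

definition Minus :: "('a \<Rightarrow> 'a) \<Rightarrow> 'a set \<Rightarrow> 'a set" where
  "Minus h Q = Plus (inv\<^sub>L h) Q"

definition Plus_plus :: "('a \<Rightarrow> 'a) \<Rightarrow> 'a set \<Rightarrow> 'a set" where
  "Plus_plus h U = {x \<in> carrier G. \<exists>m::int. \<forall>i\<le>m. (h \<up> i) x \<in> U}"

definition tidy_for :: "('a \<Rightarrow> 'a) \<Rightarrow> 'a set \<Rightarrow> bool" where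
  "tidy_for h U \<longleftrightarrow> subgroup U G \<and> compactin T U \<and> openin T U \<and>
     U = Plus h U <#> Minus h U \<and> closedin T (Plus_plus h U)"

definition tidy_all :: "'a set set" where
  "tidy_all = {U. \<forall>h\<in>carrier L. tidy_for h U}"

text \<open>Membership in the translate by \<open>h \<up> i\<close> concerns the point moved by
  \<open>h \<up> (- i)\<close>, so intersecting over nonnegative \<open>i\<close> constrains the
  backward orbit. Later arguments mostly use this orbit form.\<close>

lemma Plus_mem:
  assumes "h \<in> carrier L" "Q \<subseteq> carrier G"
  shows "x \<in> Plus h Q \<longleftrightarrow> x \<in> carrier G \<and> (\<forall>i\<le>0::int. (h \<up> i) x \<in> Q)"
proof -
  have "x \<in> Plus h Q \<longleftrightarrow> (\<forall>i\<ge>0::int. x \<in> carrier G \<and> (h \<up> (- i)) x \<in> Q)"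
    unfolding Plus_def using assms by (auto simp: act_image_mem_iff inv_pw)
  also have "\<dots> \<longleftrightarrow> x \<in> carrier G \<and> (\<forall>i\<le>0::int. (h \<up> i) x \<in> Q)"
    by (metis neg_0_le_iff_le minus_minus order_refl)
  finally show ?thesis .
qed

lemma Minus_mem:
  assumes "h \<in> carrier L" "Q \<subseteq> carrier G"
  shows "x \<in> Minus h Q \<longleftrightarrow> x \<in> carrier G \<and> (\<forall>i\<ge>0::int. (h \<up> i) x \<in> Q)"
proof -
  have "x \<in> Minus h Q \<longleftrightarrow> x \<in> carrier G \<and> (\<forall>i\<le>0::int. (h \<up> (- i)) x \<in> Q)"
    unfolding Minus_def using assms by (simp add: Plus_mem pw_minus)
  also have "\<dots> \<longleftrightarrow> x \<in> carrier G \<and> (\<forall>i\<ge>0::int. (h \<up> i) x \<in> Q)"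
    by (metis neg_0_le_iff_le neg_le_0_iff_le minus_minus)
  finally show ?thesis .
qed

lemma Plus_inv: "h \<in> carrier L \<Longrightarrow> Plus (inv\<^sub>L h) Q = Minus h Q"
  by (simp add: Minus_def)

lemma Minus_inv: "h \<in> carrier L \<Longrightarrow> Minus (inv\<^sub>L h) Q = Plus h Q"
  by (simp add: Minus_def)

lemma Plus_subset: "\<lbrakk>h \<in> carrier L; Q \<subseteq> carrier G\<rbrakk> \<Longrightarrow> Plus h Q \<subseteq> Q"
  by (metis Plus_mem order_refl pw_0 subsetI)

lemma Minus_subset: "\<lbrakk>h \<in> carrier L; Q \<subseteq> carrier G\<rbrakk> \<Longrightarrow> Minus h Q \<subseteq> Q"
  unfolding Minus_def by (simp add: Plus_subset)

lemma Plus_shift: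
  assumes "h \<in> carrier L" "Q \<subseteq> carrier G" "x \<in> Plus h Q" "i \<le> 0"
  shows "(h \<up> i) x \<in> Plus h Q"
  using assms by (auto simp: Plus_mem pw_add)

lemma Minus_shift:
  assumes "h \<in> carrier L" "Q \<subseteq> carrier G" "x \<in> Minus h Q" "i \<ge> 0"
  shows "(h \<up> i) x \<in> Minus h Q"
  using assms by (auto simp: Minus_mem pw_add)

lemma Plus_subgroup:
  assumes "h \<in> carrier L" "subgroup Q G" shows "subgroup (Plus h Q) G"
proof -
  have "subgroup (\<Inter>((\<lambda>i::int. (h \<up> i) ` Q) ` {0..})) G"
    by (rule subgroups_Inter) (use assms act_image_subgroup in auto)
  then show ?thesis by (simp add: Plus_def)
qed

lemma Minus_subgroup: "\<lbrakk>h \<in> carrier L; subgroup Q G\<rbrakk> \<Longrightarrow> subgroup (Minus h Q) G"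
  unfolding Minus_def by (simp add: Plus_subgroup)

lemma Plus_compact:
  assumes "h \<in> carrier L" "compactin T Q" shows "compactin T (Plus h Q)"
proof -
  have c: "compactin T ((h \<up> i) ` Q)" for i
    using assms by (simp add: act_image_compact)
  show ?thesis unfolding Plus_def
    by (rule closed_compactin_Inter[OF c[of 0]]) (use c compact_closed in blast)+
qed

lemma Minus_compact: "\<lbrakk>h \<in> carrier L; compactin T Q\<rbrakk> \<Longrightarrow> compactin T (Minus h Q)"
  unfolding Minus_def by (simp add: Plus_compact)

lemma tidy_forD:
  assumes "tidy_for h U"
  shows "subgroup U G" "compactin T U" "openin T U" "U \<subseteq> carrier G" "closedin T U"
    "U = Plus h U <#> Minus h U" "closedin T (Plus_plus h U)"
  using assms compact_closed compact_subset_carrier unfolding tidy_for_def by blast+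

section \<open>Points of a tidy subgroup with bounded orbits\<close>

lemma open_nbhd_one_compact_cover:
  assumes D: "compactin T D" and N: "openin T N" "\<one> \<in> N"
  obtains F where "finite F" "F \<subseteq> D" "D \<subseteq> (\<Union>a\<in>F. a <# N)"
proof -
  have Dc: "D \<subseteq> carrier G" using D compact_subset_carrier by blast
  have "\<And>V. V \<in> (\<lambda>a. a <# N) ` D \<Longrightarrow> openin T V" using open_lcoset N Dc by blast
  moreover have "D \<subseteq> \<Union>((\<lambda>a. a <# N) ` D)"
  proof
    fix x assume x: "x \<in> D"
    then have "x \<in> x <# N"
      using Dc N open_subset_carrier[OF N(1)] by (auto simp: l_coset_mem_iff)
    then show "x \<in> \<Union>((\<lambda>a. a <# N) ` D)" using x by blast
  qed
  ultimately obtain \<F> where "finite \<F>" "\<F> \<subseteq> (\<lambda>a. a <# N) ` D" "D \<subseteq> \<Union>\<F>"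
    using compactinD[OF D, of "(\<lambda>a. a <# N) ` D"] by blast
  then obtain F where F: "finite F" "F \<subseteq> D" "\<F> = (\<lambda>a. a <# N) ` F"
    by (meson finite_subset_image)
  then show thesis using that \<open>D \<subseteq> \<Union>\<F>\<close> by blast
qed

text \<open>Baire's theorem makes one member of the exhaustion relatively open; compactness then bounds the index.\<close>

lemma compact_group_exhaustion:
  fixes E :: "nat \<Rightarrow> 'a set"
  assumes D: "compactin T D" "subgroup D G"
    and E: "\<And>n. closedin T (E n)" "\<And>n. subgroup (E n) G" "incseq E" "D \<subseteq> (\<Union>n. E n)"
  obtains n where "D \<subseteq> E n"
proof -
  let ?X = "subtopology T D"
  have Dc: "D \<subseteq> carrier G" using D compact_subset_carrier by blast
  then have top: "topspace ?X = D" by (simp add: inf_absorb2)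
  have comp: "compact_space ?X" using D(1) compact_space_subtopology by blast
  have haus: "Hausdorff_space ?X" by (simp add: Hausdorff_T Hausdorff_space_subtopology)
  have lc: "locally_compact_space ?X \<and> regular_space ?X"
    using comp haus compact_Hausdorff_imp_regular_space compact_imp_locally_compact_space by blast
  have "?X interior_of \<Union>(range (\<lambda>n. D \<inter> E n)) \<noteq> {}"
  proof -
    have "\<Union>(range (\<lambda>n. D \<inter> E n)) = D" using E(4) by auto
    then have "?X interior_of \<Union>(range (\<lambda>n. D \<inter> E n)) = D"
      by (metis interior_of_topspace top)
    then show ?thesis using subgroup.one_closed[OF D(2)] by auto
  qed
  then have "\<not> (\<forall>S\<in>range (\<lambda>n. D \<inter> E n). closedin ?X S \<and> ?X interior_of S = {})"
    using Baire_category_alt[of ?X "range (\<lambda>n. D \<inter> E n)"] lc by auto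
  moreover have "closedin ?X (D \<inter> E n)" for n
    using E(1) closedin_subtopology by blast
  ultimately obtain m where m: "?X interior_of (D \<inter> E m) \<noteq> {}" by auto
  then obtain z V where zV: "openin ?X V" "z \<in> V" "V \<subseteq> D \<inter> E m"
    unfolding interior_of_def by auto
  then obtain W where W: "openin T W" "V = W \<inter> D" unfolding openin_subtopology by blast
  have z: "z \<in> D" "z \<in> E m" "z \<in> W" "z \<in> carrier G" using zV W Dc by auto
  define N where "N = inv z <# W"
  have N: "openin T N" unfolding N_def using open_lcoset W z by simp
  have Nmem: "x \<in> N \<longleftrightarrow> x \<in> carrier G \<and> z \<otimes> x \<in> W" for x
    unfolding N_def using l_coset_mem_iff[of "inv z" W x] open_subset_carrier[OF W(1)] z by simp
  have N1: "\<one> \<in> N" using z by (simp add: Nmem)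
  have NE: "x \<in> E m" if "x \<in> N" "x \<in> D" for x
  proof -
    have "z \<otimes> x \<in> W \<inter> D" using that z Nmem subgroup.m_closed[OF D(2)] by simp
    then have "z \<otimes> x \<in> E m" using zV W by blast
    then have "inv z \<otimes> (z \<otimes> x) \<in> E m"
      using z E(2) subgroup.m_closed subgroup.m_inv_closed by metis
    then show ?thesis using z that Dc by (simp add: m_assoc[symmetric] subset_iff)
  qed
  obtain F where F: "finite F" "F \<subseteq> D" "D \<subseteq> (\<Union>a\<in>F. a <# N)"
    using open_nbhd_one_compact_cover[OF D(1) N N1] .
  have "\<exists>k. a \<in> E k" if "a \<in> F" for a using that F E(4) by blast
  then obtain k where k: "\<And>a. a \<in> F \<Longrightarrow> a \<in> E (k a)" by metis
  define M where "M = Max (insert m (k ` F))"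
  have M: "m \<le> M" "\<And>a. a \<in> F \<Longrightarrow> k a \<le> M" unfolding M_def using F(1) by auto
  have EM: "E m \<subseteq> E M" "\<And>a. a \<in> F \<Longrightarrow> a \<in> E M"
    using M k incseqD[OF E(3)] by blast+
  have "D \<subseteq> E M"
  proof
    fix x assume x: "x \<in> D"
    then obtain a where a: "a \<in> F" "x \<in> a <# N" using F(3) by blast
    then have ax: "inv a \<otimes> x \<in> N" "a \<in> carrier G" "x \<in> carrier G"
      using l_coset_mem_iff[of a N x] open_subset_carrier[OF N] F(2) Dc by auto
    have "inv a \<otimes> x \<in> D" using x a F(2) D(2) by (meson subgroup.m_closed subgroup.m_inv_closed subsetD)
    then have "inv a \<otimes> x \<in> E M" using NE ax EM by blast
    then have "a \<otimes> (inv a \<otimes> x) \<in> E M" using EM(2)[OF a(1)] E(2) subgroup.m_closed by metis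
    then show "x \<in> E M" using ax by (simp add: m_assoc[symmetric])
  qed
  then show thesis using that by blast
qed

text \<open>The \<open>Minus\<close>-factor of \<open>x\<close> stays in \<open>U\<close>, so only
  the \<open>Plus\<close>-factor \<open>a\<close> matters. Its forward orbit lies in a compact part
  of the closed group \<open>Plus_plus h U\<close>, which is exhausted by the closed subgroups
  \<open>E n\<close>; compactness yields one delay \<open>N\<close> valid for the whole
  orbit.\<close>

lemma tidy_for_bounded_forward:
  assumes h: "h \<in> carrier L" and U: "tidy_for h U" and x: "x \<in> U"
    and C: "compactin T C" and orb: "\<And>i::int. i \<ge> 0 \<Longrightarrow> (h \<up> i) x \<in> C"
  shows "x \<in> Minus h U"
proof -
  note U' = tidy_forD[OF U]
  obtain a b where ab: "a \<in> Plus h U" "b \<in> Minus h U" "x = a \<otimes> b"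
    using x U'(6) set_mult_mem by metis
  have abU: "a \<in> U" "b \<in> U" using ab Plus_subset Minus_subset h U'(4) by blast+
  then have abc: "a \<in> carrier G" "b \<in> carrier G" "x \<in> carrier G" using U'(4) x by auto
  define E where "E n = {y \<in> carrier G. \<forall>i\<le>- int n. (h \<up> i) y \<in> U}" for n
  have Ealt: "E n = (\<Inter>i\<in>{int n..}. (h \<up> i) ` U)" for n
  proof -
    have "y \<in> (\<Inter>i\<in>{int n..}. (h \<up> i) ` U) \<longleftrightarrow> (\<forall>i\<ge>int n. y \<in> carrier G \<and> (h \<up> (- i)) y \<in> U)" for y
      using h U'(4) by (auto simp: act_image_mem_iff inv_pw)
    also have "\<dots> y \<longleftrightarrow> y \<in> E n" for y
      unfolding E_def by (auto simp: le_minus_iff minus_le_iff) (metis le_minus_iff minus_minus)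
    finally show ?thesis by blast
  qed
  have Ecl: "closedin T (E n)" for n
    unfolding Ealt by (rule closedin_INT) (use h U'(5) act_image_closed_set in auto)
  have Esub: "subgroup (E n) G" for n
  proof -
    have "subgroup (\<Inter>((\<lambda>i::int. (h \<up> i) ` U) ` {int n..})) G"
      by (rule subgroups_Inter) (use h U'(1) act_image_subgroup in auto)
    then show ?thesis by (simp add: Ealt)
  qed
  have Einc: "incseq E" unfolding incseq_def E_def by auto
  have PPE: "Plus_plus h U = (\<Union>n. E n)"
  proof
    show "Plus_plus h U \<subseteq> (\<Union>n. E n)"
    proof
      fix y assume "y \<in> Plus_plus h U"
      then obtain m :: int where "y \<in> carrier G" "\<forall>i\<le>m. (h \<up> i) y \<in> U" unfolding Plus_plus_def by auto
      then have "y \<in> E (nat (- m))" unfolding E_def by auto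
      then show "y \<in> (\<Union>n. E n)" by blast
    qed
    show "(\<Union>n. E n) \<subseteq> Plus_plus h U" unfolding Plus_plus_def E_def by auto
  qed
  have PPsub: "subgroup (Plus_plus h U) G"
  proof (rule subgroupI)
    show "Plus_plus h U \<subseteq> carrier G" unfolding Plus_plus_def by auto
    have "\<one> \<in> E 0" using Esub subgroup.one_closed by metis
    then show "Plus_plus h U \<noteq> {}" unfolding PPE by blast
    fix u assume u: "u \<in> Plus_plus h U"
    then obtain m where "u \<in> E m" unfolding PPE by blast
    then have "inv u \<in> E m" using Esub subgroup.m_inv_closed by metis
    then show "inv u \<in> Plus_plus h U" unfolding PPE by blast
    fix v assume v: "v \<in> Plus_plus h U"
    obtain m n where "u \<in> E m" "v \<in> E n" using u v unfolding PPE by blast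
    then have "u \<in> E (max m n)" "v \<in> E (max m n)"
      using incseqD[OF Einc] by (meson max.cobounded1 max.cobounded2 subsetD)+
    then have "u \<otimes> v \<in> E (max m n)" using Esub subgroup.m_closed by metis
    then show "u \<otimes> v \<in> Plus_plus h U" unfolding PPE by blast
  qed
  \<comment> \<open>On this compact group \<open>compact_group_exhaustion\<close> supplies a uniform
    delay \<open>M\<close>; finitely many cosets of \<open>U\<close> then carry a uniform delay over
    to \<open>C'\<close>.\<close>
  have Dcomp: "compactin T (U \<inter> Plus_plus h U)" using U'(2,7) compact_Int_closedin by blast
  have Dsub: "subgroup (U \<inter> Plus_plus h U) G" using U'(1) PPsub subgroups_Inter_pair by blast
  obtain M where M: "U \<inter> Plus_plus h U \<subseteq> E M"
    using compact_group_exhaustion[OF Dcomp Dsub Ecl Esub Einc] PPE by blast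
  define C' where "C' = (C <#> U) \<inter> Plus_plus h U"
  have C'comp: "compactin T C'"
    unfolding C'_def using compact_set_mult[OF C U'(2)] U'(7) compact_Int_closedin by blast
  have orb': "(h \<up> i) a \<in> C'" if i: "i \<ge> 0" for i :: int
  proof -
    have "(h \<up> i) x = (h \<up> i) a \<otimes> (h \<up> i) b" using ab abc h by simp
    then have "(h \<up> i) a = (h \<up> i) x \<otimes> inv ((h \<up> i) b)"
      using abc h by (simp add: m_assoc)
    moreover have "(h \<up> i) b \<in> U" using ab(2) Minus_mem[OF h U'(4)] i by blast
    ultimately have "(h \<up> i) a \<in> C <#> U"
      using orb[OF i] subgroup.m_inv_closed[OF U'(1)] unfolding set_mult_mem by blast
    moreover have "(h \<up> i) a \<in> Plus_plus h U"
    proof -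
      have "(h \<up> j) ((h \<up> i) a) \<in> U" if "j \<le> - i" for j
        using ab(1) that h abc Plus_mem[OF h U'(4)] by (simp add: pw_add)
      then show ?thesis unfolding Plus_plus_def using h abc by auto
    qed
    ultimately show ?thesis unfolding C'_def by blast
  qed
  obtain F where F: "finite F" "F \<subseteq> C'" "C' \<subseteq> F <#> U"
    using finite_coset_cover[OF C'comp U'(3,1)] .
  have "\<exists>k. f \<in> E k" if "f \<in> F" for f using that F(2) PPE unfolding C'_def by blast
  then obtain k where k: "\<And>f. f \<in> F \<Longrightarrow> f \<in> E (k f)" by metis
  define N where "N = Max (insert M (k ` F))"
  have N: "M \<le> N" "\<And>f. f \<in> F \<Longrightarrow> k f \<le> N" unfolding N_def using F(1) by auto
  have EN: "E M \<subseteq> E N" "\<And>f. f \<in> F \<Longrightarrow> f \<in> E N"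
    using N k incseqD[OF Einc] by blast+
  have C'N: "y \<in> E N" if y: "y \<in> C'" for y
  proof -
    obtain f u where fu: "f \<in> F" "u \<in> U" "y = f \<otimes> u" using F(3) y set_mult_mem[of y F U] by blast
    have fc: "f \<in> carrier G" "u \<in> carrier G" using fu F(2) C'comp compact_subset_carrier U'(4) by blast+
    have "inv f \<otimes> y \<in> Plus_plus h U"
      using PPsub fu F(2) y unfolding C'_def by (meson Int_iff subgroup.m_closed subgroup.m_inv_closed subsetD)
    then have "u \<in> Plus_plus h U" using fu fc by (simp add: m_assoc[symmetric])
    then have "u \<in> E N" using fu M EN by blast
    then show ?thesis using EN(2) fu Esub subgroup.m_closed by metis
  qed
  \<comment> \<open>The iterate \<open>i + N\<close> lies in \<open>E N\<close>, so the point
    \<open>N\<close> steps earlier, which is the iterate \<open>i\<close>, lies in \<open>U\<close>: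
    running ahead cancels the delay.\<close>
  have "(h \<up> i) a \<in> U" if "i \<ge> 0" for i :: int
  proof -
    have "(h \<up> (i + int N)) a \<in> E N" using orb'[of "i + int N"] C'N that by simp
    then have "(h \<up> (- int N)) ((h \<up> (i + int N)) a) \<in> U" unfolding E_def by blast
    then show ?thesis using h abc by (simp add: pw_add)
  qed
  then have "a \<in> Minus h U" using Minus_mem[OF h U'(4)] abc by blast
  then show ?thesis using ab Minus_subgroup[OF h U'(1)] subgroup.m_closed by metis
qed

lemma tidy_allD:
  assumes "U \<in> tidy_all"
  shows "subgroup U G" "compactin T U" "openin T U" "U \<subseteq> carrier G" "closedin T U"
  using assms tidy_forD[of "\<one>\<^bsub>L\<^esub>" U] unfolding tidy_all_def by auto

lemma tidy_all_tidy_for: "\<lbrakk>U \<in> tidy_all; h \<in> carrier L\<rbrakk> \<Longrightarrow> tidy_for h U"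
  unfolding tidy_all_def by blast

lemma tidy_decomp:
  assumes "U \<in> tidy_all" "h \<in> carrier L" shows "U = Plus h U <#> Minus h U"
  using tidy_forD(6)[OF tidy_all_tidy_for[OF assms]] .

lemma tidy_forward:
  assumes "U \<in> tidy_all" "h \<in> carrier L" "x \<in> U" "compactin T C"
    "\<And>i::int. i \<ge> 0 \<Longrightarrow> (h \<up> i) x \<in> C"
  shows "x \<in> Minus h U"
  using tidy_for_bounded_forward[OF assms(2) tidy_all_tidy_for[OF assms(1,2)] assms(3,4)] assms(5) by blast

lemma tidy_backward:
  assumes "U \<in> tidy_all" "h \<in> carrier L" "x \<in> U" "compactin T C"
    "\<And>i::int. i \<le> 0 \<Longrightarrow> (h \<up> i) x \<in> C"
  shows "x \<in> Plus h U"
proof -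
  have "x \<in> Minus (inv\<^sub>L h) U"
    by (rule tidy_forward[OF assms(1) _ assms(3,4)]) (use assms(2,5) in \<open>simp_all add: pw_minus\<close>)
  then show ?thesis using assms(2) by (simp add: Minus_inv)
qed


section \<open>Intersections of tidy subgroups\<close>

lemma Plus_Int:
  assumes "h \<in> carrier L" "U \<subseteq> carrier G" "W \<subseteq> carrier G"
  shows "Plus h (U \<inter> W) = Plus h U \<inter> Plus h W"
proof -
  have "U \<inter> W \<subseteq> carrier G" using assms by blast
  then show ?thesis using assms by (auto simp: Plus_mem)
qed

lemma Minus_Int:
  assumes "h \<in> carrier L" "U \<subseteq> carrier G" "W \<subseteq> carrier G"
  shows "Minus h (U \<inter> W) = Minus h U \<inter> Minus h W"
  unfolding Minus_def using assms Plus_Int by simp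

lemma Plus_plus_Int: "Plus_plus h (U \<inter> W) = Plus_plus h U \<inter> Plus_plus h W"
proof
  show "Plus_plus h (U \<inter> W) \<subseteq> Plus_plus h U \<inter> Plus_plus h W" unfolding Plus_plus_def by auto
  show "Plus_plus h U \<inter> Plus_plus h W \<subseteq> Plus_plus h (U \<inter> W)"
  proof
    fix x assume "x \<in> Plus_plus h U \<inter> Plus_plus h W"
    then obtain m n :: int where "x \<in> carrier G" "\<forall>i\<le>m. (h \<up> i) x \<in> U" "\<forall>i\<le>n. (h \<up> i) x \<in> W"
      unfolding Plus_plus_def by auto
    then show "x \<in> Plus_plus h (U \<inter> W)" unfolding Plus_plus_def by (auto intro!: exI[of _ "min m n"])
  qed
qed

definition Core :: "('a \<Rightarrow> 'a) \<Rightarrow> 'a set \<Rightarrow> 'a set" where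
  "Core h U = Plus h U \<inter> Minus h U"

lemma Core_mem:
  assumes "h \<in> carrier L" "Q \<subseteq> carrier G"
  shows "x \<in> Core h Q \<longleftrightarrow> x \<in> carrier G \<and> (\<forall>i::int. (h \<up> i) x \<in> Q)"
  unfolding Core_def using assms by (auto simp: Plus_mem Minus_mem) (metis linorder_le_cases)

lemma Core_shift:
  assumes "h \<in> carrier L" "Q \<subseteq> carrier G" "x \<in> Core h Q"
  shows "(h \<up> i) x \<in> Core h Q"
  using assms by (auto simp: Core_mem pw_add)

lemma Core_subgroup: "\<lbrakk>h \<in> carrier L; subgroup Q G\<rbrakk> \<Longrightarrow> subgroup (Core h Q) G"
  unfolding Core_def by (simp add: Plus_subgroup Minus_subgroup subgroups_Inter_pair)

lemma Core_subset: "\<lbrakk>h \<in> carrier L; Q \<subseteq> carrier G\<rbrakk> \<Longrightarrow> Core h Q \<subseteq> Q"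
  unfolding Core_def using Plus_subset by blast

lemma set_mult_subset: "\<lbrakk>subgroup S G; A \<subseteq> S; B \<subseteq> S\<rbrakk> \<Longrightarrow> A <#> B \<subseteq> S"
  unfolding set_mult_def by (auto intro: subgroup.m_closed)

lemma set_mult_mono: "\<lbrakk>A \<subseteq> A'; B \<subseteq> B'\<rbrakk> \<Longrightarrow> A <#> B \<subseteq> A' <#> B'"
  unfolding set_mult_def by blast

text \<open>
  The two decompositions of a point of \<open>U \<inter> W\<close> differ by an element \<open>y\<close> with bounded orbit.  Backward iterates
  of \<open>y\<close> approach the product of the two cores, hence eventually lie in it; this allows correcting the
  decomposition along \<open>U\<close> so that its factors lie in \<open>W\<close> as well.
\<close>

lemma tidy_Int_decomp:
  assumes U: "U \<in> tidy_all" and W: "W \<in> tidy_all" and h: "h \<in> carrier L" and x: "x \<in> U \<inter> W"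
  shows "x \<in> Plus h (U \<inter> W) <#> Minus h (U \<inter> W)"
proof -
  note U' = tidy_allD[OF U] and W' = tidy_allD[OF W]
  obtain u1 u2 where u: "u1 \<in> Plus h U" "u2 \<in> Minus h U" "x = u1 \<otimes> u2"
    using x tidy_decomp[OF U h] set_mult_mem by (metis IntD1)
  obtain w1 w2 where w: "w1 \<in> Plus h W" "w2 \<in> Minus h W" "x = w1 \<otimes> w2"
    using x tidy_decomp[OF W h] set_mult_mem by (metis IntD2)
  have c: "u1 \<in> carrier G" "u2 \<in> carrier G" "w1 \<in> carrier G" "w2 \<in> carrier G" "x \<in> carrier G"
    using u w x U'(4) W'(4) Plus_subset[OF h] Minus_subset[OF h] by blast+
  define y where "y = inv w1 \<otimes> u1"
  have y: "y \<in> carrier G" "y = inv w1 \<otimes> u1" "y = w2 \<otimes> inv u2"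
  proof -
    have "w1 \<otimes> w2 = u1 \<otimes> u2" using u w by simp
    then have "inv w1 \<otimes> (u1 \<otimes> u2) = w2" using c by (metis inv_closed inv_solve_left' m_closed)
    then have "y \<otimes> u2 = w2" unfolding y_def using c by (simp add: m_assoc)
    then show "y = w2 \<otimes> inv u2" unfolding y_def using c by (simp add: m_assoc inv_solve_right)
  qed (use c y_def in auto)
  have bck: "(h \<up> i) y \<in> (h \<up> i) ` Plus h W <#> (h \<up> i) ` Plus h U" for i :: int
  proof -
    have "(h \<up> i) y = (h \<up> i) (inv w1) \<otimes> (h \<up> i) u1" using c h y(2) by simp
    then show ?thesis
      using subgroup.m_inv_closed[OF Plus_subgroup[OF h W'(1)] w(1)] u(1) unfolding set_mult_mem by blast
  qed
  have orbWU: "(h \<up> i) y \<in> W <#> U" for i :: int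
  proof (cases "i \<le> 0")
    case True
    have "(h \<up> i) ` Plus h W \<subseteq> W" "(h \<up> i) ` Plus h U \<subseteq> U"
      using True Plus_mem[OF h W'(4)] Plus_mem[OF h U'(4)] by auto
    then show ?thesis using bck[of i] set_mult_mono by blast
  next
    case False
    have "(h \<up> i) w2 \<in> W" "(h \<up> i) (inv u2) \<in> U"
      using False w(2) subgroup.m_inv_closed[OF Minus_subgroup[OF h U'(1)] u(2)]
        Minus_mem[OF h W'(4)] Minus_mem[OF h U'(4)] by auto
    moreover have "(h \<up> i) y = (h \<up> i) w2 \<otimes> (h \<up> i) (inv u2)"
      using y(3) c h by simp
    ultimately show ?thesis unfolding set_mult_mem by blast
  qed
  define A B where "A n = (h \<up> (- int n)) ` Plus h W" and "B n = (h \<up> (- int n)) ` Plus h U" for n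
  have dec: "decseq (\<lambda>n. (h \<up> (- int n)) ` Plus h Q)" if Q: "Q \<subseteq> carrier G" for Q
  proof (rule decseq_SucI)
    fix n
    show "(h \<up> (- int (Suc n))) ` Plus h Q \<subseteq> (h \<up> (- int n)) ` Plus h Q"
    proof
      fix z assume "z \<in> (h \<up> (- int (Suc n))) ` Plus h Q"
      then obtain v where v: "v \<in> Plus h Q" "z = (h \<up> (- int (Suc n))) v" by blast
      have "v \<in> carrier G" using v Plus_subset[OF h Q] Q by blast
      then have "z = (h \<up> (- int n)) ((h \<up> (-1)) v)"
        using v h by (simp add: pw_add algebra_simps)
      moreover have "(h \<up> (-1)) v \<in> Plus h Q" using Plus_shift[OF h Q v(1), of "-1"] by simp
      ultimately show "z \<in> (h \<up> (- int n)) ` Plus h Q" by blast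
    qed
  qed
  have int: "(\<Inter>n. (h \<up> (- int n)) ` Plus h Q) \<subseteq> Core h Q" if Q: "Q \<subseteq> carrier G" for Q
  proof
    fix z assume z: "z \<in> (\<Inter>n. (h \<up> (- int n)) ` Plus h Q)"
    have Pc: "Plus h Q \<subseteq> carrier G" using Plus_subset[OF h Q] Q by blast
    have zn: "z \<in> carrier G \<and> (h \<up> (int n)) z \<in> Plus h Q" for n
      using z act_image_mem_iff[OF _ Pc, of "h \<up> (- int n)" z] h by (simp add: inv_pw)
    have "(h \<up> i) z \<in> Q" for i :: int
    proof (cases "i \<ge> 0")
      case True
      then show ?thesis using zn[of "nat i"] Plus_subset[OF h Q] by auto
    next
      case False
      then show ?thesis using zn[of 0] Plus_mem[OF h Q, of z] by auto
    qed
    then show "z \<in> Core h Q" using Core_mem[OF h Q] zn by blast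
  qed
  have "(\<Inter>n. A n <#> B n) = (\<Inter>n. A n) <#> (\<Inter>n. B n)"
    unfolding A_def B_def
    by (rule set_mult_INT_compact) (use h U' W' dec Plus_compact act_image_compact in auto)
  also have "\<dots> \<subseteq> Core h W <#> U"
  proof (rule set_mult_mono)
    show "(\<Inter>n. A n) \<subseteq> Core h W" unfolding A_def using int W' by blast
    show "(\<Inter>n. B n) \<subseteq> U"
      unfolding B_def using int[OF U'(4)] Core_subset[OF h U'(4)] by (rule subset_trans)
  qed
  finally have sub: "(\<Inter>n. A n <#> B n) \<subseteq> Core h W <#> U" .
  have CW: "Core h W \<subseteq> carrier G" using Core_subset[OF h W'(4)] W'(4) by blast
  obtain n where n: "A n <#> B n \<subseteq> Core h W <#> U"
  proof (rule compact_chain_subset_open[OF _ _ open_set_mult_right[OF CW U'(3)] sub])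
    show "compactin T (A n <#> B n)" for n
      unfolding A_def B_def using h U' W' Plus_compact act_image_compact compact_set_mult by auto
    show "decseq (\<lambda>n. A n <#> B n)"
      using dec[OF W'(4)] dec[OF U'(4)] set_mult_mono unfolding A_def B_def decseq_def by meson
  qed
  then obtain w0 v where wv: "w0 \<in> Core h W" "v \<in> U" "(h \<up> (- int n)) y = w0 \<otimes> v"
    using subsetD[OF n[unfolded A_def B_def] bck] unfolding set_mult_mem by blast
  have wvc: "w0 \<in> carrier G" "v \<in> carrier G" using wv CW U' by blast+
  \<comment> \<open>A point of \<open>U\<close> whose orbit is bounded in both directions lies in
    the core; this upgrades \<open>v\<close> from \<open>U\<close> to
    \<open>Core h U\<close>.\<close>
  have vorb: "(h \<up> i) v \<in> W <#> (W <#> U)" for i :: int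
  proof -
    have "v = inv w0 \<otimes> (h \<up> (- int n)) y" using wv wvc by (simp add: m_assoc[symmetric])
    then have "(h \<up> i) v = (h \<up> i) (inv w0) \<otimes> (h \<up> (i - int n)) y"
      using wvc h y(1) pw_add[OF h y(1), of i "- int n"] by simp
    moreover have "(h \<up> i) (inv w0) \<in> W"
      using subgroup.m_inv_closed[OF Core_subgroup[OF h W'(1)] wv(1)] Core_mem[OF h W'(4)] by blast
    ultimately show ?thesis using orbWU[of "i - int n"] set_mult_mem[of _ W "W <#> U"] by blast
  qed
  have WWU: "compactin T (W <#> (W <#> U))" using U' W' compact_set_mult by blast
  have v0: "v \<in> Core h U"
    unfolding Core_def using tidy_backward[OF U h wv(2) WWU vorb] tidy_forward[OF U h wv(2) WWU vorb] by blast
  define w' u' where "w' = (h \<up> (int n)) w0" and "u' = (h \<up> (int n)) v"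
  have w'u': "w' \<in> Core h W" "u' \<in> Core h U" "w' \<in> carrier G" "u' \<in> carrier G"
    unfolding w'_def u'_def using wv v0 Core_shift h U' W' wvc by auto
  have yw'u': "y = w' \<otimes> u'"
  proof -
    have "y = (h \<up> (int n)) ((h \<up> (- int n)) y)" using h y by (simp add: pw_add)
    then show ?thesis using wv wvc h unfolding w'_def u'_def by simp
  qed
  \<comment> \<open>\<open>a\<close> also equals \<open>w1 \<otimes> w'\<close> and \<open>b\<close>
    also equals \<open>inv w' \<otimes> w2\<close>, so this one factorization of \<open>x\<close>
    can be read along \<open>U\<close> and along \<open>W\<close>.\<close>
  define a b where "a = u1 \<otimes> inv u'" and "b = u' \<otimes> u2"
  have "a = w1 \<otimes> w'"
  proof -
    have "u1 = w1 \<otimes> y" unfolding y(2) using c by (simp add: m_assoc[symmetric])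
    then have "u1 = w1 \<otimes> w' \<otimes> u'" using yw'u' c w'u' by (simp add: m_assoc)
    then show ?thesis unfolding a_def using c w'u' by (simp add: m_assoc)
  qed
  moreover have "b = inv w' \<otimes> w2"
  proof -
    have "w2 = y \<otimes> u2" unfolding y(3) using c by (simp add: m_assoc)
    then have "w2 = w' \<otimes> (u' \<otimes> u2)" using yw'u' c w'u' by (simp add: m_assoc)
    then show ?thesis unfolding b_def using c w'u' by (simp add: m_assoc[symmetric])
  qed
  ultimately have "a \<in> Plus h U \<inter> Plus h W" "b \<in> Minus h U \<inter> Minus h W"
    using u w w'u'(1,2) Plus_subgroup[OF h U'(1)] Plus_subgroup[OF h W'(1)] Minus_subgroup[OF h U'(1)]
      Minus_subgroup[OF h W'(1)] unfolding Core_def a_def b_def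
    by (metis Int_iff subgroup.m_closed subgroup.m_inv_closed)+
  moreover have "x = a \<otimes> b"
  proof -
    have "inv u' \<otimes> (u' \<otimes> u2) = u2" using c w'u' by (simp add: m_assoc[symmetric])
    then show ?thesis unfolding a_def b_def using u c w'u' by (simp add: m_assoc)
  qed
  ultimately show ?thesis
    unfolding set_mult_mem Plus_Int[OF h U'(4) W'(4)] Minus_Int[OF h U'(4) W'(4)] by blast
qed

lemma tidy_Int: assumes "U \<in> tidy_all" "W \<in> tidy_all" shows "U \<inter> W \<in> tidy_all"
  unfolding tidy_all_def
proof (intro CollectI ballI)
  fix h assume h: "h \<in> carrier L"
  note U' = tidy_allD[OF assms(1)] and W' = tidy_allD[OF assms(2)]
  have s: "subgroup (U \<inter> W) G" using U' W' subgroups_Inter_pair by blast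
  have c: "U \<inter> W \<subseteq> carrier G" using U' by blast
  have "Plus h (U \<inter> W) <#> Minus h (U \<inter> W) \<subseteq> U \<inter> W"
    by (rule set_mult_subset[OF s Plus_subset[OF h c] Minus_subset[OF h c]])
  then have "U \<inter> W = Plus h (U \<inter> W) <#> Minus h (U \<inter> W)"
    using tidy_Int_decomp[OF assms h] by blast
  moreover have "compactin T (U \<inter> W)" "openin T (U \<inter> W)"
    using U' W' compact_Int_closedin openin_Int by blast+
  moreover have "closedin T (Plus_plus h (U \<inter> W))"
    unfolding Plus_plus_Int using tidy_forD(7) tidy_all_tidy_for[OF _ h] assms closedin_Int by blast
  ultimately show "tidy_for h (U \<inter> W)" unfolding tidy_for_def using s by blast
qed


section \<open>Automorphisms fixing an open subgroup\<close>

lemma act_image_lcoset: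
  "\<lbrakk>h \<in> carrier L; a \<in> carrier G; D \<subseteq> carrier G\<rbrakk> \<Longrightarrow> h ` (a <# D) = h a <# h ` D"
  unfolding l_coset_eq_image image_image by (rule image_cong) auto

lemma lcoset_self: "\<lbrakk>subgroup D G; a \<in> carrier G\<rbrakk> \<Longrightarrow> a \<in> a <# D"
  by (simp add: l_coset_mem_iff subgroup.subset subgroup.one_closed)

text \<open>An automorphism that expands a compact group but fixes an open subgroup of it permutes the finitely many cosets.\<close>

lemma expanding_fixing_open:
  assumes h: "h \<in> carrier L" and A: "subgroup A G" "compactin T A" and D: "subgroup D G" "openin T D" "D \<subseteq> A"
    and hD: "h ` D = D" and exp: "A \<subseteq> h ` A"
  shows "h ` A = A"
proof
  let ?c = "\<lambda>y. y <# D"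
  have Ac: "A \<subseteq> carrier G" "D \<subseteq> carrier G" using A D subgroup.subset by blast+
  have fin: "finite (?c ` A)" using finite_cosets[OF A(2) D(2,1)] .
  have "?c ` (h ` A) = (`) h ` ?c ` A"
    unfolding image_image
    by (rule image_cong) (use act_image_lcoset[OF h _ Ac(2)] hD Ac in auto)
  then have "card (?c ` (h ` A)) \<le> card (?c ` A)" using card_image_le[OF fin] by simp
  moreover have "finite (?c ` (h ` A))" using \<open>?c ` (h ` A) = (`) h ` ?c ` A\<close> fin by simp
  moreover have "?c ` A \<subseteq> ?c ` (h ` A)" using exp by blast
  ultimately have eq: "?c ` A = ?c ` (h ` A)" by (metis card_seteq)
  show "h ` A \<subseteq> A"
  proof
    fix y assume y: "y \<in> h ` A"
    then obtain a where a: "a \<in> A" "y <# D = a <# D" using eq by (metis (no_types, lifting) imageE imageI)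
    have "y \<in> carrier G" using y act_image_closed[OF h Ac(1)] by blast
    then have "y \<in> a <# D" using lcoset_self[OF D(1)] a(2) by blast
    then show "y \<in> A" using a(1) D(3) subgroup.m_closed[OF A(1)] by (auto simp: l_coset_eq_image)
  qed
qed (rule exp)

lemma image_eq_pw:
  assumes h: "h \<in> carrier L" and A: "A \<subseteq> carrier G" and eq: "h ` A = A"
  shows "(h \<up> i) ` A = A"
proof -
  have nat: "(g [^]\<^bsub>L\<^esub> (n::nat)) ` A = A" if g: "g \<in> carrier L" "g ` A = A" for g n
  proof (induction n)
    case 0
    show ?case using act_image_one[OF A] by simp
  next
    case (Suc n)
    then show ?case using g act_image_mult[OF _ g(1) A, of "g [^]\<^bsub>L\<^esub> n"] by simp
  qed
  have "(inv\<^sub>L h) ` A = A" using act_image_inv_left[OF h A] eq by simp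
  then have "((inv\<^sub>L h) \<up> (int n)) ` A = A" for n
    using nat h unfolding int_pow_int by blast
  moreover have "(h \<up> (int n)) ` A = A" for n
    using nat[OF h eq] unfolding int_pow_int .
  ultimately show ?thesis
    by (cases i rule: int_cases2) (simp_all only: pw_minus[OF h])
qed

lemma Plus_expanding: 
  assumes "h \<in> carrier L" "Q \<subseteq> carrier G" shows "Plus h Q \<subseteq> h ` Plus h Q"
proof
  fix x assume x: "x \<in> Plus h Q"
  have c: "Plus h Q \<subseteq> carrier G" using Plus_subset[OF assms] assms(2) by blast
  have "(inv\<^sub>L h) x \<in> Plus h Q" using Plus_shift[OF assms x, of "-1"] assms(1) by (simp add: pw_m1)
  then show "x \<in> h ` Plus h Q" using act_image_mem_iff[OF assms(1) c] x c by blast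
qed

text \<open>\<open>Plus h U\<close> is expanded by \<open>h\<close> and contains \<open>D\<close>,
  whose full orbit stays in \<open>U\<close>; \<open>expanding_fixing_open\<close> makes the
  expansion an equality. The same for \<open>inv\<^sub>L h\<close> settles \<open>Minus h U\<close>,
  and \<open>U\<close> is the product of the two.\<close>

lemma tidy_for_fixes_if_fixes_open:
  assumes h: "h \<in> carrier L" and U: "tidy_for h U" and D: "subgroup D G" "openin T D" "D \<subseteq> U" "h ` D = D"
  shows "h ` U = U"
proof -
  note U' = tidy_forD[OF U]
  have Dc: "D \<subseteq> carrier G" using D U' by blast
  have fixP: "g ` Plus g U = Plus g U" if g: "g \<in> carrier L" "g ` D = D" for g
  proof (rule expanding_fixing_open[OF g(1) _ _ D(1,2) _ g(2)])
    show "subgroup (Plus g U) G" "compactin T (Plus g U)" "Plus g U \<subseteq> g ` Plus g U"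
      using g U' Plus_subgroup Plus_compact Plus_expanding by auto
    show "D \<subseteq> Plus g U"
    proof
      fix x assume "x \<in> D"
      then have "(g \<up> i) x \<in> D" for i using image_eq_pw[OF g(1) Dc g(2), of i] by blast
      then show "x \<in> Plus g U" using Plus_mem[OF g(1) U'(4)] \<open>x \<in> D\<close> D(3) U'(4) by blast
    qed
  qed
  have hinv: "inv\<^sub>L h \<in> carrier L" "(inv\<^sub>L h) ` D = D"
    using act_image_inv_left[OF h Dc] D(4) h by auto
  have P: "h ` Plus h U = Plus h U" using fixP[OF h D(4)] .
  have Mc: "Minus h U \<subseteq> carrier G" "Plus h U \<subseteq> carrier G"
    using Minus_subset[OF h U'(4)] Plus_subset[OF h U'(4)] U'(4) by auto
  have "(inv\<^sub>L h) ` Minus h U = Minus h U" using fixP[OF hinv] h by (simp add: Plus_inv)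
  then have M: "h ` Minus h U = Minus h U" using act_image_inv_right[OF h Mc(1)] by simp
  have "h ` (Plus h U <#> Minus h U) = Plus h U <#> Minus h U"
    using act_image_set_mult[OF h Mc(2,1)] P M by simp
  then show ?thesis using U'(6) by simp
qed

text \<open>Points of \<open>U \<inter> W\<close> have their orbits in the compact \<open>U\<close>,
  so tidiness of \<open>W\<close> keeps these orbits in \<open>W\<close>; thus
  \<open>U \<inter> W\<close> is an open subgroup fixed by \<open>h\<close>. Consequently the
  uniscalar part can be read off from any tidy subgroup, and in a compact group, with the whole
  group as \<open>U\<close>, every tidy subgroup is invariant.\<close>

lemma tidy_fixes_transfer:
  assumes U: "U \<in> tidy_all" and W: "W \<in> tidy_all" and h: "h \<in> carrier L" and hU: "h ` U = U"
  shows "h ` W = W"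
proof (rule tidy_for_fixes_if_fixes_open[OF h tidy_all_tidy_for[OF W h]])
  note U' = tidy_allD[OF U] and W' = tidy_allD[OF W]
  show "subgroup (U \<inter> W) G" "openin T (U \<inter> W)" "U \<inter> W \<subseteq> W"
    using U' W' subgroups_Inter_pair by blast+
  have orb: "(h \<up> i) x \<in> U" if "x \<in> U" for x i
    using image_eq_pw[OF h U'(4) hU, of i] that by blast
  have core: "U \<inter> W \<subseteq> Core h W"
  proof
    fix x assume "x \<in> U \<inter> W"
    then show "x \<in> Core h W"
      unfolding Core_def using tidy_forward[OF W h _ U'(2)] tidy_backward[OF W h _ U'(2)] orb by blast
  qed
  have 1: "h x \<in> U \<inter> W" "(inv\<^sub>L h) x \<in> U \<inter> W" if "x \<in> U \<inter> W" for x
  proof -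
    have "(h \<up> i) x \<in> U \<inter> W" for i
      using that core Core_mem[OF h W'(4)] orb by blast
    from this[of 1] this[of "-1"] show "h x \<in> U \<inter> W" "(inv\<^sub>L h) x \<in> U \<inter> W"
      using h by (simp_all add: pw_m1)
  qed
  show "h ` (U \<inter> W) = U \<inter> W"
  proof
    show "h ` (U \<inter> W) \<subseteq> U \<inter> W" using 1 by blast
    show "U \<inter> W \<subseteq> h ` (U \<inter> W)"
      using 1(2) act_image_mem_iff[OF h, of "U \<inter> W"] U'(4) by blast
  qed
qed

end

section \<open>Homogeneous length functions\<close>

text \<open>Homogeneity absorbs additive errors: an estimate for all multiples, up to a constant,
  becomes exact.\<close>

lemma le_if_linear_bound:
  fixes a b c :: real
  assumes "\<And>n::nat. real n * a \<le> c + real n * b" shows "a \<le> b"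
proof (rule ccontr)
  assume "\<not> a \<le> b"
  then obtain n :: nat where "c < real n * (a - b)" using reals_Archimedean3[of "a - b"] by auto
  then show False using assms[of n] by (simp add: algebra_simps)
qed

locale homogeneous_length = group G for G (structure) +
  fixes l :: "'a \<Rightarrow> real"
  assumes l_mult: "\<lbrakk>x \<in> carrier G; y \<in> carrier G\<rbrakk> \<Longrightarrow> l (x \<otimes> y) \<le> l x + l y"
    and l_pow: "x \<in> carrier G \<Longrightarrow> l (x [^] (n::nat)) = real n * l x"
    and l_inv: "x \<in> carrier G \<Longrightarrow> l (inv x) = l x"
begin

lemma l_one: "l \<one> = 0" using l_pow[of "\<one>" 0] by simp

lemma l_nonneg: "x \<in> carrier G \<Longrightarrow> 0 \<le> l x"
  using l_mult[of x "inv x"] l_inv l_one by simp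

lemma conj_pow: "\<lbrakk>g \<in> carrier G; x \<in> carrier G\<rbrakk> \<Longrightarrow> (g \<otimes> x \<otimes> inv g) [^] (n::nat) = g \<otimes> x [^] n \<otimes> inv g"
proof (induction n)
  case (Suc n)
  have "inv g \<otimes> (g \<otimes> (x \<otimes> inv g)) = x \<otimes> inv g" using Suc.prems by (simp add: m_assoc[symmetric])
  then show ?case using Suc by (simp add: m_assoc)
qed simp

text \<open>A power of a conjugate is a conjugate of the power, so the two lengths differ by a
  bounded amount while both grow linearly.\<close>

lemma l_conj_le: assumes "g \<in> carrier G" "x \<in> carrier G" shows "l (g \<otimes> x \<otimes> inv g) \<le> l x"
proof (rule le_if_linear_bound)
  fix n
  have "real n * l (g \<otimes> x \<otimes> inv g) = l (g \<otimes> x [^] n \<otimes> inv g)"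
    using assms by (simp flip: l_pow conj_pow)
  also have "\<dots> \<le> l g + l (x [^] n) + l (inv g)"
    using l_mult[of "g \<otimes> x [^] n" "inv g"] l_mult[of g "x [^] n"] assms by simp
  finally show "real n * l (g \<otimes> x \<otimes> inv g) \<le> (l g + l (inv g)) + real n * l x"
    using l_pow[OF assms(2)] by simp
qed

lemma l_conj: assumes "g \<in> carrier G" "x \<in> carrier G" shows "l (g \<otimes> x \<otimes> inv g) = l x"
proof (rule antisym)
  have "inv g \<otimes> (g \<otimes> x \<otimes> inv g) \<otimes> inv (inv g) = x"
    using assms by (simp add: m_assoc inv_solve_left')
  then show "l x \<le> l (g \<otimes> x \<otimes> inv g)"
    using l_conj_le[of "inv g" "g \<otimes> x \<otimes> inv g"] assms by simp
qed (rule l_conj_le[OF assms])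

lemma l_swap: assumes "x \<in> carrier G" "y \<in> carrier G" shows "l (x \<otimes> y) = l (y \<otimes> x)"
proof -
  have "x \<otimes> y = x \<otimes> (y \<otimes> x) \<otimes> inv x" using assms by (simp add: m_assoc)
  then show ?thesis using l_conj assms by simp
qed

text \<open>\<open>x\<close> is conjugate to \<open>w y\<close> and to \<open>z w^-1\<close>. Up to
  bounded factors, \<open>x^(2n)\<close> is therefore \<open>(w y)^n r (z w^-1)^n\<close>. Raising
  \<open>n\<close> by one encloses the middle part in \<open>y\<close> and \<open>z\<close> and then
  in a conjugation by \<open>w\<close>, which is free; so the length is at most
  \<open>n (l y + l z)\<close> plus a constant.\<close>

lemma l_le_average:
  assumes c: "x \<in> carrier G" "s \<in> carrier G" "t \<in> carrier G" "w \<in> carrier G" "y \<in> carrier G" "z \<in> carrier G"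
    and xs: "x = s \<otimes> (w \<otimes> y) \<otimes> inv s" and xt: "x = t \<otimes> (z \<otimes> inv w) \<otimes> inv t"
  shows "l x \<le> (l y + l z) / 2"
proof -
  define r where "r = inv s \<otimes> t"
  have rc: "r \<in> carrier G" unfolding r_def using c by simp
  have P: "l ((w \<otimes> y) [^] n \<otimes> r \<otimes> (z \<otimes> inv w) [^] n) \<le> real n * (l y + l z) + l r" for n :: nat
  proof (induction n)
    case 0
    then show ?case using rc by simp
  next
    case (Suc n)
    define M where "M = (w \<otimes> y) [^] n \<otimes> r \<otimes> (z \<otimes> inv w) [^] n"
    have Mc: "M \<in> carrier G" unfolding M_def using c rc by simp
    have "(w \<otimes> y) [^] Suc n \<otimes> r \<otimes> (z \<otimes> inv w) [^] Suc n = (w \<otimes> y) \<otimes> M \<otimes> (z \<otimes> inv w)"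
      unfolding M_def nat_pow_Suc2[of "w \<otimes> y", OF m_closed[OF c(4,5)]] unfolding nat_pow_Suc
      using c rc by (simp add: m_assoc)
    also have "\<dots> = w \<otimes> (y \<otimes> M \<otimes> z) \<otimes> inv w" using c Mc by (simp add: m_assoc)
    finally have "l ((w \<otimes> y) [^] Suc n \<otimes> r \<otimes> (z \<otimes> inv w) [^] Suc n) = l (y \<otimes> M \<otimes> z)"
      using l_conj c Mc by simp
    also have "\<dots> \<le> l y + l M + l z"
      using l_mult[of "y \<otimes> M" z] l_mult[of y M] c Mc by simp
    finally show ?case using Suc unfolding M_def[symmetric] by (simp add: algebra_simps)
  qed
  have "2 * l x \<le> l y + l z"
  proof (rule le_if_linear_bound)
    fix n :: nat
    have "x [^] (n + n) = x [^] n \<otimes> x [^] n" using c by (simp add: nat_pow_mult)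
    also have "\<dots> = (s \<otimes> (w \<otimes> y) [^] n \<otimes> inv s) \<otimes> (t \<otimes> (z \<otimes> inv w) [^] n \<otimes> inv t)"
      using xs xt conj_pow[of s "w \<otimes> y" n] conj_pow[of t "z \<otimes> inv w" n] c by simp
    also have "\<dots> = s \<otimes> ((w \<otimes> y) [^] n \<otimes> r \<otimes> (z \<otimes> inv w) [^] n) \<otimes> inv t"
      unfolding r_def using c by (simp add: m_assoc)
    finally have "real (n + n) * l x = l (s \<otimes> ((w \<otimes> y) [^] n \<otimes> r \<otimes> (z \<otimes> inv w) [^] n) \<otimes> inv t)"
      using l_pow[OF c(1)] by metis
    also have "\<dots> \<le> l s + l ((w \<otimes> y) [^] n \<otimes> r \<otimes> (z \<otimes> inv w) [^] n) + l (inv t)"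
    proof -
      let ?m = "(w \<otimes> y) [^] n \<otimes> r \<otimes> (z \<otimes> inv w) [^] n"
      have "?m \<in> carrier G" using c rc by simp
      then show ?thesis using l_mult[of "s \<otimes> ?m" "inv t"] l_mult[of s ?m] c by simp
    qed
    also have "\<dots> \<le> l s + (real n * (l y + l z) + l r) + l (inv t)" using P[of n] by simp
    finally show "real n * (2 * l x) \<le> (l s + l r + l (inv t)) + real n * (l y + l z)"
      by (simp add: algebra_simps)
  qed
  then show ?thesis by simp
qed

text \<open>
  Write \<open>c\<close> for the commutator.  The function \<open>f m k = l (x ^ m * c ^ k)\<close> is dominated by its average over one step
  of a random walk for which \<open>m\<^sup>2 + 2 * k\<close> is a martingale.  Comparing \<open>f\<close> with a multiple of the
  martingale gives \<open>n * l c \<le> l x * (n / t + t / 2)\<close> for all \<open>t > 0\<close>.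
\<close>

theorem length_commutator:
  assumes x: "x \<in> carrier G" and y: "y \<in> carrier G"
  shows "l (x \<otimes> y \<otimes> inv x \<otimes> inv y) = 0"
proof -
  define c where "c = x \<otimes> y \<otimes> inv x \<otimes> inv y"
  have c: "c \<in> carrier G" unfolding c_def using x y by simp
  define f where "f m k = l (x [^] (m::int) \<otimes> c [^] (k::nat))" for m k
  have step: "f m (Suc k) \<le> (f (m - 1) (Suc k) + f (m + 1) k) / 2" for m k
  proof -
    \<comment> \<open>Conjugating \<open>z x^-1\<close> by \<open>y\<close> appends
      \<open>x y x^-1 y^-1\<close>, which is \<open>c\<close>, to \<open>x^m c^k\<close>. Hence
      \<open>x^m c^(k+1)\<close> is conjugate to a product ending in \<open>x^-1\<close> and equal
      to one starting with \<open>x\<close>, as \<open>l_le_average\<close> with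
      \<open>w = x\<close> requires.\<close>
    define z where "z = inv y \<otimes> (x [^] m \<otimes> c [^] k \<otimes> x) \<otimes> inv (inv y)"
    have zc: "z \<in> carrier G" unfolding z_def using x y c by simp
    have "x [^] m \<otimes> c [^] Suc k = \<one> \<otimes> (x \<otimes> (x [^] (m - 1) \<otimes> c [^] Suc k)) \<otimes> inv \<one>"
      using x c int_pow_mult[OF x, of 1 "m - 1"] by (simp add: m_assoc[symmetric] int_pow_1)
    moreover have "x [^] m \<otimes> c [^] Suc k = y \<otimes> (z \<otimes> inv x) \<otimes> inv y"
    proof -
      have "y \<otimes> (inv y \<otimes> v) = v" if "v \<in> carrier G" for v
        using y that by (simp add: m_assoc[symmetric])
      then have "y \<otimes> (z \<otimes> inv x) \<otimes> inv y = (x [^] m \<otimes> c [^] k \<otimes> x) \<otimes> y \<otimes> inv x \<otimes> inv y"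
        unfolding z_def using x y c by (simp add: m_assoc)
      also have "\<dots> = x [^] m \<otimes> (c [^] k \<otimes> c)"
        using x y c by (simp add: m_assoc c_def)
      finally show ?thesis by simp
    qed
    ultimately have "f m (Suc k) \<le> (l (x [^] (m - 1) \<otimes> c [^] Suc k) + l z) / 2"
      unfolding f_def by (intro l_le_average[of _ \<one> y x]) (use x y c zc in auto)
    also have "l z = f (m + 1) k"
    proof -
      have "l z = l (x [^] m \<otimes> c [^] k \<otimes> x)" unfolding z_def by (rule l_conj) (use x y c in auto)
      also have "\<dots> = l (x \<otimes> (x [^] m \<otimes> c [^] k))" using l_swap x c by simp
      also have "\<dots> = l (x [^] (1 + m) \<otimes> c [^] k)"
        using x c int_pow_mult[OF x, of 1 m] by (simp add: m_assoc[symmetric] int_pow_1)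
      finally show ?thesis unfolding f_def by (simp add: add.commute)
    qed
    finally show ?thesis unfolding f_def .
  qed
  have lxm: "l (x [^] (m::int)) = \<bar>real_of_int m\<bar> * l x" for m
  proof (cases m rule: int_cases2)
    case (nonneg n)
    then show ?thesis using l_pow[OF x] by (simp add: int_pow_int)
  next
    case (nonpos n)
    then show ?thesis using l_pow[OF x, of n] l_inv[of "x [^] n"] x by (simp add: int_pow_neg int_pow_int)
  qed
  have f_le: "f m k \<le> \<bar>real_of_int m\<bar> * l x + real k * l c" for m k
    unfolding f_def using l_mult[of "x [^] m" "c [^] k"] x c lxm l_pow[OF c] by simp
  note lx0 = l_nonneg[OF x] and lc0 = l_nonneg[OF c]
  have bound: "f m k \<le> l x / (2 * t) * ((real_of_int m)\<^sup>2 + 2 * real k) + l x * t / 2" if t: "t > 0" for m k and t :: real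
  proof (induction k arbitrary: m)
    case 0
    have "0 \<le> (\<bar>real_of_int m\<bar> - t)\<^sup>2" by simp
    then have "2 * t * \<bar>real_of_int m\<bar> \<le> (real_of_int m)\<^sup>2 + t\<^sup>2" by (simp add: power2_eq_square algebra_simps)
    then have "\<bar>real_of_int m\<bar> \<le> ((real_of_int m)\<^sup>2 + t\<^sup>2) / (2 * t)" using t by (simp add: field_simps)
    then have "\<bar>real_of_int m\<bar> * l x \<le> ((real_of_int m)\<^sup>2 + t\<^sup>2) / (2 * t) * l x" using lx0 by (rule mult_right_mono)
    also have "\<dots> = l x / (2 * t) * ((real_of_int m)\<^sup>2) + l x * t / 2"
      using t by (simp add: field_simps power2_eq_square)
    finally show ?case using f_le[of m 0] by simp
  next
    case (Suc k)
    define g where "g m k = l x / (2 * t) * ((real_of_int m)\<^sup>2 + 2 * real k) + l x * t / 2" for m k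
    define e where "e m = f m (Suc k) - g m (Suc k)" for m
    have g0: "0 \<le> g m k" for m k unfolding g_def using lx0 t by simp
    have gstep: "g m (Suc k) = (g (m - 1) (Suc k) + g (m + 1) k) / 2" for m
    proof -
      have "(real_of_int (m - 1))\<^sup>2 + 2 * real (Suc k) + ((real_of_int (m + 1))\<^sup>2 + 2 * real k)
        = 2 * ((real_of_int m)\<^sup>2 + 2 * real (Suc k))"
        by (simp add: power2_eq_square algebra_simps)
      then have "l x / (2 * t) * ((real_of_int (m - 1))\<^sup>2 + 2 * real (Suc k)) + l x / (2 * t) * ((real_of_int (m + 1))\<^sup>2 + 2 * real k)
        = l x / (2 * t) * (2 * ((real_of_int m)\<^sup>2 + 2 * real (Suc k)))"
        by (simp only: distrib_left[symmetric])
      then show ?thesis unfolding g_def by argo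
    qed
    have estep: "e m \<le> e (m - 1) / 2" for m
      using step[of m k] Suc[of "m + 1"] gstep[of m] unfolding e_def g_def[symmetric] by argo
    \<comment> \<open>Each step down in \<open>m\<close> gains a factor \<open>1/2\<close>, while by
      \<open>f_le\<close> the excess \<open>e\<close> grows at most linearly along the way; so no
      positive excess is possible.\<close>
    have eit: "e m \<le> e (m - int j) / 2 ^ j" for m j
    proof (induction j)
      case (Suc j)
      have "m - int j - 1 = m - int (Suc j)" by simp
      then have "e (m - int j) / 2 ^ j \<le> e (m - int (Suc j)) / 2 / 2 ^ j"
        using estep[of "m - int j"] by (intro divide_right_mono) (simp_all only: zero_le_power zero_le_numeral)
      then show ?case using Suc by (simp add: mult.commute)
    qed simp
    have "e m \<le> 0"
    proof -
      define A where "A = \<bar>real_of_int m\<bar> * l x + real (Suc k) * l c"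
      have "e m \<le> A * (1 / 2 ^ j) + l x * (real j / 2 ^ j)" for j
      proof -
        have "e (m - int j) \<le> f (m - int j) (Suc k)" unfolding e_def using g0 by simp
        also have "\<dots> \<le> \<bar>real_of_int (m - int j)\<bar> * l x + real (Suc k) * l c" by (rule f_le)
        also have "\<dots> \<le> (\<bar>real_of_int m\<bar> + real j) * l x + real (Suc k) * l c"
          using lx0 by (intro add_right_mono mult_right_mono) auto
        also have "\<dots> = A + l x * real j" unfolding A_def by (simp add: algebra_simps)
        finally have "e (m - int j) / 2 ^ j \<le> (A + l x * real j) / 2 ^ j" by (intro divide_right_mono) auto
        then show ?thesis using eit[of m j] by (simp add: add_divide_distrib)
      qed
      moreover have "(\<lambda>j. A * (1 / 2 ^ j) + l x * (real j / 2 ^ j)) \<longlonglongrightarrow> A * 0 + l x * 0"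
      proof (intro tendsto_intros)
        show "(\<lambda>j. 1 / 2 ^ j) \<longlonglongrightarrow> (0::real)"
          using LIMSEQ_inverse_realpow_zero[of 2] by (simp add: inverse_eq_divide)
        show "(\<lambda>j. real j / 2 ^ j) \<longlonglongrightarrow> 0"
          using lim_n_over_pown[of "2::real"] by simp
      qed
      ultimately show ?thesis using LIMSEQ_le_const[of _ "A * 0 + l x * 0" "e m"] by auto
    qed
    then show ?case unfolding e_def g_def by simp
  qed
  \<comment> \<open>The term \<open>l x * t / 2\<close> does not grow with \<open>n\<close> and is
    absorbed; letting \<open>t\<close> grow afterwards leaves \<open>l c \<le> 0\<close>.\<close>
  have lct: "l c \<le> l x / t" if t: "t > 0" for t :: real
  proof (rule le_if_linear_bound)
    fix n
    have "real n * l c = f 0 n" unfolding f_def using l_pow[OF c] c by simp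
    also have "\<dots> \<le> l x / (2 * t) * (2 * real n) + l x * t / 2" using bound[OF t, of 0 n] by simp
    finally show "real n * l c \<le> l x * t / 2 + real n * (l x / t)" using t by (simp add: field_simps)
  qed
  have "l c \<le> 0"
  proof (rule le_if_linear_bound)
    fix n :: nat
    show "real n * l c \<le> l x + real n * 0"
      using lct[of "real n"] lx0 by (cases "n = 0") (auto simp: field_simps)
  qed
  then show ?thesis using lc0 unfolding c_def by simp
qed

end


section \<open>Indices of translates and the displacement length\<close>

context taction begin

text \<open>For a subgroup \<open>A\<close> this is the index of \<open>A \<inter> U\<close> in
  \<open>A\<close>, expressed by counting the cosets of \<open>U\<close> that meet \<open>A\<close>.
  An infinite family would count as \<open>0\<close>, so finiteness is drawn from compactness where
  it matters.\<close>

definition cidx :: "'a set \<Rightarrow> 'a set \<Rightarrow> nat" where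
  "cidx U A = card ((\<lambda>y. y <# U) ` A)"

lemma lcoset_eq_iff:
  assumes "subgroup U G" "x \<in> carrier G" "y \<in> carrier G"
  shows "x <# U = y <# U \<longleftrightarrow> inv x \<otimes> y \<in> U"
proof
  assume "x <# U = y <# U"
  then have "y \<in> x <# U" using lcoset_self assms by blast
  then show "inv x \<otimes> y \<in> U" using l_coset_mem_iff[OF assms(2) subgroup.subset[OF assms(1)]] by blast
next
  assume "inv x \<otimes> y \<in> U"
  then have "y \<in> x <# U" using l_coset_mem_iff[OF assms(2) subgroup.subset[OF assms(1)]] assms by blast
  then show "x <# U = y <# U" using lcoset_eq[OF assms(1)] assms by blast
qed

lemma coset_reps:
  assumes "finite ((\<lambda>y. y <# U) ` A)" "subgroup U G" "A \<subseteq> carrier G"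
  obtains F where "finite F" "F \<subseteq> A" "card F = cidx U A" "A \<subseteq> F <#> U" "inj_on (\<lambda>y. y <# U) F"
proof -
  obtain F where F: "F \<subseteq> A" "inj_on (\<lambda>y. y <# U) F" "(\<lambda>y. y <# U) ` A = (\<lambda>y. y <# U) ` F"
    by (metis subset_image_inj order_refl)
  have "A \<subseteq> F <#> U"
  proof
    fix y assume y: "y \<in> A"
    then obtain f where f: "f \<in> F" "y <# U = f <# U" using F(3) by blast
    then have "y \<in> f <# U" using lcoset_self[OF assms(2), of y] assms(3) y by blast
    then show "y \<in> F <#> U" using f unfolding set_mult_eq_UN by blast
  qed
  moreover have "finite F" using assms(1) F finite_imageD by metis
  moreover have "card F = cidx U A" unfolding cidx_def F(3) using card_image[OF F(2)] by simp
  ultimately show thesis using that F by blast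
qed

lemma cidx_le:
  assumes "finite F" "F \<subseteq> carrier G" "A \<subseteq> F <#> U" "subgroup U G"
  shows "cidx U A \<le> card F"
proof -
  have "(\<lambda>y. y <# U) ` A \<subseteq> (\<lambda>y. y <# U) ` F"
  proof
    fix Y assume "Y \<in> (\<lambda>y. y <# U) ` A"
    then obtain y where y: "y \<in> F <#> U" "Y = y <# U" using assms(3) by blast
    then obtain a where a: "a \<in> F" "y \<in> a <# U" unfolding set_mult_eq_UN by blast
    then show "Y \<in> (\<lambda>y. y <# U) ` F" using y lcoset_eq[OF assms(4) a(2)] assms(2) by blast
  qed
  then show ?thesis unfolding cidx_def using assms(1) by (meson card_image_le card_mono finite_imageI le_trans)
qed

lemma cidx_mono:
  assumes "A \<subseteq> B" "compactin T B" "openin T U" "subgroup U G"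
  shows "cidx U A \<le> cidx U B"
  unfolding cidx_def using finite_cosets[OF assms(2-4)] assms(1) by (intro card_mono) auto

context
  fixes U
  assumes U: "U \<in> tidy_all"
begin

lemma finite_cosets_act: "h \<in> carrier L \<Longrightarrow> finite ((\<lambda>y. y <# U) ` h ` U)"
  using finite_cosets[OF act_image_compact] tidy_allD[OF U] by blast

lemma cidx_mult_le:
  assumes g: "g \<in> carrier L" and h: "h \<in> carrier L"
  shows "cidx U ((g \<otimes>\<^sub>L h) ` U) \<le> cidx U (g ` U) * cidx U (h ` U)"
proof -
  note U' = tidy_allD[OF U]
  have gU: "g ` U \<subseteq> carrier G" "h ` U \<subseteq> carrier G" using act_image_closed g h U' by auto
  obtain E where E: "finite E" "E \<subseteq> g ` U" "card E = cidx U (g ` U)" "g ` U \<subseteq> E <#> U"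
    using coset_reps[OF finite_cosets_act[OF g] U'(1) gU(1)] by metis
  obtain F where F: "finite F" "F \<subseteq> h ` U" "card F = cidx U (h ` U)" "h ` U \<subseteq> F <#> U"
    using coset_reps[OF finite_cosets_act[OF h] U'(1) gU(2)] by metis
  have EFc: "E \<subseteq> carrier G" "F \<subseteq> carrier G" using E F gU by auto
  define R where "R = (\<lambda>(f, e). g f \<otimes> e) ` (F \<times> E)"
  have gF: "g ` F \<subseteq> carrier G" using EFc g by auto
  have "(g \<otimes>\<^sub>L h) ` U = g ` h ` U" using act_image_mult[OF g h U'(4)] .
  also have "\<dots> \<subseteq> g ` (F <#> U)" using F(4) by blast
  also have "\<dots> = g ` F <#> g ` U" using act_image_set_mult[OF g EFc(2) U'(4)] .
  also have "\<dots> \<subseteq> g ` F <#> (E <#> U)" using E(4) set_mult_mono by blast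
  also have "\<dots> = (g ` F <#> E) <#> U" using set_mult_assoc[OF gF EFc(1) U'(4)] by simp
  also have "g ` F <#> E = R" unfolding R_def set_mult_def by auto
  finally have sub: "(g \<otimes>\<^sub>L h) ` U \<subseteq> R <#> U" .
  have "finite R" "card R \<le> card E * card F"
    unfolding R_def using E F card_image_le[of "F \<times> E" "\<lambda>(f, e). g f \<otimes> e"]
    by (simp_all add: card_cartesian_product mult.commute)
  moreover have "R \<subseteq> carrier G"
    unfolding R_def using EFc g by (auto simp: subset_iff)
  ultimately have "cidx U ((g \<otimes>\<^sub>L h) ` U) \<le> card R" "card R \<le> card E * card F"
    using cidx_le[OF _ _ sub U'(1)] by auto
  then show ?thesis using E F by simp
qed

lemma cidx_pos: assumes "h \<in> carrier L" shows "cidx U (h ` U) \<ge> 1"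
proof -
  have "U \<noteq> {}" using tidy_allD[OF U] subgroup.one_closed by blast
  then show ?thesis unfolding cidx_def using finite_cosets_act[OF assms] by (simp add: Suc_le_eq card_gt_0_iff)
qed

lemma cidx_eq_1: assumes h: "h \<in> carrier L" and "cidx U (h ` U) = 1" shows "h ` U \<subseteq> U"
proof
  fix y assume y: "y \<in> h ` U"
  note U' = tidy_allD[OF U]
  have 1: "\<one> \<in> h ` U" using act_image_subgroup[OF h U'(1)] subgroup.one_closed by blast
  obtain Y where "(\<lambda>y. y <# U) ` h ` U = {Y}" using assms(2) unfolding cidx_def by (auto simp: card_1_singleton_iff)
  then have "y <# U = \<one> <# U" using y 1 by (metis (no_types, lifting) imageI singletonD)
  then have "\<one> <# U = y <# U" ..
  moreover have "y \<in> carrier G" using y act_image_closed[OF h U'(4)] by blast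
  ultimately show "y \<in> U" using lcoset_eq_iff[OF U'(1), of \<one> y] by simp
qed

text \<open>Such a point has its backward orbit in a compact translate of \<open>Plus h U\<close>,
  so tidiness applies. The increasing tower of translates of \<open>Plus h U\<close> thus meets
  \<open>U\<close> only in its bottom step.\<close>

lemma pw_image_Plus_Int:
  assumes h: "h \<in> carrier L" and i: "i \<ge> 0" and x: "x \<in> (h \<up> i) ` Plus h U" "x \<in> U"
  shows "x \<in> Plus h U"
proof (rule tidy_backward[OF U h x(2)])
  note U' = tidy_allD[OF U]
  define C where "C = (h \<up> i) ` Plus h U"
  show "compactin T C" unfolding C_def using act_image_compact Plus_compact h U' by simp
  obtain v where v: "v \<in> Plus h U" "x = (h \<up> i) v" using x by blast
  have "v \<in> carrier G" using v Plus_subset[OF h U'(4)] U'(4) by blast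
  then show "(h \<up> j) x \<in> C" if "j \<le> 0" for j :: int
    using Plus_shift[OF h U'(4) v(1) that] v h unfolding C_def image_iff
    by (intro bexI[of _ "(h \<up> j) v"]) (simp_all add: pw_add add.commute)
qed

text \<open>The index is the scale of \<open>h\<close>. One estimate is submultiplicativity. The
  other counts cosets along the tower of translates of \<open>Plus h U\<close>: each step
  contributes the same index, and by \<open>pw_image_Plus_Int\<close> the cosets of \<open>U\<close>
  tell the contributions apart.\<close>

lemma cidx_pow: assumes h: "h \<in> carrier L"
  shows "cidx U ((h \<up> int n) ` U) = cidx U (h ` U) ^ n"
proof -
  note U' = tidy_allD[OF U]
  let ?A = "Plus h U"
  let ?p = "\<lambda>n. h \<up> int n"
  have A: "subgroup ?A G" "compactin T ?A" "?A \<subseteq> U" "?A \<subseteq> carrier G"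
    using Plus_subgroup[OF h U'(1)] Plus_compact[OF h U'(2)] Plus_subset[OF h U'(4)] U'(4) by auto
  have pc: "?p n \<in> carrier L" for n using h by simp
  have Sucp: "?p (Suc n) = ?p n \<otimes>\<^sub>L h" for n
    using L.int_pow_mult[OF h, of "int n" 1] h by (simp add: add.commute)
  have pA: "?A \<subseteq> ?p n ` ?A" for n
  proof
    fix x assume x: "x \<in> ?A"
    then have "(h \<up> (- int n)) x \<in> ?A" using Plus_shift[OF h U'(4)] by simp
    then show "x \<in> ?p n ` ?A" using act_image_mem_iff[OF pc A(4)] inv_pw[OF h] x A(4) by auto
  qed
  have upper: "cidx U (?p n ` U) \<le> cidx U (h ` U) ^ n" for n
  proof (induction n)
    case 0
    have "?p 0 ` U = U" using act_image_one U' by simp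
    moreover have "cidx U U \<le> card {\<one>}"
      by (rule cidx_le) (use U' in \<open>auto simp: set_mult_def subset_iff\<close>)
    ultimately show ?case by simp
  next
    case (Suc n)
    have "cidx U (?p (Suc n) ` U) \<le> cidx U (?p n ` U) * cidx U (h ` U)"
      unfolding Sucp using cidx_mult_le[OF pc h] .
    also have "\<dots> \<le> cidx U (h ` U) ^ n * cidx U (h ` U)" using Suc by simp
    finally show ?case by (simp add: mult.commute)
  qed
  \<comment> \<open>\<open>h\<close> maps \<open>Minus h U\<close> into \<open>U\<close>, so coset
    representatives for \<open>h U\<close> can be taken from the image of
    \<open>Plus h U\<close>.\<close>
  have hU: "cidx U (h ` U) \<le> cidx U (h ` ?A)"
  proof -
    have hA: "finite ((\<lambda>y. y <# U) ` h ` ?A)"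
      using finite_cosets[OF act_image_compact[OF h A(2)] U'(3,1)] .
    have hAc: "h ` ?A \<subseteq> carrier G" using act_image_closed h A by blast
    obtain F where F: "finite F" "F \<subseteq> h ` ?A" "card F = cidx U (h ` ?A)" "h ` ?A \<subseteq> F <#> U"
      using coset_reps[OF hA U'(1) hAc] by metis
    have Fc: "F \<subseteq> carrier G" using F hAc by blast
    have Mc: "Minus h U \<subseteq> carrier G" using Minus_subset[OF h U'(4)] U'(4) by blast
    have "h ` Minus h U \<subseteq> Minus h U" using Minus_shift[OF h U'(4), of _ 1] h by auto
    then have "h ` Minus h U \<subseteq> U" using Minus_subset[OF h U'(4)] by blast
    then have "h ` U \<subseteq> (F <#> U) <#> U"
      using tidy_decomp[OF U h] act_image_set_mult[OF h A(4) Mc] F(4) set_mult_mono by metis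
    also have "\<dots> = F <#> (U <#> U)" using set_mult_assoc[OF Fc U'(4,4)] .
    also have "\<dots> \<subseteq> F <#> U" using set_mult_mono[OF order_refl set_mult_subset[OF U'(1) order_refl order_refl]] .
    finally show ?thesis using cidx_le[OF F(1) Fc _ U'(1)] F(3) by simp
  qed
  have lower: "cidx U (h ` ?A) ^ n \<le> cidx U (?p n ` ?A)" for n
  proof (induction n)
    case 0
    have "\<one> \<in> ?p 0 ` ?A" using A act_image_subgroup[OF pc A(1)] subgroup.one_closed by blast
    moreover have "finite ((\<lambda>y. y <# U) ` ?p 0 ` ?A)"
      using finite_cosets[OF act_image_compact[OF pc A(2)] U'(3,1)] .
    ultimately show ?case unfolding cidx_def by (auto simp: Suc_le_eq card_gt_0_iff)
  next
    case (Suc n)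
    have fin: "finite ((\<lambda>y. y <# U) ` g ` ?A)" if "g \<in> carrier L" for g
      using finite_cosets[OF act_image_compact[OF that A(2)] U'(3,1)] .
    have car: "g ` ?A \<subseteq> carrier G" if "g \<in> carrier L" for g using act_image_closed that A by blast
    obtain E where E: "finite E" "E \<subseteq> h ` ?A" "card E = cidx U (h ` ?A)" "inj_on (\<lambda>y. y <# U) E"
      using coset_reps[OF fin[OF h] U'(1) car[OF h]] by metis
    obtain F where F: "finite F" "F \<subseteq> ?p n ` ?A" "card F = cidx U (?p n ` ?A)" "inj_on (\<lambda>y. y <# U) F"
      using coset_reps[OF fin[OF pc] U'(1) car[OF pc]] by metis
    have Ec: "E \<subseteq> carrier G" "F \<subseteq> carrier G" using E F car[OF h] car[OF pc] by blast+
    \<comment> \<open>Representatives one level up: \<open>e\<close> selects a coset in the top step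
      of the tower, moved there by the \<open>n\<close>-th power of \<open>h\<close>, and
      \<open>f\<close> one in the lower steps.\<close>
    define r where "r = (\<lambda>(e, f). (?p n e \<otimes> f) <# U)"
    have sgp: "subgroup (?p n ` ?A) G" "subgroup (h ` ?A) G" using act_image_subgroup A pc h by blast+
    have im: "?p (Suc n) ` ?A = ?p n ` h ` ?A" unfolding Sucp using act_image_mult[OF pc h A(4)] .
    have inj: "inj_on r (E \<times> F)"
    proof (rule inj_onI, clarify)
      fix e f e' f' assume ef: "e \<in> E" "f \<in> F" "e' \<in> E" "f' \<in> F" and eq: "r (e, f) = r (e', f')"
      have c: "e \<in> carrier G" "f \<in> carrier G" "e' \<in> carrier G" "f' \<in> carrier G" using ef Ec by auto
      define v where "v = inv e \<otimes> e'"
      have "v \<in> h ` ?A" unfolding v_def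
        by (rule subgroup.m_closed[OF sgp(2) subgroup.m_inv_closed[OF sgp(2)]]) (use ef E(2) in blast)+
      then have vc: "v \<in> carrier G" "v \<in> h ` ?A" using car[OF h] by blast+
      have pv: "?p n v = inv (?p n e) \<otimes> ?p n e'" unfolding v_def using c pc by simp
      have "inv (?p n e \<otimes> f) \<otimes> (?p n e' \<otimes> f') \<in> U"
        using eq lcoset_eq_iff[OF U'(1)] c pc unfolding r_def by simp
      moreover have "inv (?p n e \<otimes> f) \<otimes> (?p n e' \<otimes> f') = inv f \<otimes> (?p n v \<otimes> f')"
        unfolding pv using c pc by (simp add: inv_mult_group m_assoc)
      ultimately have inU: "inv f \<otimes> (?p n v \<otimes> f') \<in> U" by simp
      have fA: "f \<in> ?p n ` ?A" "f' \<in> ?p n ` ?A" using ef F by auto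
      have "?p n ` ?A \<subseteq> ?p (Suc n) ` ?A"
        unfolding im using Plus_expanding[OF h U'(4)] by (simp add: image_mono)
      then have "f \<in> ?p (Suc n) ` ?A" "f' \<in> ?p (Suc n) ` ?A" using fA by auto
      moreover have "?p n v \<in> ?p (Suc n) ` ?A" unfolding im using vc by blast
      moreover have "subgroup (?p (Suc n) ` ?A) G" using act_image_subgroup[OF pc A(1)] .
      ultimately have "inv f \<otimes> (?p n v \<otimes> f') \<in> ?p (Suc n) ` ?A"
        by (meson subgroup.m_closed subgroup.m_inv_closed)
      \<comment> \<open>The difference of the two products lies in \<open>U\<close> and in the
        tower, hence in its bottom step; cancelling \<open>f\<close> and \<open>f'\<close> places
        \<open>v\<close> in \<open>Plus h U\<close>, so \<open>e\<close> and \<open>e'\<close> share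
        a coset.\<close>
      then have "inv f \<otimes> (?p n v \<otimes> f') \<in> ?A" by (rule pw_image_Plus_Int[OF h of_nat_0_le_iff _ inU])
      then have "inv f \<otimes> (?p n v \<otimes> f') \<in> ?p n ` ?A" using pA by blast
      then have "f \<otimes> (inv f \<otimes> (?p n v \<otimes> f')) \<otimes> inv f' \<in> ?p n ` ?A"
        using fA sgp(1) by (meson subgroup.m_closed subgroup.m_inv_closed)
      moreover have "f \<otimes> (inv f \<otimes> (?p n v \<otimes> f')) \<otimes> inv f' = ?p n v"
      proof -
        have "f \<otimes> (inv f \<otimes> (?p n v \<otimes> f')) = ?p n v \<otimes> f'" using c vc pc by (simp add: m_assoc[symmetric])
        then show ?thesis using c vc pc by (simp add: m_assoc)
      qed
      ultimately have "?p n v \<in> ?p n ` ?A" by simp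
      then have "v \<in> ?A" using act_inj[OF pc] vc(1) A(4) by (metis inj_on_image_mem_iff)
      then have "inv e \<otimes> e' \<in> U" unfolding v_def using A by blast
      then have ee: "e = e'" using E(4) ef c lcoset_eq_iff[OF U'(1)] by (metis inj_onD)
      then have "v = \<one>" unfolding v_def using c by simp
      then have "inv f \<otimes> f' \<in> U" using inU c pc by simp
      then have "f = f'" using F(4) ef c lcoset_eq_iff[OF U'(1)] by (metis inj_onD)
      then show "e = e' \<and> f = f'" using ee by simp
    qed
    have "r ` (E \<times> F) \<subseteq> (\<lambda>y. y <# U) ` ?p (Suc n) ` ?A"
    proof
      fix Y assume "Y \<in> r ` (E \<times> F)"
      then obtain e f where ef: "e \<in> E" "f \<in> F" "Y = (?p n e \<otimes> f) <# U" unfolding r_def by auto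
      have "?p n ` ?A \<subseteq> ?p (Suc n) ` ?A"
        unfolding im using Plus_expanding[OF h U'(4)] by (simp add: image_mono)
      then have "f \<in> ?p (Suc n) ` ?A" using ef F(2) by blast
      moreover have "?p n e \<in> ?p (Suc n) ` ?A" unfolding im using ef E(2) by blast
      ultimately have "?p n e \<otimes> f \<in> ?p (Suc n) ` ?A"
        using subgroup.m_closed[OF act_image_subgroup[OF pc A(1)]] by blast
      then show "Y \<in> (\<lambda>y. y <# U) ` ?p (Suc n) ` ?A" using ef by blast
    qed
    then have "card (E \<times> F) \<le> cidx U (?p (Suc n) ` ?A)"
      unfolding cidx_def using card_mono[OF fin[OF pc]] card_image[OF inj] by metis
    then have "cidx U (h ` ?A) * cidx U (?p n ` ?A) \<le> cidx U (?p (Suc n) ` ?A)"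
      by (simp add: card_cartesian_product E F)
    moreover have "cidx U (h ` ?A) * cidx U (h ` ?A) ^ n \<le> cidx U (h ` ?A) * cidx U (?p n ` ?A)"
      using Suc by (rule mult_left_mono) simp
    ultimately show ?case unfolding power_Suc by (rule order_trans[rotated])
  qed
  have "cidx U (?p n ` ?A) \<le> cidx U (?p n ` U)"
    by (rule cidx_mono) (use A U' pc act_image_compact in auto)
  then have "cidx U (h ` U) ^ n \<le> cidx U (?p n ` U)"
    using lower[of n] power_mono[OF hU, of n] by simp
  then show ?thesis using upper[of n] by simp
qed

text \<open>The logarithm turns submultiplicativity into subadditivity, and the term for the inverse
  makes the length symmetric. It vanishes exactly on the stabilizer of \<open>U\<close>.\<close>

definition displacement :: "('a \<Rightarrow> 'a) \<Rightarrow> real" where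
  "displacement h = ln (cidx U (h ` U)) + ln (cidx U ((inv\<^sub>L h) ` U))"

lemma displacement_homogeneous: "homogeneous_length L displacement"
proof
  have pos: "0 < real (cidx U (h ` U))" if "h \<in> carrier L" for h using cidx_pos[OF that] by simp
  have mult: "ln (cidx U ((g \<otimes>\<^sub>L h) ` U)) \<le> ln (cidx U (g ` U)) + ln (cidx U (h ` U))"
    if "g \<in> carrier L" "h \<in> carrier L" for g h
  proof -
    have "real (cidx U ((g \<otimes>\<^sub>L h) ` U)) \<le> real (cidx U (g ` U)) * real (cidx U (h ` U))"
      using cidx_mult_le[OF that] by (metis of_nat_le_iff of_nat_mult)
    then have "ln (real (cidx U ((g \<otimes>\<^sub>L h) ` U))) \<le> ln (real (cidx U (g ` U)) * real (cidx U (h ` U)))"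
      using pos that by simp
    then show ?thesis using pos that by (simp add: ln_mult)
  qed
  fix x y assume x: "x \<in> carrier L"
  show "displacement (inv\<^sub>L x) = displacement x" unfolding displacement_def using x by simp
  have pow: "ln (cidx U ((h [^]\<^bsub>L\<^esub> n) ` U)) = real n * ln (cidx U (h ` U))" if "h \<in> carrier L" for h and n :: nat
    using cidx_pow[OF that, of n] pos[OF that] by (simp add: int_pow_int ln_realpow)
  show "displacement (x [^]\<^bsub>L\<^esub> n) = real n * displacement x" for n :: nat
    unfolding displacement_def using x pow[OF x, of n] pow[of "inv\<^sub>L x" n]
    by (simp add: L.nat_pow_inv distrib_left)
  assume y: "y \<in> carrier L"
  show "displacement (x \<otimes>\<^sub>L y) \<le> displacement x + displacement y"
    unfolding displacement_def using x y mult[OF x y] mult[of "inv\<^sub>L y" "inv\<^sub>L x"] by (simp add: L.inv_mult_group)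
qed

text \<open>Zero displacement makes both indices \<open>1\<close>, so the commutator and its inverse
  map \<open>U\<close> into itself. Modulo the stabilizer of \<open>U\<close> the acting group is
  therefore abelian.\<close>

lemma commutator_fixes:
  assumes g: "g \<in> carrier L" and h: "h \<in> carrier L"
  shows "(g \<otimes>\<^sub>L h \<otimes>\<^sub>L inv\<^sub>L g \<otimes>\<^sub>L inv\<^sub>L h) ` U = U"
proof -
  note U' = tidy_allD[OF U]
  define k where "k = g \<otimes>\<^sub>L h \<otimes>\<^sub>L inv\<^sub>L g \<otimes>\<^sub>L inv\<^sub>L h"
  have k: "k \<in> carrier L" unfolding k_def using g h by simp
  have "displacement k = 0"
    unfolding k_def using homogeneous_length.length_commutator[OF displacement_homogeneous g h] .
  moreover have "1 \<le> real (cidx U (k ` U))" "1 \<le> real (cidx U ((inv\<^sub>L k) ` U))"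
    using cidx_pos k by simp_all
  ultimately have "ln (real (cidx U (k ` U))) = 0" "ln (real (cidx U ((inv\<^sub>L k) ` U))) = 0"
    unfolding displacement_def using ln_ge_zero by (smt (verit))+
  then have "cidx U (k ` U) = 1" "cidx U ((inv\<^sub>L k) ` U) = 1"
    using \<open>1 \<le> real (cidx U (k ` U))\<close> \<open>1 \<le> real (cidx U ((inv\<^sub>L k) ` U))\<close> by (auto simp: ln_eq_zero_iff)
  then have "k ` U \<subseteq> U" "(inv\<^sub>L k) ` U \<subseteq> U" using cidx_eq_1 k by auto
  then have "k ` U = U" using act_image_inv_right[OF k U'(4)] by (metis image_mono subset_antisym)
  then show ?thesis unfolding k_def .
qed

end

end

section \<open>Intersections of translates of a tidy subgroup\<close>

context taction begin

lemma conj_pw_act: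
  assumes h: "h \<in> carrier L" and k: "k \<in> carrier L" and x: "x \<in> carrier G"
  shows "((inv\<^sub>L k \<otimes>\<^sub>L h \<otimes>\<^sub>L k) \<up> i) ((inv\<^sub>L k) x) = (inv\<^sub>L k) ((h \<up> i) x)"
proof -
  define h' where "h' = inv\<^sub>L k \<otimes>\<^sub>L h \<otimes>\<^sub>L k"
  have h': "h' \<in> carrier L" unfolding h'_def using h k by simp
  have nat: "(h' \<up> int n) ((inv\<^sub>L k) y) = (inv\<^sub>L k) ((h \<up> int n) y)" if "y \<in> carrier G" for n y
    using that
  proof (induction n arbitrary: y)
    case (Suc n)
    have "(h' \<up> int (Suc n)) ((inv\<^sub>L k) y) = (h' \<up> int n) (h' ((inv\<^sub>L k) y))"
      using pw_add[OF h', of "(inv\<^sub>L k) y" "int n" 1] h' k Suc.prems by (simp add: add.commute)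
    also have "h' ((inv\<^sub>L k) y) = (inv\<^sub>L k) (h y)" unfolding h'_def using h k Suc.prems by simp
    also have "(h' \<up> int n) ((inv\<^sub>L k) (h y)) = (inv\<^sub>L k) ((h \<up> int n) (h y))"
      using Suc.IH h Suc.prems by simp
    also have "(h \<up> int n) (h y) = (h \<up> int (Suc n)) y"
      using pw_add[OF h, of y "int n" 1] h Suc.prems by (simp add: add.commute)
    finally show ?case .
  qed (use h k in simp)
  have "(h' \<up> i) ((inv\<^sub>L k) x) = (inv\<^sub>L k) ((h \<up> i) x)"
  proof (cases i rule: int_cases2)
    case (nonneg n)
    then show ?thesis using nat[OF x] by simp
  next
    case (nonpos n)
    define y where "y = (h \<up> (- int n)) x"
    have y: "y \<in> carrier G" "(h \<up> int n) y = x" unfolding y_def using h x by (simp_all add: pw_add)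
    have "(h' \<up> (- int n)) ((h' \<up> int n) ((inv\<^sub>L k) y)) = (inv\<^sub>L k) y"
      using h' k y by (simp add: pw_add)
    then show ?thesis using nat[OF y(1)] y nonpos unfolding y_def by simp
  qed
  then show ?thesis unfolding h'_def .
qed

text \<open>Tidiness of the translate for \<open>h\<close> is tidiness of \<open>U\<close> for the
  conjugate of \<open>h\<close> by \<open>k\<close>, and conjugation permutes
  \<open>L\<close>.\<close>

lemma act_image_tidy: assumes U: "U \<in> tidy_all" and k: "k \<in> carrier L" shows "k ` U \<in> tidy_all"
  unfolding tidy_all_def
proof (intro CollectI ballI)
  fix h assume h: "h \<in> carrier L"
  note U' = tidy_allD[OF U]
  have kU: "k ` U \<subseteq> carrier G" using act_image_closed k U' by blast
  define h' where "h' = inv\<^sub>L k \<otimes>\<^sub>L h \<otimes>\<^sub>L k"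
  have h': "h' \<in> carrier L" unfolding h'_def using h k by simp
  have key: "(h \<up> i) x \<in> k ` U \<longleftrightarrow> (h' \<up> i) ((inv\<^sub>L k) x) \<in> U" if "x \<in> carrier G" for x and i :: int
    unfolding h'_def conj_pw_act[OF h k that] using act_image_mem_iff[OF k U'(4)] h that by simp
  have P: "Plus h (k ` U) = k ` Plus h' U"
  proof (rule Set.set_eqI)
    fix x
    have "Plus h' U \<subseteq> carrier G" using Plus_subset[OF h' U'(4)] U'(4) by blast
    then show "x \<in> Plus h (k ` U) \<longleftrightarrow> x \<in> k ` Plus h' U"
      unfolding act_image_mem_iff[OF k] Plus_mem[OF h kU] using key[of x] k
      by (auto simp: act_image_mem_iff Plus_mem[OF h' U'(4)])
  qed
  have M: "Minus h (k ` U) = k ` Minus h' U"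
  proof (rule Set.set_eqI)
    fix x
    have "Minus h' U \<subseteq> carrier G" using Minus_subset[OF h' U'(4)] U'(4) by blast
    then show "x \<in> Minus h (k ` U) \<longleftrightarrow> x \<in> k ` Minus h' U"
      unfolding act_image_mem_iff[OF k] Minus_mem[OF h kU] using key[of x] k
      by (auto simp: act_image_mem_iff Minus_mem[OF h' U'(4)])
  qed
  have PPs: "Plus_plus h' U \<subseteq> carrier G" unfolding Plus_plus_def by blast
  have "Plus_plus h (k ` U) = k ` Plus_plus h' U"
  proof (rule Set.set_eqI)
    fix x
    show "x \<in> Plus_plus h (k ` U) \<longleftrightarrow> x \<in> k ` Plus_plus h' U"
      unfolding act_image_mem_iff[OF k PPs] unfolding Plus_plus_def using key[of x] k
      by (cases "x \<in> carrier G") simp_all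
  qed
  then have "closedin T (Plus_plus h (k ` U))"
    using act_image_closed_set[OF k tidy_forD(7)[OF tidy_all_tidy_for[OF U h']]] by simp
  moreover have "k ` U = Plus h (k ` U) <#> Minus h (k ` U)"
    unfolding P M
    using act_image_set_mult[OF k, of "Plus h' U" "Minus h' U"] tidy_decomp[OF U h']
      Plus_subset[OF h' U'(4)] Minus_subset[OF h' U'(4)] U'(4) by auto
  ultimately show "tidy_for h (k ` U)"
    unfolding tidy_for_def using act_image_subgroup[OF k U'(1)] act_image_compact[OF k U'(2)] act_image_open[OF k U'(3)] by simp
qed

end

locale flat_action = taction +
  fixes U
  assumes U: "U \<in> tidy_all"
begin

lemmas U' = tidy_allD[OF U]

definition translates_Int :: "('a \<Rightarrow> 'a) set \<Rightarrow> 'a set" where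
  "translates_Int I = (\<Inter>g\<in>I. g ` U)"

text \<open>Infinite index sets are allowed so that the family is closed under \<open>Plus\<close>,
  \<open>Minus\<close> and arbitrary intersections; its members are compact subgroups, but in
  general not open.\<close>

definition translates_Ints :: "'a set set" where
  "translates_Ints = {translates_Int I |I. I \<subseteq> carrier L \<and> I \<noteq> {}}"

lemma famE: assumes "Q \<in> translates_Ints" obtains I where "I \<subseteq> carrier L" "I \<noteq> {}" "Q = translates_Int I"
  using assms unfolding translates_Ints_def by blast

lemma fam_carrier: assumes "Q \<in> translates_Ints" shows "Q \<subseteq> carrier G"
proof -
  obtain I g where "I \<subseteq> carrier L" "Q = translates_Int I" "g \<in> I" using famE[OF assms] by blast
  then have "Q \<subseteq> g ` U" "g ` U \<subseteq> carrier G" unfolding translates_Int_def using act_image_closed U' by blast+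
  then show ?thesis by blast
qed

lemma fam_subgroup: assumes "Q \<in> translates_Ints" shows "subgroup Q G"
proof -
  obtain I where I: "I \<subseteq> carrier L" "I \<noteq> {}" "Q = translates_Int I" using famE[OF assms] .
  have "subgroup (\<Inter>((\<lambda>g. g ` U) ` I)) G"
    by (rule subgroups_Inter) (use I act_image_subgroup U' in auto)
  then show ?thesis using I translates_Int_def by simp
qed

lemma fam_compact: assumes "Q \<in> translates_Ints" shows "compactin T Q"
proof -
  obtain I where I: "I \<subseteq> carrier L" "I \<noteq> {}" "Q = translates_Int I" using famE[OF assms] .
  obtain g where g: "g \<in> I" using I by blast
  have c: "compactin T (h ` U)" if "h \<in> I" for h using that I act_image_compact U' by blast
  have "compactin T (\<Inter>((\<lambda>g. g ` U) ` I))"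
    by (rule closed_compactin_Inter[OF c[OF g]]) (use c g compact_closed in blast)+
  then show ?thesis using I translates_Int_def by simp
qed

lemma fam_U: "U \<in> translates_Ints"
proof -
  have "translates_Int {\<one>\<^bsub>L\<^esub>} = U" unfolding translates_Int_def using act_image_one U' by simp
  then show ?thesis unfolding translates_Ints_def using L.one_closed by blast
qed

lemma stabilizer_conj:
  assumes g: "g \<in> carrier L" and k: "k \<in> carrier L" and gU: "g ` U = U"
  shows "g ` k ` U = k ` U"
  using tidy_fixes_transfer[OF U act_image_tidy[OF U k] g gU] .

lemma stabilizer_fam:
  assumes g: "g \<in> carrier L" and gU: "g ` U = U" and Q: "Q \<in> translates_Ints"
  shows "g ` Q = Q"
proof -
  obtain I where I: "I \<subseteq> carrier L" "I \<noteq> {}" "Q = translates_Int I" using famE[OF Q] .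
  have "g ` Q = (\<Inter>k\<in>I. g ` k ` U)"
    unfolding I translates_Int_def by (rule act_image_INT[OF g I(2)]) (use I act_image_closed U' in blast)
  also have "\<dots> = Q" unfolding I(3) translates_Int_def
    by (intro INF_cong refl) (use stabilizer_conj[OF g _ gU] I(1) in blast)
  finally show ?thesis .
qed

lemma fam_act: assumes g: "g \<in> carrier L" and Q: "Q \<in> translates_Ints" shows "g ` Q \<in> translates_Ints"
proof -
  obtain I where I: "I \<subseteq> carrier L" "I \<noteq> {}" "Q = translates_Int I" using famE[OF Q] .
  have "g ` Q = (\<Inter>k\<in>I. g ` k ` U)"
    unfolding I translates_Int_def by (rule act_image_INT[OF g I(2)]) (use I act_image_closed U' in blast)
  also have "\<dots> = (\<Inter>k\<in>I. (g \<otimes>\<^sub>L k) ` U)"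
    by (intro INF_cong refl) (use act_image_mult[OF g _ U'(4)] I(1) in blast)
  also have "\<dots> = translates_Int ((\<lambda>k. g \<otimes>\<^sub>L k) ` I)"
    unfolding translates_Int_def by simp
  finally have eq: "g ` Q = translates_Int ((\<lambda>k. g \<otimes>\<^sub>L k) ` I)" .
  have "(\<lambda>k. g \<otimes>\<^sub>L k) ` I \<subseteq> carrier L" using I(1) g by auto
  then show ?thesis unfolding eq translates_Ints_def using I(2) by blast
qed

text \<open>\<open>h g\<close> and \<open>g h\<close> differ by a commutator, which fixes
  \<open>U\<close> and with it every member of the family. Hence \<open>Plus h\<close> and
  \<open>Minus h\<close> commute with translation, which makes the splittings below compatible with
  the action.\<close>

lemma fam_commute:
  assumes g: "g \<in> carrier L" and h: "h \<in> carrier L" and Q: "Q \<in> translates_Ints"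
  shows "g ` h ` Q = h ` g ` Q"
proof -
  define c where "c = inv\<^sub>L h \<otimes>\<^sub>L inv\<^sub>L g \<otimes>\<^sub>L h \<otimes>\<^sub>L g"
  have c: "c \<in> carrier L" unfolding c_def using g h by simp
  have "c ` U = U" using commutator_fixes[OF U, of "inv\<^sub>L h" "inv\<^sub>L g"] g h unfolding c_def by simp
  then have cQ: "c ` Q = Q" using stabilizer_fam[OF c _ Q] by blast
  note Qc = fam_carrier[OF Q]
  have "h \<otimes>\<^sub>L g = (g \<otimes>\<^sub>L h) \<otimes>\<^sub>L c"
  proof -
    have "h \<otimes>\<^sub>L (inv\<^sub>L h \<otimes>\<^sub>L v) = v" if "v \<in> carrier L" for v
      using h that by (simp add: L.m_assoc[symmetric])
    moreover have "g \<otimes>\<^sub>L (inv\<^sub>L g \<otimes>\<^sub>L v) = v" if "v \<in> carrier L" for v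
      using g that by (simp add: L.m_assoc[symmetric])
    ultimately show ?thesis unfolding c_def using g h by (simp add: L.m_assoc)
  qed
  then have "(h \<otimes>\<^sub>L g) ` Q = (g \<otimes>\<^sub>L h) ` c ` Q"
    using act_image_mult[of "g \<otimes>\<^sub>L h" c Q] g h c Qc by simp
  then show ?thesis using act_image_mult[OF g h Qc] act_image_mult[OF h g Qc] cQ by simp
qed

lemma fam_Int: assumes "P \<in> translates_Ints" "Q \<in> translates_Ints" shows "P \<inter> Q \<in> translates_Ints"
proof -
  obtain I where I: "I \<subseteq> carrier L" "I \<noteq> {}" "P = translates_Int I" using famE[OF assms(1)] .
  obtain J where J: "J \<subseteq> carrier L" "J \<noteq> {}" "Q = translates_Int J" using famE[OF assms(2)] .
  have "P \<inter> Q = translates_Int (I \<union> J)" unfolding I J translates_Int_def by blast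
  then show ?thesis unfolding translates_Ints_def using I J by blast
qed

lemma fam_INT:
  assumes "N \<noteq> {}" "\<And>n. n \<in> N \<Longrightarrow> Q n \<in> translates_Ints" shows "(\<Inter>n\<in>N. Q n) \<in> translates_Ints"
proof -
  have "\<forall>n\<in>N. \<exists>I. I \<subseteq> carrier L \<and> I \<noteq> {} \<and> Q n = translates_Int I" using assms(2) famE by metis
  then obtain I where I: "\<And>n. n \<in> N \<Longrightarrow> I n \<subseteq> carrier L \<and> I n \<noteq> {} \<and> Q n = translates_Int (I n)" by metis
  have "(\<Inter>n\<in>N. Q n) = translates_Int (\<Union>n\<in>N. I n)" using I unfolding translates_Int_def by auto
  moreover have "(\<Union>n\<in>N. I n) \<subseteq> carrier L" "(\<Union>n\<in>N. I n) \<noteq> {}" using I assms(1) by blast+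
  ultimately show ?thesis unfolding translates_Ints_def by blast
qed

lemma fam_Plus: assumes "h \<in> carrier L" "Q \<in> translates_Ints" shows "Plus h Q \<in> translates_Ints"
  unfolding Plus_def by (rule fam_INT) (use assms fam_act in auto)

lemma fam_Minus: assumes "h \<in> carrier L" "Q \<in> translates_Ints" shows "Minus h Q \<in> translates_Ints"
  unfolding Minus_def using assms fam_Plus by simp

lemma fam_Plus_act:
  assumes h: "h \<in> carrier L" and g: "g \<in> carrier L" and Q: "Q \<in> translates_Ints"
  shows "g ` Plus h Q = Plus h (g ` Q)"
proof -
  have "g ` (\<Inter>i\<in>{0::int..}. (h \<up> i) ` Q) = (\<Inter>i\<in>{0::int..}. g ` (h \<up> i) ` Q)"
    by (rule act_image_INT[OF g]) (use h Q fam_carrier act_image_closed in auto)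
  also have "\<dots> = (\<Inter>i\<in>{0::int..}. (h \<up> i) ` g ` Q)"
    using fam_commute[OF g _ Q] h by simp
  finally show ?thesis unfolding Plus_def .
qed

lemma fam_Minus_act:
  assumes "h \<in> carrier L" "g \<in> carrier L" "Q \<in> translates_Ints"
  shows "g ` Minus h Q = Minus h (g ` Q)"
  unfolding Minus_def using assms fam_Plus_act by simp

lemma translates_Int_finite_tidy:
  assumes "finite J" "J \<noteq> {}" "J \<subseteq> carrier L" shows "translates_Int J \<in> tidy_all"
  using assms
proof (induction rule: finite_ne_induct)
  case (singleton x)
  then show ?case unfolding translates_Int_def using act_image_tidy[OF U] by simp
next
  case (insert x F)
  have "translates_Int (insert x F) = x ` U \<inter> translates_Int F" unfolding translates_Int_def by simp
  then show ?case using insert tidy_Int act_image_tidy[OF U] by simp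
qed

lemma Plus_mono: "P \<subseteq> Q \<Longrightarrow> Plus h P \<subseteq> Plus h Q"
  unfolding Plus_def by blast

lemma Minus_mono: "P \<subseteq> Q \<Longrightarrow> Minus h P \<subseteq> Minus h Q"
  unfolding Minus_def by (rule Plus_mono)

lemma fam_decomp: assumes h: "h \<in> carrier L" and Q: "Q \<in> translates_Ints"
  shows "Q = Plus h Q <#> Minus h Q"
proof
  note Qc = fam_carrier[OF Q]
  show "Plus h Q <#> Minus h Q \<subseteq> Q"
    using set_mult_subset[OF fam_subgroup[OF Q] Plus_subset[OF h Qc] Minus_subset[OF h Qc]] .
  obtain I where I: "I \<subseteq> carrier L" "I \<noteq> {}" "Q = translates_Int I" using famE[OF Q] .
  show "Q \<subseteq> Plus h Q <#> Minus h Q"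
  proof
    fix x assume x: "x \<in> Q"
    have xc: "x \<in> carrier G" using x Qc by blast
    have gU: "g ` U \<subseteq> carrier G" if "g \<in> I" for g using that I act_image_closed U' by blast
    \<comment> \<open>\<open>Z g\<close> collects the first factors of \<open>x\<close> that serve
      for the translate \<open>g U\<close>. Finitely many translates intersect in a tidy subgroup,
      whose decomposition gives a common first factor; compactness extends this to all of
      \<open>I\<close>.\<close>
    define Z where "Z g = Plus h (g ` U) \<inter> {a \<in> topspace T. inv a \<otimes> x \<in> Minus h (g ` U)}" for g
    have comp: "compactin T (Z g)" if "g \<in> I" for g
    proof -
      have gL: "g \<in> carrier L" using that I by blast
      have "closedin T (Minus h (g ` U))"
        using Minus_compact[OF h act_image_compact[OF gL U'(2)]] compact_closed by blast
      then have "closedin T {a \<in> topspace T. inv a \<otimes> x \<in> Minus h (g ` U)}"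
        using closedin_continuous_map_preimage[OF continuous_mult[OF inv_cont, of "\<lambda>_. x"]] xc by simp
      then show ?thesis unfolding Z_def
        using compact_Int_closedin[OF Plus_compact[OF h act_image_compact[OF gL U'(2)]]] by blast
    qed
    have "(\<Inter>g\<in>I. Z g) \<noteq> {}"
    proof
      assume "(\<Inter>g\<in>I. Z g) = {}"
      then have "\<Inter>(Z ` I) \<subseteq> {}" by simp
      then obtain \<F> where \<F>: "finite \<F>" "\<F> \<subseteq> Z ` I" "\<F> \<noteq> {}" "\<Inter>\<F> \<subseteq> {}"
        by (rule compact_Inter_subset_open[OF _ _ openin_empty, rotated 2]) (use I(2) comp in blast)+
      then obtain J where J: "finite J" "J \<subseteq> I" "\<F> = Z ` J" by (meson finite_subset_image)
      then have J0: "J \<noteq> {}" using \<F>(3) by blast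
      have tJ: "translates_Int J \<in> tidy_all" using translates_Int_finite_tidy J J0 I by blast
      have "x \<in> translates_Int J" using x J(2) unfolding I translates_Int_def by blast
      then obtain a b where ab: "a \<in> Plus h (translates_Int J)" "b \<in> Minus h (translates_Int J)" "x = a \<otimes> b"
        using tidy_decomp[OF tJ h] set_mult_mem by metis
      have "a \<in> Z g" if "g \<in> J" for g
      proof -
        have sub: "translates_Int J \<subseteq> g ` U" unfolding translates_Int_def using that by blast
        have "a \<in> Plus h (g ` U)" "b \<in> Minus h (g ` U)" using ab Plus_mono[OF sub] Minus_mono[OF sub] by blast+
        moreover have "a \<in> carrier G" "b \<in> carrier G"
          using calculation gU[of g] that J(2) Plus_subset[OF h] Minus_subset[OF h] by blast+
        moreover have "inv a \<otimes> x = b" using calculation ab by (simp add: m_assoc[symmetric])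
        ultimately show ?thesis unfolding Z_def by simp
      qed
      then show False using \<F>(4) J(3) by blast
    qed
    then obtain a where a: "\<And>g. g \<in> I \<Longrightarrow> a \<in> Z g" by blast
    have ac: "a \<in> carrier G" using a I(2) unfolding Z_def by auto
    have P: "Plus h Q = (\<Inter>g\<in>I. Plus h (g ` U))"
    proof (rule Set.set_eqI)
      fix y
      have "y \<in> (\<Inter>g\<in>I. Plus h (g ` U)) \<longleftrightarrow> (\<forall>g\<in>I. y \<in> Plus h (g ` U))" by blast
      also have "\<dots> \<longleftrightarrow> y \<in> Plus h Q"
        unfolding Plus_mem[OF h Qc] using Plus_mem[OF h gU] I(2) unfolding I(3) translates_Int_def
        by (simp add: Ball_def) blast
      finally show "y \<in> Plus h Q \<longleftrightarrow> y \<in> (\<Inter>g\<in>I. Plus h (g ` U))" by blast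
    qed
    have M: "Minus h Q = (\<Inter>g\<in>I. Minus h (g ` U))"
    proof (rule Set.set_eqI)
      fix y
      have "y \<in> (\<Inter>g\<in>I. Minus h (g ` U)) \<longleftrightarrow> (\<forall>g\<in>I. y \<in> Minus h (g ` U))" by blast
      also have "\<dots> \<longleftrightarrow> y \<in> Minus h Q"
        unfolding Minus_mem[OF h Qc] using Minus_mem[OF h gU] I(2) unfolding I(3) translates_Int_def
        by (simp add: Ball_def) blast
      finally show "y \<in> Minus h Q \<longleftrightarrow> y \<in> (\<Inter>g\<in>I. Minus h (g ` U))" by blast
    qed
    have "a \<in> Plus h Q" "inv a \<otimes> x \<in> Minus h Q" using a unfolding P M Z_def by blast+
    moreover have "x = a \<otimes> (inv a \<otimes> x)" using ac xc by (simp add: m_assoc[symmetric])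
    ultimately show "x \<in> Plus h Q <#> Minus h Q" unfolding set_mult_mem by blast
  qed
qed

end

section \<open>Splitting a tidy subgroup into expanded and contracted pieces\<close>

context flat_action begin

text \<open>Since \<open>g Q\<close> meets \<open>U\<close> only inside \<open>Q\<close>, the cosets
  of \<open>U\<close> met by \<open>g Q\<close> count the index of \<open>g Q \<inter> Q\<close> in
  \<open>g Q\<close>. Indices over the fixed open group \<open>U\<close> can thus be used for pieces
  \<open>Q\<close> that need not be open.\<close>

definition saturated :: "'a set \<Rightarrow> bool" where
  "saturated Q \<longleftrightarrow> Q \<in> translates_Ints \<and> Q \<subseteq> U \<and> (\<forall>g\<in>carrier L. g ` Q \<inter> U \<subseteq> Q)"

lemma saturated_U: "saturated U"
  unfolding saturated_def using fam_U by blast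

text \<open>Each backward iterate of a point of \<open>g (Plus h Q) \<inter> U\<close> lies in the
  compact \<open>g Q\<close>; tidiness keeps it in \<open>U\<close>, and saturation of
  \<open>Q\<close> brings it into \<open>Q\<close>.\<close>

lemma saturated_Plus:
  assumes Q: "saturated Q" and h: "h \<in> carrier L" shows "saturated (Plus h Q)"
  unfolding saturated_def
proof (intro conjI ballI)
  have Qf: "Q \<in> translates_Ints" "Q \<subseteq> U" and sat: "\<And>g. g \<in> carrier L \<Longrightarrow> g ` Q \<inter> U \<subseteq> Q"
    using Q unfolding saturated_def by blast+
  note Qc = fam_carrier[OF Qf(1)]
  show "Plus h Q \<in> translates_Ints" "Plus h Q \<subseteq> U" using fam_Plus[OF h Qf(1)] Plus_subset[OF h Qc] Qf(2) by blast+
  fix g assume g: "g \<in> carrier L"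
  have gQ: "g ` Q \<in> translates_Ints" using fam_act[OF g Qf(1)] .
  have eq: "g ` Plus h Q = Plus h (g ` Q)" using fam_Plus_act[OF h g Qf(1)] .
  show "g ` Plus h Q \<inter> U \<subseteq> Plus h Q"
  proof
    fix x assume x: "x \<in> g ` Plus h Q \<inter> U"
    then have xP: "x \<in> Plus h (g ` Q)" "x \<in> U" using eq by auto
    have orb: "(h \<up> i) x \<in> g ` Q" if "i \<le> 0" for i :: int
      using xP(1) that Plus_mem[OF h fam_carrier[OF gQ]] by blast
    have "x \<in> Plus h U" using tidy_backward[OF U h xP(2) fam_compact[OF gQ] orb] .
    then have "(h \<up> i) x \<in> g ` Q \<inter> U" if "i \<le> 0" for i :: int
      using orb[OF that] Plus_mem[OF h U'(4)] that by blast
    then have "(h \<up> i) x \<in> Q" if "i \<le> 0" for i :: int using sat[OF g] that by blast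
    then show "x \<in> Plus h Q" using Plus_mem[OF h Qc] xP(2) U'(4) by blast
  qed
qed

lemma saturated_Minus: "\<lbrakk>saturated Q; h \<in> carrier L\<rbrakk> \<Longrightarrow> saturated (Minus h Q)"
  unfolding Minus_def using saturated_Plus by simp

lemma cosets_eq_imp_subset:
  assumes eq: "(\<lambda>y. y <# U) ` A = (\<lambda>y. y <# U) ` B" and B: "subgroup B G" and A: "A \<subseteq> B" and y: "y \<in> B"
  obtains a u where "a \<in> A" "u \<in> U \<inter> B" "y = a \<otimes> u"
proof -
  have "y <# U \<in> (\<lambda>y. y <# U) ` A" using eq y by blast
  then obtain a where a: "a \<in> A" "y <# U = a <# U" by blast
  have c: "a \<in> carrier G" "y \<in> carrier G" using a A y subgroup.subset[OF B] by blast+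
  have "inv a \<otimes> y \<in> U" using lcoset_eq_iff[OF U'(1) c] a by simp
  moreover have "inv a \<otimes> y \<in> B"
    using a(1) A y subgroup.m_closed[OF B] subgroup.m_inv_closed[OF B] by blast
  moreover have "y = a \<otimes> (inv a \<otimes> y)" using c by (simp add: m_assoc[symmetric])
  ultimately show thesis using that a(1) by blast
qed

text \<open>The termination measure of the splitting. Inverses are counted too because words in the
  generators use them.\<close>

definition weight :: "('a \<Rightarrow> 'a) set \<Rightarrow> 'a set \<Rightarrow> nat" where
  "weight S Q = (\<Sum>s\<in>S. cidx U (s ` Q) + cidx U ((inv\<^sub>L s) ` Q))"

text \<open>
  If the weight did not drop, every generator would satisfy \<open>s Q \<subseteq> s Q\<^sub>+ Q\<close>, hence \<open>g Q \<subseteq> R Q\<close> for all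
  \<open>g\<close>, where \<open>R\<close> is generated by the translates of \<open>Q\<^sub>+\<close>.  Applied to the powers of \<open>h\<close>
  this gives \<open>Q\<^sub>- \<subseteq> Q\<^sub>+\<close>.
\<close>

lemma weight_Plus_less:
  assumes S: "finite S" "S \<subseteq> carrier L" "carrier L = generate L S"
    and Q: "saturated Q" and h: "h \<in> carrier L" and ne: "Plus h Q \<noteq> Q"
    and ne': "Minus h Q \<noteq> Q"
  shows "weight S (Plus h Q) < weight S Q"
proof (rule ccontr)
  assume not: "\<not> weight S (Plus h Q) < weight S Q"
  define P where "P = Plus h Q"
  define M where "M = Minus h Q"
  have Qf: "Q \<in> translates_Ints" "Q \<subseteq> U" and sat: "\<And>g. g \<in> carrier L \<Longrightarrow> g ` Q \<inter> U \<subseteq> Q"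
    using Q unfolding saturated_def by blast+
  note Qc = fam_carrier[OF Qf(1)]
  have PQ: "P \<subseteq> Q" "P \<in> translates_Ints" unfolding P_def using Plus_subset[OF h Qc] fam_Plus[OF h Qf(1)] by blast+
  have MQ: "M \<subseteq> Q" "M \<in> translates_Ints" unfolding M_def using Minus_subset[OF h Qc] fam_Minus[OF h Qf(1)] by blast+
  have QPM: "Q = P <#> M" unfolding P_def M_def using fam_decomp[OF h Qf(1)] .
  have Pc: "P \<subseteq> carrier G" using PQ Qc by blast
  have mono: "cidx U (g ` P) \<le> cidx U (g ` Q)" if "g \<in> carrier L" for g
    by (rule cidx_mono[OF image_mono[OF PQ(1)] act_image_compact[OF that fam_compact[OF Qf(1)]] U'(3,1)])
  have eqs: "cidx U (s ` P) = cidx U (s ` Q) \<and> cidx U ((inv\<^sub>L s) ` P) = cidx U ((inv\<^sub>L s) ` Q)" if "s \<in> S" for s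
  proof (rule ccontr)
    assume "\<not> ?thesis"
    then have "cidx U (s ` P) + cidx U ((inv\<^sub>L s) ` P) < cidx U (s ` Q) + cidx U ((inv\<^sub>L s) ` Q)"
      using mono[of s] mono[of "inv\<^sub>L s"] that S(2) by fastforce
    then have "weight S P < weight S Q" unfolding weight_def
    proof (rule sum_strict_mono_ex1[OF S(1) _ bexI[OF _ that], rotated])
      show "\<forall>x\<in>S. cidx U (x ` P) + cidx U ((inv\<^sub>L x) ` P) \<le> cidx U (x ` Q) + cidx U ((inv\<^sub>L x) ` Q)"
        using mono S(2) by (intro ballI add_mono) auto
    qed
    then show False using not P_def by simp
  qed
  define R where "R = generate G (\<Union>g\<in>carrier L. g ` P)"
  have gP: "g ` P \<subseteq> carrier G" if "g \<in> carrier L" for g using act_image_closed[OF that Pc] .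
  have Rs: "subgroup R G" unfolding R_def by (rule generate_is_subgroup) (use gP in blast)
  have Rc: "R \<subseteq> carrier G" using subgroup.subset[OF Rs] .
  have gPR: "g ` P \<subseteq> R" if "g \<in> carrier L" for g unfolding R_def
    by (rule subsetI, rule generate.incl, rule UN_I[OF that])
  have PR: "P \<subseteq> R" using gPR[of "\<one>\<^bsub>L\<^esub>"] act_image_one[OF Pc] by simp
  have Ract: "k r \<in> R" if "r \<in> R" "k \<in> carrier L" for r k
    using that(1) unfolding R_def
  proof (induction r rule: generate.induct)
    case one then show ?case using that(2) generate.one by simp
  next
    case (incl r)
    then obtain g where g: "g \<in> carrier L" "r \<in> g ` P" by blast
    then have "k r \<in> (k \<otimes>\<^sub>L g) ` P" using act_image_mult[OF that(2) g(1) Pc] by blast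
    then show ?case using gPR[of "k \<otimes>\<^sub>L g"] that(2) g(1) unfolding R_def by blast
  next
    case (inv r)
    then obtain g where g: "g \<in> carrier L" "r \<in> g ` P" by blast
    have rc: "r \<in> carrier G" using g gP by blast
    have "k r \<in> (k \<otimes>\<^sub>L g) ` P" using act_image_mult[OF that(2) g(1) Pc] g by blast
    then have "k r \<in> R" using gPR[of "k \<otimes>\<^sub>L g"] that(2) g(1) by blast
    then show ?case using subgroup.m_inv_closed[OF Rs] rc that(2) unfolding R_def by simp
  next
    case (eng r r')
    then have "r \<in> carrier G" "r' \<in> carrier G" using Rc unfolding R_def by blast+
    then show ?case using eng generate.eng that(2) by simp
  qed
  \<comment> \<open>A translate of \<open>P\<close> is \<open>Plus h\<close> of a translate of
    \<open>Q\<close>, so backward orbits in it are bounded, and products keep this property.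
    Tidiness then puts all of \<open>R \<inter> U\<close> into \<open>Plus h U\<close>.\<close>
  have Rbdd: "\<exists>C. compactin T C \<and> (\<forall>i\<le>0::int. (h \<up> i) r \<in> C)" if "r \<in> R" for r
    using that unfolding R_def
  proof (induction r rule: generate.induct)
    case one then show ?case using h by (intro exI[of _ "{\<one>}"]) simp
  next
    case (incl r)
    then obtain g where g: "g \<in> carrier L" "r \<in> g ` P" by blast
    then have "r \<in> Plus h (g ` Q)" unfolding P_def using fam_Plus_act[OF h g(1) Qf(1)] by simp
    then show ?case
      using Plus_mem[OF h fam_carrier[OF fam_act[OF g(1) Qf(1)]]] fam_compact[OF fam_act[OF g(1) Qf(1)]] by blast
  next
    case (inv r)
    then obtain g where g: "g \<in> carrier L" "r \<in> g ` P" by blast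
    then have "r \<in> Plus h (g ` Q)" unfolding P_def using fam_Plus_act[OF h g(1) Qf(1)] by simp
    then have r: "(h \<up> i) r \<in> g ` Q" "r \<in> carrier G" if "i \<le> 0" for i :: int
      using Plus_mem[OF h fam_carrier[OF fam_act[OF g(1) Qf(1)]]] that by blast+
    have "(h \<up> i) (inv r) \<in> g ` Q" if "i \<le> 0" for i :: int
      using r[OF that] h subgroup.m_inv_closed[OF fam_subgroup[OF fam_act[OF g(1) Qf(1)]]] by simp
    then show ?case using fam_compact[OF fam_act[OF g(1) Qf(1)]] by blast
  next
    case (eng r r')
    then obtain C C' where C: "compactin T C" "\<forall>i\<le>0::int. (h \<up> i) r \<in> C"
      "compactin T C'" "\<forall>i\<le>0::int. (h \<up> i) r' \<in> C'" by blast
    have c: "r \<in> carrier G" "r' \<in> carrier G" using eng Rc unfolding R_def by blast+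
    have "(h \<up> i) (r \<otimes> r') \<in> C <#> C'" if "i \<le> 0" for i :: int
    proof -
      have "(h \<up> i) (r \<otimes> r') = (h \<up> i) r \<otimes> (h \<up> i) r'" using h c by simp
      then show ?thesis using C that unfolding set_mult_mem by blast
    qed
    then show ?case using compact_set_mult[OF C(1,3)] by blast
  qed
  have RU: "r \<in> Plus h U" if "r \<in> R" "r \<in> U" for r
    using tidy_backward[OF U h that(2)] Rbdd[OF that(1)] by blast
  have gen: "s ` Q \<subseteq> R <#> Q" if sL: "s \<in> carrier L" and e: "cidx U (s ` P) = cidx U (s ` Q)" for s
  proof
    fix y assume y: "y \<in> s ` Q"
    have fin: "finite ((\<lambda>y. y <# U) ` s ` Q)"
      using finite_cosets[OF act_image_compact[OF sL fam_compact[OF Qf(1)]] U'(3,1)] .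
    have "(\<lambda>y. y <# U) ` s ` P = (\<lambda>y. y <# U) ` s ` Q"
      by (rule card_subset_eq[OF fin]) (use PQ e in \<open>auto simp: cidx_def\<close>)
    then obtain a u where "a \<in> s ` P" "u \<in> U \<inter> s ` Q" "y = a \<otimes> u"
      using cosets_eq_imp_subset[OF _ act_image_subgroup[OF sL fam_subgroup[OF Qf(1)]] image_mono[OF PQ(1)] y] by metis
    then show "y \<in> R <#> Q" using gPR[OF sL] sat[OF sL] unfolding set_mult_mem by blast
  qed
  have all: "g ` Q \<subseteq> R <#> Q" if "g \<in> carrier L" for g
    using that unfolding S(3)
  proof (induction g rule: generate.induct)
    case one
    have "Q \<subseteq> R <#> Q" using subset_set_mult_right[OF Qc subgroup.one_closed[OF Rs]] .
    then show ?case using act_image_one[OF Qc] by simp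
  next
    case (incl s) then show ?case using gen eqs S(2) by blast
  next
    case (inv s) then show ?case using gen[of "inv\<^sub>L s"] eqs S(2) by blast
  next
    case (eng g1 g2)
    have g: "g1 \<in> carrier L" "g2 \<in> carrier L" using eng S(3) by auto
    have "(g1 \<otimes>\<^sub>L g2) ` Q = g1 ` g2 ` Q" using act_image_mult[OF g Qc] .
    also have "\<dots> \<subseteq> g1 ` (R <#> Q)" using eng by blast
    also have "\<dots> = g1 ` R <#> g1 ` Q" using act_image_set_mult[OF g(1) Rc Qc] .
    also have "\<dots> \<subseteq> R <#> (R <#> Q)" by (rule set_mult_mono) (use Ract g eng in auto)
    also have "\<dots> = (R <#> R) <#> Q" using set_mult_assoc[OF Rc Rc Qc] by simp
    also have "\<dots> \<subseteq> R <#> Q" by (rule set_mult_mono[OF set_mult_subset[OF Rs order_refl order_refl] order_refl])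
    finally show ?case .
  qed
  have Msat: "saturated M" unfolding M_def using saturated_Minus[OF Q h] .
  have "M \<subseteq> P"
  proof
    fix x assume x: "x \<in> M"
    have xc: "x \<in> carrier G" using x MQ Qc by blast
    \<comment> \<open>The iterate is written as \<open>r' \<otimes> m\<close> with \<open>r'\<close>
      in \<open>R\<close> and \<open>m\<close> in \<open>M\<close>. Pulled back to time zero,
      \<open>r'\<close> becomes a quotient \<open>z\<close> of elements of \<open>M\<close>, so
      \<open>z\<close> lies in \<open>R \<inter> U\<close> and its backward iterate
      \<open>r'\<close> is still in \<open>U\<close>; saturation of \<open>M\<close> returns
      \<open>r'\<close> to \<open>M\<close>.\<close>
    have "(h \<up> i) x \<in> Q" if i: "i \<le> 0" for i :: int
    proof -
      have "(h \<up> i) x \<in> R <#> Q" using all[of "h \<up> i"] h x MQ by blast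
      then obtain r q where "r \<in> R" "q \<in> Q" "(h \<up> i) x = r \<otimes> q" unfolding set_mult_mem by blast
      moreover obtain p m where "p \<in> P" "m \<in> M" "q = p \<otimes> m" using QPM calculation(2) set_mult_mem by metis
      ultimately have rm: "r \<in> R" "p \<in> P" "m \<in> M" "(h \<up> i) x = r \<otimes> (p \<otimes> m)" by auto
      define r' where "r' = r \<otimes> p"
      have r'R: "r' \<in> R" unfolding r'_def using rm PR subgroup.m_closed[OF Rs] by blast
      have c: "r \<in> carrier G" "p \<in> carrier G" "m \<in> carrier G" "r' \<in> carrier G" using rm r'R Rc MQ PQ Qc by blast+
      have xr: "(h \<up> i) x = r' \<otimes> m" unfolding r'_def using rm c by (simp add: m_assoc)
      define z where "z = (h \<up> (- i)) r'"
      have z: "z \<in> carrier G" "(h \<up> i) z = r'" unfolding z_def using h c by (simp_all add: pw_add)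
      have hm: "(h \<up> (- i)) m \<in> M" using Minus_shift[OF h Qc, of m "- i"] rm i unfolding M_def by simp
      have "x = (h \<up> (- i)) ((h \<up> i) x)" using h xc by (simp add: pw_add)
      then have "x = z \<otimes> (h \<up> (- i)) m" unfolding xr z_def using h c by simp
      then have "z = x \<otimes> inv ((h \<up> (- i)) m)" using z h c by (simp add: m_assoc)
      then have zM: "z \<in> M"
        using x hm subgroup.m_closed[OF fam_subgroup[OF MQ(2)]] subgroup.m_inv_closed[OF fam_subgroup[OF MQ(2)]] by simp
      have "z \<in> R" unfolding z_def using Ract[OF r'R] h by simp
      then have "z \<in> Plus h U" using RU zM MQ(1) Qf(2) by blast
      then have "r' \<in> U" using Plus_mem[OF h U'(4)] i z(2) by blast
      moreover have "r' \<in> (h \<up> i) ` M" using zM z(2) by blast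
      ultimately have "r' \<in> M" using Msat h unfolding saturated_def by (meson IntI pw_closed subsetD)
      then have "r' \<otimes> m \<in> M" using rm subgroup.m_closed[OF fam_subgroup[OF MQ(2)]] by blast
      then show ?thesis using xr MQ(1) by auto
    qed
    then show "x \<in> P" unfolding P_def using Plus_mem[OF h Qc] xc by blast
  qed
  then have "Q \<subseteq> P" using QPM set_mult_subset[OF fam_subgroup[OF PQ(2)] order_refl] by metis
  then show False using ne PQ(1) P_def by blast
qed

lemma weight_Minus_less:
  assumes "finite S" "S \<subseteq> carrier L" "carrier L = generate L S"
    and "saturated Q" and "h \<in> carrier L" and "Plus h Q \<noteq> Q" and "Minus h Q \<noteq> Q"
  shows "weight S (Minus h Q) < weight S Q"
  using weight_Plus_less[OF assms(1-4), of "inv\<^sub>L h"] assms(5-7) by (simp add: Plus_inv Minus_inv)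

text \<open>\<open>between Q b c\<close> makes \<open>b\<close> a point on a geodesic from the identity to \<open>c\<close>.\<close>

definition between :: "'a set \<Rightarrow> ('a \<Rightarrow> 'a) \<Rightarrow> ('a \<Rightarrow> 'a) \<Rightarrow> bool" where
  "between Q b c \<longleftrightarrow> Q \<inter> c ` Q \<subseteq> b ` Q \<and> Q \<inter> c ` Q \<subseteq> (inv\<^sub>L b \<otimes>\<^sub>L c) ` Q"

text \<open>\<open>Q \<inter> c Q\<close> belongs to the family, so it is the product of its
  \<open>Plus\<close> and \<open>Minus\<close> parts, and by commutation these are the corresponding
  intersections for \<open>Plus h Q\<close> and \<open>Minus h Q\<close>.\<close>

lemma between_split:
  assumes Q: "Q \<in> translates_Ints" and h: "h \<in> carrier L" and b: "b \<in> carrier L" and c: "c \<in> carrier L"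
    and P: "between (Plus h Q) b c" and M: "between (Minus h Q) b c"
  shows "between Q b c"
proof -
  note Qc = fam_carrier[OF Q]
  have cQ: "c ` Q \<in> translates_Ints" using fam_act[OF c Q] .
  note cQc = fam_carrier[OF cQ]
  have 1: "Plus h (Q \<inter> c ` Q) = Plus h Q \<inter> c ` Plus h Q" "Minus h (Q \<inter> c ` Q) = Minus h Q \<inter> c ` Minus h Q"
    using Plus_Int[OF h Qc cQc] Minus_Int[OF h Qc cQc] fam_Plus_act[OF h c Q] fam_Minus_act[OF h c Q] by auto
  have sub: "Q \<inter> c ` Q \<subseteq> g ` Q"
    if g: "g \<in> carrier L" and "Plus h Q \<inter> c ` Plus h Q \<subseteq> g ` Plus h Q" "Minus h Q \<inter> c ` Minus h Q \<subseteq> g ` Minus h Q" for g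
  proof -
    have "g ` Plus h Q \<subseteq> g ` Q" "g ` Minus h Q \<subseteq> g ` Q"
      using Plus_subset[OF h Qc] Minus_subset[OF h Qc] by (simp_all add: image_mono)
    then have "Plus h (Q \<inter> c ` Q) \<subseteq> g ` Q" "Minus h (Q \<inter> c ` Q) \<subseteq> g ` Q" using that 1 by auto
    then show ?thesis
      using fam_decomp[OF h fam_Int[OF Q cQ]] set_mult_subset[OF fam_subgroup[OF fam_act[OF g Q]]] by metis
  qed
  show ?thesis using P M sub[OF b] sub[of "inv\<^sub>L b \<otimes>\<^sub>L c"] b c unfolding between_def by simp
qed

end

section \<open>Well-quasi-ordering of the acting group by geodesics\<close>

lemma nat_seq_mono_subseq:
  fixes f :: "nat \<Rightarrow> nat"
  obtains r :: "nat \<Rightarrow> nat" where "strict_mono r" "\<And>k l. k \<le> l \<Longrightarrow> f (r k) \<le> f (r l)"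
proof -
  obtain g where g: "strict_mono g" "monoseq (\<lambda>n. f (g n))" using seq_monosub[of f] by blast
  show thesis
  proof (cases "\<forall>m. \<forall>n\<ge>m. f (g m) \<le> f (g n)")
    case True
    then show thesis using that[OF g(1)] by blast
  next
    case False
    then have dec: "\<And>m n. m \<le> n \<Longrightarrow> f (g n) \<le> f (g m)" using g(2) unfolding monoseq_def by blast
    obtain N where N: "\<And>n. f (g N) \<le> f (g n)" using ex_has_least_nat[of "\<lambda>_. True" 0 "\<lambda>n. f (g n)"] by auto
    have const: "f (g (n + N)) = f (g N)" for n using dec[of N "n + N"] N by (simp add: antisym)
    show thesis
    proof (rule that)
      show "strict_mono (\<lambda>n. g (n + N))" using g(1) by (simp add: strict_mono_def)
      show "f (g (k + N)) \<le> f (g (l + N))" for k l using const by simp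
    qed
  qed
qed

lemma infinite_nat_subseq:
  assumes "\<And>n::nat. A n \<or> B n"
  obtains r :: "nat \<Rightarrow> nat" where "strict_mono r" "\<And>n. A (r n)"
    | r :: "nat \<Rightarrow> nat" where "strict_mono r" "\<And>n. B (r n)"
proof (cases "infinite {n. A n}")
  case True
  then show thesis using infinite_enumerate[of "{n. A n}"] that(1) by blast
next
  case False
  moreover have "{n. A n} \<union> {n. B n} = UNIV" using assms by blast
  ultimately have "infinite {n. B n}" by (metis finite_Un infinite_UNIV_nat)
  then show thesis using infinite_enumerate[of "{n. B n}"] that(2) by blast
qed

context flat_action begin

text \<open>A whole subsequence with all its pairs comparable is demanded, not merely one good pair:
  this form survives passing to a further subsequence, which is how the conditions for two pieces
  are met simultaneously.\<close>

definition between_wqo :: "'a set \<Rightarrow> bool" where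
  "between_wqo Q \<longleftrightarrow> (\<forall>\<beta>::nat \<Rightarrow> 'a \<Rightarrow> 'a. (\<forall>n. \<beta> n \<in> carrier L) \<longrightarrow>
     (\<exists>r::nat \<Rightarrow> nat. strict_mono r \<and> (\<forall>k l. k < l \<longrightarrow> between Q (\<beta> (r k)) (\<beta> (r l)))))"

lemma between_wqo_split:
  assumes Q: "Q \<in> translates_Ints" and h: "h \<in> carrier L" and P: "between_wqo (Plus h Q)" and M: "between_wqo (Minus h Q)"
  shows "between_wqo Q"
  unfolding between_wqo_def
proof (intro allI impI)
  fix \<beta> :: "nat \<Rightarrow> 'a \<Rightarrow> 'a" assume \<beta>: "\<forall>n. \<beta> n \<in> carrier L"
  obtain r :: "nat \<Rightarrow> nat" where r: "strict_mono r" "\<And>k l. k < l \<Longrightarrow> between (Plus h Q) (\<beta> (r k)) (\<beta> (r l))"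
    using P \<beta> unfolding between_wqo_def by blast
  obtain s :: "nat \<Rightarrow> nat" where s: "strict_mono s" "\<And>k l. k < l \<Longrightarrow> between (Minus h Q) (\<beta> (r (s k))) (\<beta> (r (s l)))"
    using M[unfolded between_wqo_def, rule_format, of "\<lambda>n. \<beta> (r n)"] \<beta> by auto
  show "\<exists>r::nat \<Rightarrow> nat. strict_mono r \<and> (\<forall>k l. k < l \<longrightarrow> between Q (\<beta> (r k)) (\<beta> (r l)))"
  proof (intro exI[of _ "r \<circ> s"] conjI allI impI)
    show "strict_mono (r \<circ> s)" using r s strict_mono_o by blast
    fix k l :: nat assume "k < l"
    then show "between Q (\<beta> ((r \<circ> s) k)) (\<beta> ((r \<circ> s) l))"
      using between_split[OF Q h] \<beta> r(2) s strict_monoD[OF s(1)] by simp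
  qed
qed

text \<open>Some subsequence consists of elements that all expand or all contract \<open>Q\<close>.
  For expanding elements the translates form a chain in which, by saturation, the index decides
  inclusion, so a subsequence of nondecreasing index is ordered. Contracting elements are compared
  through their inverses.\<close>

lemma between_wqo_monotone:
  assumes Q: "saturated Q" and mon: "\<And>g. g \<in> carrier L \<Longrightarrow> Q \<subseteq> g ` Q \<or> g ` Q \<subseteq> Q"
  shows "between_wqo Q"
  unfolding between_wqo_def
proof (intro allI impI)
  fix \<beta> :: "nat \<Rightarrow> 'a \<Rightarrow> 'a" assume \<beta>: "\<forall>n. \<beta> n \<in> carrier L"
  have Qf: "Q \<in> translates_Ints" and sat: "\<And>g. g \<in> carrier L \<Longrightarrow> g ` Q \<inter> U \<subseteq> Q"
    using Q unfolding saturated_def by blast+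
  note Qc = fam_carrier[OF Qf]
  have gQc: "g ` Q \<subseteq> carrier G" if "g \<in> carrier L" for g using act_image_closed[OF that Qc] .
  have inv_sub: "(inv\<^sub>L g) ` A \<subseteq> B \<longleftrightarrow> A \<subseteq> g ` B" if "g \<in> carrier L" "A \<subseteq> carrier G" "B \<subseteq> carrier G" for g A B
    using act_image_mono_iff[OF that(1) act_image_closed[of "inv\<^sub>L g" A] that(3)] act_image_inv_right[OF that(1,2)] that by simp
  have sub_inv: "A \<subseteq> (inv\<^sub>L g) ` B \<longleftrightarrow> g ` A \<subseteq> B" if "g \<in> carrier L" "A \<subseteq> carrier G" "B \<subseteq> carrier G" for g A B
    using inv_sub[of "inv\<^sub>L g" A B] that by simp
  have chain: "b ` Q \<subseteq> c ` Q"
    if b: "b \<in> carrier L" "Q \<subseteq> b ` Q" and c: "c \<in> carrier L" "Q \<subseteq> c ` Q" and le: "cidx U (b ` Q) \<le> cidx U (c ` Q)" for b c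
  proof -
    have bcL: "inv\<^sub>L b \<otimes>\<^sub>L c \<in> carrier L" using b c by simp
    have bc: "(inv\<^sub>L b \<otimes>\<^sub>L c) ` Q = (inv\<^sub>L b) ` c ` Q" using act_image_mult b c Qc by simp
    from mon[OF bcL] show ?thesis
    proof
      assume "Q \<subseteq> (inv\<^sub>L b \<otimes>\<^sub>L c) ` Q"
      then show ?thesis unfolding bc using sub_inv[OF b(1) Qc gQc[OF c(1)]] by blast
    next
      assume "(inv\<^sub>L b \<otimes>\<^sub>L c) ` Q \<subseteq> Q"
      then have cb: "c ` Q \<subseteq> b ` Q" unfolding bc using inv_sub[OF b(1) gQc[OF c(1)] Qc] by blast
      have fin: "finite ((\<lambda>y. y <# U) ` b ` Q)"
        using finite_cosets[OF act_image_compact[OF b(1) fam_compact[OF Qf]] U'(3,1)] .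
      have eq: "(\<lambda>y. y <# U) ` c ` Q = (\<lambda>y. y <# U) ` b ` Q"
        by (rule card_seteq[OF fin]) (use cb le in \<open>auto simp: cidx_def\<close>)
      show ?thesis
      proof
        fix y assume y: "y \<in> b ` Q"
        obtain a u where au: "a \<in> c ` Q" "u \<in> U \<inter> b ` Q" "y = a \<otimes> u"
          using cosets_eq_imp_subset[OF eq act_image_subgroup[OF b(1) fam_subgroup[OF Qf]] cb y] by metis
        then have "u \<in> c ` Q" using sat[OF b(1)] c(2) by blast
        then show "y \<in> c ` Q"
          using au subgroup.m_closed[OF act_image_subgroup[OF c(1) fam_subgroup[OF Qf]]] by blast
      qed
    qed
  qed
  have bt1: "between Q b c" if b: "b \<in> carrier L" "Q \<subseteq> b ` Q" and c: "c \<in> carrier L" and bc: "b ` Q \<subseteq> c ` Q" for b c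
  proof -
    have "Q \<subseteq> (inv\<^sub>L b) ` c ` Q" using sub_inv[OF b(1) Qc gQc[OF c]] bc by blast
    moreover have "(inv\<^sub>L b \<otimes>\<^sub>L c) ` Q = (inv\<^sub>L b) ` c ` Q" using act_image_mult b c Qc by simp
    ultimately show ?thesis unfolding between_def using b by blast
  qed
  have bt2: "between Q b c" if b: "b \<in> carrier L" "b ` Q \<subseteq> Q" and c: "c \<in> carrier L" and bc: "c ` Q \<subseteq> b ` Q" for b c
  proof -
    have "b ` c ` Q = c ` b ` Q" using fam_commute[OF b(1) c Qf] .
    also have "\<dots> \<subseteq> c ` Q" using b by blast
    finally have "c ` Q \<subseteq> (inv\<^sub>L b) ` c ` Q" using sub_inv[OF b(1) gQc[OF c] gQc[OF c]] by blast
    moreover have "(inv\<^sub>L b \<otimes>\<^sub>L c) ` Q = (inv\<^sub>L b) ` c ` Q" using act_image_mult b c Qc by simp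
    ultimately show ?thesis unfolding between_def using bc by blast
  qed
  consider r :: "nat \<Rightarrow> nat" where "strict_mono r" "\<And>n. Q \<subseteq> \<beta> (r n) ` Q"
    | r :: "nat \<Rightarrow> nat" where "strict_mono r" "\<And>n. \<beta> (r n) ` Q \<subseteq> Q"
    using infinite_nat_subseq[of "\<lambda>n. Q \<subseteq> \<beta> n ` Q" "\<lambda>n. \<beta> n ` Q \<subseteq> Q"] mon \<beta> by metis
  then show "\<exists>r::nat \<Rightarrow> nat. strict_mono r \<and> (\<forall>k l. k < l \<longrightarrow> between Q (\<beta> (r k)) (\<beta> (r l)))"
  proof cases
    case (1 r)
    obtain s :: "nat \<Rightarrow> nat" where s: "strict_mono s" "\<And>k l. k \<le> l \<Longrightarrow> cidx U (\<beta> (r (s k)) ` Q) \<le> cidx U (\<beta> (r (s l)) ` Q)"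
      using nat_seq_mono_subseq[of "\<lambda>n. cidx U (\<beta> (r n) ` Q)"] by blast
    show ?thesis
    proof (intro exI[of _ "r \<circ> s"] conjI allI impI)
      show "strict_mono (r \<circ> s)" using 1 s strict_mono_o by blast
      fix k l :: nat assume "k < l"
      then show "between Q (\<beta> ((r \<circ> s) k)) (\<beta> ((r \<circ> s) l))"
        using bt1 chain 1 \<beta> s(2)[of k l] by simp
    qed
  next
    case (2 r)
    obtain s :: "nat \<Rightarrow> nat" where s: "strict_mono s"
      "\<And>k l. k \<le> l \<Longrightarrow> cidx U ((inv\<^sub>L (\<beta> (r (s k)))) ` Q) \<le> cidx U ((inv\<^sub>L (\<beta> (r (s l)))) ` Q)"
      using nat_seq_mono_subseq[of "\<lambda>n. cidx U ((inv\<^sub>L (\<beta> (r n))) ` Q)"] by blast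
    show ?thesis
    proof (intro exI[of _ "r \<circ> s"] conjI allI impI)
      show "strict_mono (r \<circ> s)" using 2 s strict_mono_o by blast
      fix k l :: nat assume kl: "k < l"
      define b c where "b = \<beta> (r (s k))" and "c = \<beta> (r (s l))"
      have bc: "b \<in> carrier L" "c \<in> carrier L" "b ` Q \<subseteq> Q" "c ` Q \<subseteq> Q" unfolding b_def c_def using \<beta> 2 by auto
      have "Q \<subseteq> (inv\<^sub>L b) ` Q" "Q \<subseteq> (inv\<^sub>L c) ` Q" using sub_inv Qc bc by auto
      then have "(inv\<^sub>L b) ` Q \<subseteq> (inv\<^sub>L c) ` Q"
        using chain[of "inv\<^sub>L b" "inv\<^sub>L c"] bc s(2)[of k l] kl unfolding b_def c_def by simp
      then have "c ` (inv\<^sub>L b) ` Q \<subseteq> Q"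
        using sub_inv[OF bc(2) gQc[of "inv\<^sub>L b"] Qc] bc by simp
      then have "(inv\<^sub>L b) ` c ` Q \<subseteq> Q" using fam_commute[OF bc(2) _ Qf, of "inv\<^sub>L b"] bc by simp
      then have "c ` Q \<subseteq> b ` Q" using inv_sub[OF bc(1) gQc[OF bc(2)] Qc] by blast
      then show "between Q (\<beta> ((r \<circ> s) k)) (\<beta> ((r \<circ> s) l))"
        using bt2[OF bc(1,3,2)] unfolding b_def c_def by simp
    qed
  qed
qed

end

locale fg_flat_action = flat_action +
  fixes S
  assumes S: "finite S" "S \<subseteq> carrier L" "carrier L = generate L S"
begin

text \<open>Induction on the weight: an \<open>h\<close> that neither expands nor contracts
  \<open>Q\<close> splits it into two lighter saturated pieces, and if there is no such
  \<open>h\<close>, every element is monotone on \<open>Q\<close>.\<close>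

lemma between_wqo_saturated: "saturated Q \<Longrightarrow> between_wqo Q"
proof (induction "weight S Q" arbitrary: Q rule: less_induct)
  case less
  have Qf: "Q \<in> translates_Ints" using less.prems unfolding saturated_def by blast
  note Qc = fam_carrier[OF Qf]
  show ?case
  proof (cases "\<exists>h\<in>carrier L. Plus h Q \<noteq> Q \<and> Minus h Q \<noteq> Q")
    case True
    then obtain h where h: "h \<in> carrier L" "Plus h Q \<noteq> Q" "Minus h Q \<noteq> Q" by blast
    have "between_wqo (Plus h Q)"
      using less.hyps[OF weight_Plus_less[OF S less.prems h] saturated_Plus[OF less.prems h(1)]] .
    moreover have "between_wqo (Minus h Q)"
      using less.hyps[OF weight_Minus_less[OF S less.prems h] saturated_Minus[OF less.prems h(1)]] .
    ultimately show ?thesis using between_wqo_split[OF Qf h(1)] by blast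
  next
    case False
    show ?thesis
    proof (rule between_wqo_monotone[OF less.prems])
      fix g assume g: "g \<in> carrier L"
      then consider "Plus g Q = Q" | "Minus g Q = Q" using False by blast
      then show "Q \<subseteq> g ` Q \<or> g ` Q \<subseteq> Q"
      proof cases
        case 1 then show ?thesis using Plus_expanding[OF g Qc] by simp
      next
        case 2
        then have "Q \<subseteq> (inv\<^sub>L g) ` Q" using Plus_expanding[of "inv\<^sub>L g" Q] Qc g unfolding Minus_def by simp
        then have "g ` Q \<subseteq> g ` (inv\<^sub>L g) ` Q" by (rule image_mono)
        then show ?thesis using act_image_inv_right[OF g Qc] by simp
      qed
    qed
  qed
qed

text \<open>Otherwise a sequence could be chosen in which no member lies between the identity and a
  later member. Elements fixing \<open>U\<close> are left out because a step by one of them makes no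
  progress in the sense of \<open>dist_id_less\<close>.\<close>

lemma finite_between:
  obtains F where "finite F" "F \<subseteq> {g \<in> carrier L. g ` U \<noteq> U}"
    "\<And>b. \<lbrakk>b \<in> carrier L; b ` U \<noteq> U\<rbrakk> \<Longrightarrow> \<exists>f\<in>F. between U f b"
proof (rule ccontr)
  assume a: "\<not> thesis"
  note outer = that
  let ?X = "{g \<in> carrier L. g ` U \<noteq> U}"
  have nx: "\<exists>b\<in>?X. \<forall>f\<in>F. \<not> between U f b" if "finite F" "F \<subseteq> ?X" for F
  proof (rule ccontr)
    assume "\<not> ?thesis"
    then have "\<exists>f\<in>F. between U f b" if "b \<in> carrier L" "b ` U \<noteq> U" for b using that by blast
    then have thesis using outer[OF that] by blast
    then show False using a by blast
  qed
  have "\<exists>\<beta>. \<forall>n::nat. \<beta> n \<in> ?X \<and> (\<forall>k<n. \<not> between U (\<beta> k) (\<beta> n))"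
  proof (rule dependent_wellorder_choice)
    fix n :: nat and \<beta> assume IH: "\<And>k. k < n \<Longrightarrow> \<beta> k \<in> ?X \<and> (\<forall>j<k. \<not> between U (\<beta> j) (\<beta> k))"
    then have "\<beta> ` {..<n} \<subseteq> ?X" by blast
    then obtain b where "b \<in> ?X" "\<forall>f\<in>\<beta> ` {..<n}. \<not> between U f b" using nx[of "\<beta> ` {..<n}"] by blast
    then show "\<exists>b. b \<in> ?X \<and> (\<forall>k<n. \<not> between U (\<beta> k) b)" by blast
  qed simp
  then obtain \<beta> :: "nat \<Rightarrow> 'a \<Rightarrow> 'a" where \<beta>: "\<And>n. \<beta> n \<in> ?X" "\<And>n k. k < n \<Longrightarrow> \<not> between U (\<beta> k) (\<beta> n)" by blast
  have "\<forall>n. \<beta> n \<in> carrier L" using \<beta>(1) by blast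
  then obtain r :: "nat \<Rightarrow> nat" where r: "strict_mono r" "\<And>k l. k < l \<Longrightarrow> between U (\<beta> (r k)) (\<beta> (r l))"
    using between_wqo_saturated[OF saturated_U] unfolding between_wqo_def by blast
  have "r 0 < r 1" using strict_monoD[OF r(1)] by simp
  then show False using \<beta>(2) r(2)[of 0 1] by simp
qed

end

section \<open>Geodesic steps towards the stabilizer\<close>

context flat_action begin

text \<open>By \<open>imp\<close>, \<open>k\<close> induces a surjection from the cosets of
  \<open>U\<close> met by \<open>A\<close> onto those met by \<open>k A\<close>. Equal counts make
  it injective, and injectivity at the trivial coset is the converse of \<open>imp\<close>.\<close>

lemma cidx_image_le:
  assumes A: "subgroup A G" "compactin T A" and k: "k \<in> carrier L"
    and imp: "\<And>v. \<lbrakk>v \<in> A; v \<in> U\<rbrakk> \<Longrightarrow> k v \<in> U"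
  shows "cidx U (k ` A) \<le> cidx U A"
    and "cidx U (k ` A) = cidx U A \<Longrightarrow> v \<in> A \<Longrightarrow> k v \<in> U \<Longrightarrow> v \<in> U"
proof -
  note Ac = subgroup.subset[OF A(1)]
  let ?c = "\<lambda>y. y <# U"
  have fin: "finite (?c ` A)" using finite_cosets[OF A(2) U'(3,1)] .
  define \<phi> where "\<phi> Y = ?c (k (SOME y. y \<in> A \<and> ?c y = Y))" for Y
  have \<phi>: "\<phi> (?c y) = ?c (k y)" if y: "y \<in> A" for y
  proof -
    define z where "z = (SOME z. z \<in> A \<and> ?c z = ?c y)"
    have z: "z \<in> A" "?c z = ?c y" using someI[of "\<lambda>z. z \<in> A \<and> ?c z = ?c y" y] y unfolding z_def by auto
    have c: "z \<in> carrier G" "y \<in> carrier G" using z y Ac by auto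
    have "inv z \<otimes> y \<in> U" using lcoset_eq_iff[OF U'(1) c] z(2) by simp
    moreover have "inv z \<otimes> y \<in> A" using z y subgroup.m_closed[OF A(1)] subgroup.m_inv_closed[OF A(1)] by blast
    ultimately have "k (inv z \<otimes> y) \<in> U" using imp by blast
    then have "?c (k z) = ?c (k y)" using lcoset_eq_iff[OF U'(1), of "k z" "k y"] c k by simp
    then show ?thesis unfolding \<phi>_def z_def by simp
  qed
  have im: "?c ` k ` A = \<phi> ` ?c ` A" unfolding image_image using \<phi> by simp
  show "cidx U (k ` A) \<le> cidx U A" unfolding cidx_def im using card_image_le[OF fin] .
  show "v \<in> U" if eq: "cidx U (k ` A) = cidx U A" and v: "v \<in> A" "k v \<in> U"
  proof -
    have inj: "inj_on \<phi> (?c ` A)" using eq unfolding cidx_def im by (rule eq_card_imp_inj_on[OF fin])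
    have 1: "\<one> \<in> A" using subgroup.one_closed[OF A(1)] .
    have "?c (k \<one>) = ?c (k v)" using lcoset_eq_iff[OF U'(1), of "k \<one>" "k v"] v k Ac by auto
    then have "\<phi> (?c \<one>) = \<phi> (?c v)" using \<phi> 1 v by simp
    then have "?c \<one> = ?c v" using inj 1 v by (meson imageI inj_onD)
    then show "v \<in> U" using lcoset_eq_iff[OF U'(1), of \<one> v] v Ac by auto
  qed
qed

text \<open>A natural number, unlike \<open>displacement\<close>, so that induction can run on it.
  Its least value \<open>2\<close> is taken exactly on the stabilizer of \<open>U\<close>.\<close>

definition dist_id :: "('a \<Rightarrow> 'a) \<Rightarrow> nat" where
  "dist_id b = cidx U (b ` U) + cidx U ((inv\<^sub>L b) ` U)"

text \<open>Betweenness is what \<open>cidx_image_le\<close> needs to show that neither index grows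
  from \<open>b\<close> to \<open>b' = f^-1 b\<close>. If both stayed equal, its converse part would
  give \<open>U \<inter> b U = f U \<inter> b U = U \<inter> b' U\<close>; as \<open>f\<close> maps
  the last group onto the middle one, it would fix an open subgroup of \<open>U\<close>, hence
  \<open>U\<close>.\<close>

lemma dist_id_less:
  assumes f: "f \<in> carrier L" "f ` U \<noteq> U" and b: "b \<in> carrier L" and bt: "between U f b"
  shows "dist_id (inv\<^sub>L f \<otimes>\<^sub>L b) < dist_id b"
proof (rule ccontr)
  assume not: "\<not> ?thesis"
  define b' where "b' = inv\<^sub>L f \<otimes>\<^sub>L b"
  have b': "b' \<in> carrier L" unfolding b'_def using f b by simp
  have bt1: "U \<inter> b ` U \<subseteq> f ` U" and bt2: "U \<inter> b ` U \<subseteq> b' ` U" using bt unfolding between_def b'_def by auto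
  have sg: "subgroup (g ` U) G" "compactin T (g ` U)" if "g \<in> carrier L" for g
    using act_image_subgroup[OF that U'(1)] act_image_compact[OF that U'(2)] by auto
  have im1: "(inv\<^sub>L f) ` b ` U = b' ` U" unfolding b'_def using act_image_mult[of "inv\<^sub>L f" b U] f b U'(4) by simp
  \<comment> \<open>\<open>k\<close> carries the translate by the inverse of \<open>b\<close> to the
    translate by the inverse of \<open>b'\<close>, which brings the second index into the form of
    \<open>cidx_image_le\<close> as well.\<close>
  define k where "k = inv\<^sub>L b' \<otimes>\<^sub>L b"
  have k: "k \<in> carrier L" unfolding k_def using b b' by simp
  have im2: "k ` (inv\<^sub>L b) ` U = (inv\<^sub>L b') ` U"
    unfolding k_def using act_image_mult[of "inv\<^sub>L b'" b "(inv\<^sub>L b) ` U"] act_image_inv_right[OF b U'(4)]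
      act_image_closed[of "inv\<^sub>L b" U] b b' U'(4) by simp
  have imp1: "(inv\<^sub>L f) v \<in> U" if "v \<in> b ` U" "v \<in> U" for v
    using bt1 that act_image_mem_iff[OF f(1) U'(4)] by blast
  have imp2: "k v \<in> U" if "v \<in> (inv\<^sub>L b) ` U" "v \<in> U" for v
  proof -
    have vc: "v \<in> carrier G" "b v \<in> U" using that U'(4) act_inv_image_mem_iff[OF b U'(4)] by auto
    then have "b v \<in> b' ` U" using bt2 that(2) by blast
    then have "(inv\<^sub>L b') (b v) \<in> U" using act_image_mem_iff[OF b' U'(4)] by blast
    then show ?thesis unfolding k_def using b b' vc by simp
  qed
  have le: "cidx U (b' ` U) \<le> cidx U (b ` U)" "cidx U ((inv\<^sub>L b') ` U) \<le> cidx U ((inv\<^sub>L b) ` U)"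
    using cidx_image_le(1)[OF sg[OF b], where k="inv\<^sub>L f"] imp1
      cidx_image_le(1)[OF sg[of "inv\<^sub>L b"] k] imp2 im1 im2 f(1) b by simp_all
  then have eq: "cidx U (b' ` U) = cidx U (b ` U)" "cidx U ((inv\<^sub>L b') ` U) = cidx U ((inv\<^sub>L b) ` U)"
    using not unfolding dist_id_def b'_def[symmetric] by auto
  have s1: "f ` U \<inter> b ` U \<subseteq> U"
  proof
    fix v assume v: "v \<in> f ` U \<inter> b ` U"
    then have "(inv\<^sub>L f) v \<in> U" using act_image_mem_iff[OF f(1) U'(4)] by blast
    then show "v \<in> U" using cidx_image_le(2)[OF sg[OF b], where k="inv\<^sub>L f" and v=v] imp1 eq(1) im1 v f(1)
      by simp
  qed
  have s2: "U \<inter> b' ` U \<subseteq> b ` U"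
  proof
    fix v assume v: "v \<in> U \<inter> b' ` U"
    define y where "y = (inv\<^sub>L b) v"
    have vc: "v \<in> carrier G" "(inv\<^sub>L b') v \<in> U" using v act_image_mem_iff[OF b' U'(4)] by auto
    have "k y = (inv\<^sub>L b') v" unfolding k_def y_def using b b' vc by simp
    then have "y \<in> U" using cidx_image_le(2)[OF sg[of "inv\<^sub>L b"] k, where v=y] imp2 eq(2) im2 v vc b
      unfolding y_def by simp
    then show "v \<in> b ` U" unfolding y_def using act_image_mem_iff[OF b U'(4)] vc by blast
  qed
  define D where "D = U \<inter> b ` U"
  have D1: "D = f ` U \<inter> b ` U" unfolding D_def using s1 bt1 by blast
  have D2: "D = U \<inter> b' ` U" unfolding D_def using s2 bt2 by blast
  have "f ` b' ` U = b ` U" using im1 act_image_inv_right[OF f(1) act_image_closed[OF b U'(4)]] by simp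
  then have "f ` D = D"
    unfolding D2 using act_image_Int[OF f(1) U'(4) act_image_closed[OF b' U'(4)]] D1 D2 by simp
  moreover have "subgroup D G" "openin T D" "D \<subseteq> U"
    unfolding D_def using subgroups_Inter_pair[OF U'(1) sg(1)[OF b]] U'(3) act_image_open[OF b U'(3)] openin_Int by auto
  ultimately have "f ` U = U" using tidy_for_fixes_if_fixes_open[OF f(1) tidy_all_tidy_for[OF U f(1)]] by blast
  then show False using f(2) by blast
qed

end

section \<open>Invariant open subgroups\<close>

context taction begin

lemma subgroup_open_if_nbhd:
  assumes V: "subgroup V G" and N: "openin T N" "\<one> \<in> N" "N \<subseteq> V" shows "openin T V"
proof -
  have Vc: "V \<subseteq> carrier G" using subgroup.subset[OF V] .
  have "V = V <#> N"
  proof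
    show "V <#> N \<subseteq> V" using set_mult_subset[OF V order_refl N(3)] .
    show "V \<subseteq> V <#> N" using subset_set_mult_left[OF Vc N(2)] .
  qed
  then show ?thesis using open_set_mult_right[OF Vc N(1)] by simp
qed

lemma compact_nbhd_one:
  assumes C: "compactin T C" and W: "openin (prod_topology T T) W" and sub: "C \<times> {\<one>} \<subseteq> W"
  obtains N where "openin T N" "\<one> \<in> N" "\<And>c x. \<lbrakk>c \<in> C; x \<in> N\<rbrakk> \<Longrightarrow> (c, x) \<in> W"
proof -
  obtain A N where "openin T N" "C \<subseteq> A" "\<one> \<in> N" "A \<times> N \<subseteq> W"
    using tube_lemma_left[OF W C _ sub] by auto
  then show thesis using that by blast
qed

text \<open>The component of \<open>\<one>\<close> in \<open>U\<close> is trivial, and in a locally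
  compact Hausdorff space a compact component has arbitrarily small clopen neighbourhoods.\<close>

lemma small_compact_open:
  assumes td: "totally_disconnected_space T" and U: "compactin T U" "openin T U" "\<one> \<in> U"
    and \<Omega>: "openin T \<Omega>" "\<one> \<in> \<Omega>"
  obtains A where "openin T A" "compactin T A" "\<one> \<in> A" "A \<subseteq> U" "A \<subseteq> \<Omega>"
proof -
  let ?X = "subtopology T U"
  have top: "topspace ?X = U" using compact_subset_carrier[OF U(1)] by (simp add: inf_absorb2)
  have haus: "Hausdorff_space ?X" by (simp add: Hausdorff_T Hausdorff_space_subtopology)
  have comp: "compact_space ?X" using U(1) compact_space_subtopology by blast
  have lc: "locally_compact_space ?X" using comp compact_imp_locally_compact_space haus by blast
  have conn: "connected_component_of_set ?X \<one> = {\<one>}"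
  proof -
    have "connectedin T (connected_component_of_set ?X \<one>)"
      using connectedin_connected_component_of[of ?X \<one>] connectedin_subtopology by blast
    moreover have "\<one> \<in> connected_component_of_set ?X \<one>"
      using U(3) top by (simp add: connected_component_of_refl)
    ultimately show ?thesis using td unfolding totally_disconnected_space_def by blast
  qed
  have "{\<one>} \<in> connected_components_of ?X"
    unfolding connected_components_of_def using conn U(3) top by force
  moreover have "compactin ?X {\<one>}" using U(3) top by simp
  moreover have "openin ?X (\<Omega> \<inter> U)" using \<Omega>(1) openin_subtopology by blast
  ultimately obtain A B where AB: "openin ?X A" "openin ?X B" "disjnt A B" "A \<union> B = topspace ?X" "{\<one>} \<subseteq> A" "A \<subseteq> \<Omega> \<inter> U"
    using wilder_locally_compact_component_thm[OF lc haus, of "{\<one>}" "\<Omega> \<inter> U"] U(3) \<Omega>(2) by auto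
  have "openin T A" using AB(1) U(2) openin_open_subtopology by blast
  moreover have "compactin T A"
  proof -
    have "A = topspace ?X - B" using AB(3,4) unfolding disjnt_def by blast
    then have "closedin ?X A" using AB(2) by blast
    then have "compactin ?X A" using comp closedin_compact_space by blast
    then show ?thesis using compactin_subtopology by blast
  qed
  ultimately show thesis using that AB by blast
qed

text \<open>Van Dantzig's theorem with normality. \<open>B\<close> is the stabilizer of a compact
  open \<open>A\<close> under left translation, and \<open>V\<close> is the intersection of the
  conjugates of \<open>B\<close> under \<open>U\<close>; both contain a neighbourhood of
  \<open>\<one>\<close> by the tube lemma, over the compact sets \<open>A\<close> and
  \<open>U\<close>.\<close>

lemma small_normal_open_subgroup:
  assumes td: "totally_disconnected_space T" and U: "compactin T U" "openin T U" "subgroup U G"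
    and \<Omega>: "openin T \<Omega>" "\<one> \<in> \<Omega>"
  obtains V where "subgroup V G" "openin T V" "V \<subseteq> U" "V \<subseteq> \<Omega>"
    "\<And>u x. \<lbrakk>u \<in> U; x \<in> V\<rbrakk> \<Longrightarrow> u \<otimes> x \<otimes> inv u \<in> V"
proof -
  have Uc: "U \<subseteq> carrier G" using subgroup.subset[OF U(3)] .
  obtain A where A: "openin T A" "compactin T A" "\<one> \<in> A" "A \<subseteq> U" "A \<subseteq> \<Omega>"
    using small_compact_open[OF td U(1,2) subgroup.one_closed[OF U(3)] \<Omega>] .
  have Ac: "A \<subseteq> carrier G" using A(4) Uc by blast
  define B where "B = {x \<in> carrier G. \<forall>a\<in>A. x \<otimes> a \<in> A \<and> inv x \<otimes> a \<in> A}"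
  have Bs: "subgroup B G"
  proof (rule subgroupI)
    show "B \<subseteq> carrier G" unfolding B_def by blast
    have "\<one> \<in> B" unfolding B_def using Ac by auto
    then show "B \<noteq> {}" by blast
    fix x assume x: "x \<in> B"
    then show "inv x \<in> B" unfolding B_def by simp
    fix y assume y: "y \<in> B"
    show "x \<otimes> y \<in> B" unfolding B_def
    proof (intro CollectI conjI ballI)
      have c: "x \<in> carrier G" "y \<in> carrier G" using x y unfolding B_def by auto
      then show "x \<otimes> y \<in> carrier G" by simp
      fix a assume a: "a \<in> A"
      then have ac: "a \<in> carrier G" using Ac by blast
      have "x \<otimes> (y \<otimes> a) \<in> A" "inv y \<otimes> (inv x \<otimes> a) \<in> A" using x y a unfolding B_def by auto
      then show "x \<otimes> y \<otimes> a \<in> A" "inv (x \<otimes> y) \<otimes> a \<in> A" using c ac by (simp_all add: m_assoc inv_mult_group)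
    qed
  qed
  have BA: "B \<subseteq> A" unfolding B_def using A(3) by force
  have "openin T B"
  proof -
    let ?W = "{z \<in> topspace (prod_topology T T). snd z \<otimes> fst z \<in> A} \<inter> {z \<in> topspace (prod_topology T T). inv (snd z) \<otimes> fst z \<in> A}"
    have "openin (prod_topology T T) ?W"
      by (intro openin_Int openin_continuous_map_preimage[OF _ A(1)] continuous_mult continuous_inv
          continuous_map_fst continuous_map_snd)
    moreover have "A \<times> {\<one>} \<subseteq> ?W" using Ac by auto
    ultimately obtain N where N: "openin T N" "\<one> \<in> N" "\<And>a x. \<lbrakk>a \<in> A; x \<in> N\<rbrakk> \<Longrightarrow> (a, x) \<in> ?W"
      using compact_nbhd_one[OF A(2)] by blast
    have "N \<subseteq> B" unfolding B_def using N(3) open_subset_carrier[OF N(1)] by auto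
    then show ?thesis using subgroup_open_if_nbhd[OF Bs N(1,2)] by blast
  qed
  define V where "V = {x \<in> carrier G. \<forall>u\<in>U. u \<otimes> x \<otimes> inv u \<in> B}"
  have Bc: "B \<subseteq> carrier G" using subgroup.subset[OF Bs] .
  have Vs: "subgroup V G"
  proof (rule subgroupI)
    show "V \<subseteq> carrier G" unfolding V_def by blast
    have "u \<otimes> \<one> \<otimes> inv u \<in> B" if "u \<in> U" for u using that Uc subgroup.one_closed[OF Bs] by (auto simp: subset_iff)
    then have "\<one> \<in> V" unfolding V_def by simp
    then show "V \<noteq> {}" by blast
    fix x assume x: "x \<in> V"
    then have xc: "x \<in> carrier G" unfolding V_def by blast
    show "inv x \<in> V" unfolding V_def
    proof (intro CollectI conjI ballI)
      fix u assume u: "u \<in> U"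
      then have uc: "u \<in> carrier G" using Uc by blast
      have "inv (u \<otimes> x \<otimes> inv u) \<in> B" using x u subgroup.m_inv_closed[OF Bs] unfolding V_def by blast
      then show "u \<otimes> inv x \<otimes> inv u \<in> B" using uc xc by (simp add: inv_mult_group m_assoc)
    qed (use xc in simp)
    fix y assume y: "y \<in> V"
    then have yc: "y \<in> carrier G" unfolding V_def by blast
    show "x \<otimes> y \<in> V" unfolding V_def
    proof (intro CollectI conjI ballI)
      fix u assume u: "u \<in> U"
      then have uc: "u \<in> carrier G" using Uc by blast
      have "(u \<otimes> x \<otimes> inv u) \<otimes> (u \<otimes> y \<otimes> inv u) \<in> B"
        using x y u subgroup.m_closed[OF Bs] unfolding V_def by blast
      moreover have "inv u \<otimes> (u \<otimes> (y \<otimes> inv u)) = y \<otimes> inv u" using uc yc by (simp add: m_assoc[symmetric])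
      ultimately show "u \<otimes> (x \<otimes> y) \<otimes> inv u \<in> B" using uc xc yc by (simp add: m_assoc)
    qed (use xc yc in simp)
  qed
  have Vo: "openin T V"
  proof -
    let ?W = "{z \<in> topspace (prod_topology T T). fst z \<otimes> snd z \<otimes> inv (fst z) \<in> B}"
    have "openin (prod_topology T T) ?W"
      by (intro openin_continuous_map_preimage[OF _ \<open>openin T B\<close>] continuous_mult continuous_inv
          continuous_map_fst continuous_map_snd)
    moreover have "U \<times> {\<one>} \<subseteq> ?W" using Uc subgroup.one_closed[OF Bs] by (auto simp: subset_iff)
    ultimately obtain N where N: "openin T N" "\<one> \<in> N" "\<And>u x. \<lbrakk>u \<in> U; x \<in> N\<rbrakk> \<Longrightarrow> (u, x) \<in> ?W"
      using compact_nbhd_one[OF U(1)] by blast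
    have "N \<subseteq> V" unfolding V_def using N(3) open_subset_carrier[OF N(1)] by auto
    then show ?thesis using subgroup_open_if_nbhd[OF Vs N(1,2)] by blast
  qed
  have VB: "V \<subseteq> B" unfolding V_def using subgroup.one_closed[OF U(3)] by force
  show thesis
  proof (rule that[OF Vs Vo])
    show "V \<subseteq> U" "V \<subseteq> \<Omega>" using VB BA A by blast+
    fix u x assume u: "u \<in> U" and x: "x \<in> V"
    then have c: "u \<in> carrier G" "x \<in> carrier G" using Uc unfolding V_def by auto
    show "u \<otimes> x \<otimes> inv u \<in> V" unfolding V_def
    proof (intro CollectI conjI ballI)
      fix v assume v: "v \<in> U"
      then have vc: "v \<in> carrier G" using Uc by blast
      have "(v \<otimes> u) \<otimes> x \<otimes> inv (v \<otimes> u) \<in> B" using x u v subgroup.m_closed[OF U(3)] unfolding V_def by blast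
      then show "v \<otimes> (u \<otimes> x \<otimes> inv u) \<otimes> inv v \<in> B" using c vc by (simp add: m_assoc inv_mult_group)
    qed (use c in simp)
  qed
qed

lemma normalized_set_mult_subgroup:
  assumes X: "subgroup X G" and V: "subgroup V G"
    and norm: "\<And>u x. \<lbrakk>u \<in> X; x \<in> V\<rbrakk> \<Longrightarrow> u \<otimes> x \<otimes> inv u \<in> V"
  shows "subgroup (X <#> V) G"
proof (rule subgroupI)
  note Xc = subgroup.subset[OF X] and Vc = subgroup.subset[OF V]
  show "X <#> V \<subseteq> carrier G" using set_mult_closed Xc Vc by blast
  show "X <#> V \<noteq> {}" using subgroup.one_closed[OF X] subgroup.one_closed[OF V] unfolding set_mult_def by blast
  fix a assume "a \<in> X <#> V"
  then obtain x v where xv: "x \<in> X" "v \<in> V" "a = x \<otimes> v" unfolding set_mult_mem by blast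
  have c: "x \<in> carrier G" "v \<in> carrier G" using xv Xc Vc by auto
  have ix: "inv x \<in> X" using subgroup.m_inv_closed[OF X xv(1)] .
  have "inv x \<otimes> inv v \<otimes> inv (inv x) \<in> V" using norm[OF ix subgroup.m_inv_closed[OF V xv(2)]] .
  moreover have "inv a = inv x \<otimes> (x \<otimes> inv v \<otimes> inv x)" "inv a = inv x \<otimes> (inv (inv x) \<otimes> inv v \<otimes> inv x)"
    using c xv(3) by (simp_all add: inv_mult_group m_assoc[symmetric])
  moreover have "x \<otimes> inv v \<otimes> inv x \<in> V" using norm[OF xv(1) subgroup.m_inv_closed[OF V xv(2)]] .
  ultimately show "inv a \<in> X <#> V" using ix unfolding set_mult_mem by blast
  fix b assume "b \<in> X <#> V"
  then obtain y w where yw: "y \<in> X" "w \<in> V" "b = y \<otimes> w" unfolding set_mult_mem by blast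
  have d: "y \<in> carrier G" "w \<in> carrier G" using yw Xc Vc by auto
  have iy: "inv y \<in> X" using subgroup.m_inv_closed[OF X yw(1)] .
  have "(inv y \<otimes> v \<otimes> inv (inv y)) \<otimes> w \<in> V" using norm[OF iy xv(2)] subgroup.m_closed[OF V] yw by blast
  moreover have "a \<otimes> b = (x \<otimes> y) \<otimes> ((inv y \<otimes> v \<otimes> inv (inv y)) \<otimes> w)"
  proof -
    have "y \<otimes> (inv y \<otimes> (v \<otimes> (y \<otimes> w))) = v \<otimes> (y \<otimes> w)" using c d by (simp add: m_assoc[symmetric])
    then show ?thesis using c d xv yw by (simp add: m_assoc)
  qed
  moreover have "x \<otimes> y \<in> X" using subgroup.m_closed[OF X xv(1) yw(1)] .
  ultimately show "a \<otimes> b \<in> X <#> V" unfolding set_mult_mem by blast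
qed

definition inv_open :: "'a set \<Rightarrow> 'a set \<Rightarrow> bool" where
  "inv_open K V \<longleftrightarrow> subgroup V G \<and> V \<subseteq> K \<and> openin (subtopology T K) V \<and> (\<forall>g\<in>carrier L. g ` V = V)"

definition Res :: "'a set \<Rightarrow> 'a set" where
  "Res K = \<Inter>{V. inv_open K V}"

lemma invariant_if_gens:
  assumes S: "S \<subseteq> carrier L" "carrier L = generate L S" and X: "X \<subseteq> carrier G"
    and gen: "\<And>s. s \<in> S \<Longrightarrow> s ` X \<subseteq> X" "\<And>s. s \<in> S \<Longrightarrow> (inv\<^sub>L s) ` X \<subseteq> X"
    and g: "g \<in> carrier L"
  shows "g ` X = X"
proof -
  have sub: "g ` X \<subseteq> X" if "g \<in> carrier L" for g
    using that unfolding S(2)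
  proof (induction g rule: generate.induct)
    case one then show ?case using act_image_one[OF X] by simp
  next
    case (incl h) then show ?case using gen by blast
  next
    case (inv h) then show ?case using gen by blast
  next
    case (eng h1 h2)
    have "h1 \<in> carrier L" "h2 \<in> carrier L" using eng S by auto
    then have "(h1 \<otimes>\<^sub>L h2) ` X = h1 ` h2 ` X" by (rule act_image_mult[OF _ _ X])
    then show ?case using eng by blast
  qed
  show ?thesis using act_image_invariant[OF X sub g] .
qed

lemma inv_openD:
  assumes "inv_open K V" shows "subgroup V G" "V \<subseteq> K" "openin (subtopology T K) V" "\<And>g. g \<in> carrier L \<Longrightarrow> g ` V = V"
  using assms unfolding inv_open_def by blast+

lemma relatively_open_subgroup_compact:
  assumes K: "compactin T K" "subgroup K G"
    and V': "subgroup V G" "V \<subseteq> K" "openin (subtopology T K) V"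
  shows "compactin T V"
proof -
  have Kc: "K \<subseteq> carrier G" using subgroup.subset[OF K(2)] .
  obtain \<Omega> where \<Omega>: "openin T \<Omega>" "V = \<Omega> \<inter> K" using V'(3) unfolding openin_subtopology by blast
  have Vc: "V \<subseteq> carrier G" using V' Kc by blast
  define N where "N = (\<Union>x\<in>K - V. x <# \<Omega>)"
  have "openin T N" unfolding N_def using open_lcoset[OF _ \<Omega>(1)] Kc by blast
  moreover have "V = K - N"
  proof
    show "K - N \<subseteq> V"
    proof
      fix x assume x: "x \<in> K - N"
      show "x \<in> V"
      proof (rule ccontr)
        assume "x \<notin> V"
        moreover have "x \<in> x <# \<Omega>"
          using l_coset_mem_iff[of x \<Omega> x] open_subset_carrier[OF \<Omega>(1)] x Kc subgroup.one_closed[OF V'(1)] \<Omega>(2) by auto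
        ultimately show False using x unfolding N_def by blast
      qed
    qed
    show "V \<subseteq> K - N"
    proof
      fix v assume v: "v \<in> V"
      have "v \<notin> x <# \<Omega>" if x: "x \<in> K - V" for x
      proof
        assume a: "v \<in> x <# \<Omega>"
        have c: "x \<in> carrier G" "v \<in> carrier G" using x v Vc Kc by auto
        have "inv x \<otimes> v \<in> \<Omega>" using a l_coset_mem_iff[OF c(1) open_subset_carrier[OF \<Omega>(1)]] by blast
        moreover have "inv x \<otimes> v \<in> K"
          using x v V'(2) subgroup.m_closed[OF K(2)] subgroup.m_inv_closed[OF K(2)] by blast
        ultimately have "inv x \<otimes> v \<in> V" using \<Omega>(2) by blast
        then have "v \<otimes> inv (inv x \<otimes> v) \<in> V" using v subgroup.m_closed[OF V'(1)] subgroup.m_inv_closed[OF V'(1)] by blast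
        moreover have "v \<otimes> inv (inv x \<otimes> v) = x" using c by (simp add: inv_mult_group m_assoc[symmetric])
        ultimately show False using x by simp
      qed
      then show "v \<in> K - N" unfolding N_def using v V'(2) by blast
    qed
  qed
  ultimately have "closedin T V" using compact_closed[OF K(1)] by (simp add: closedin_diff)
  then show ?thesis using closed_compactin[OF K(1) V'(2)] by blast
qed

lemma inv_open_compact: "\<lbrakk>compactin T K; subgroup K G; inv_open K V\<rbrakk> \<Longrightarrow> compactin T V"
  using relatively_open_subgroup_compact inv_openD by blast

lemma inv_open_Int: assumes "inv_open K V" "inv_open K W" shows "inv_open K (V \<inter> W)"
proof -
  note V = inv_openD[OF assms(1)] and W = inv_openD[OF assms(2)]
  have "g ` (V \<inter> W) = V \<inter> W" if "g \<in> carrier L" for g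
    using act_image_Int[OF that subgroup.subset[OF V(1)] subgroup.subset[OF W(1)]] V(4) W(4) that by simp
  moreover have "subgroup (V \<inter> W) G" "openin (subtopology T K) (V \<inter> W)" "V \<inter> W \<subseteq> K"
    using subgroups_Inter_pair[OF V(1) W(1)] openin_Int[OF V(3) W(3)] V(2) by blast+
  ultimately show ?thesis unfolding inv_open_def by blast
qed

lemma inv_open_Inter:
  assumes "finite \<F>" "\<F> \<noteq> {}" "\<And>V. V \<in> \<F> \<Longrightarrow> inv_open K V" shows "inv_open K (\<Inter>\<F>)"
  using assms
proof (induction rule: finite_ne_induct)
  case (insert V \<F>)
  then have "inv_open K (V \<inter> \<Inter>\<F>)" using inv_open_Int by blast
  then show ?case by simp
qed simp

context
  fixes K
  assumes K: "compactin T K" "subgroup K G" "\<And>g. g \<in> carrier L \<Longrightarrow> g ` K = K"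
begin

lemma inv_open_self: "inv_open K K"
proof -
  have "topspace (subtopology T K) = K" using subgroup.subset[OF K(2)] by (simp add: inf_absorb2)
  then have "openin (subtopology T K) K" using openin_topspace by metis
  then show ?thesis unfolding inv_open_def using K by blast
qed

lemma Res_subset: "Res K \<subseteq> K"
  unfolding Res_def using inv_open_self by blast

lemma Res_subgroup: "subgroup (Res K) G"
  unfolding Res_def by (rule subgroups_Inter) (use inv_open_self inv_openD in blast)+

lemma Res_compact: "compactin T (Res K)"
  unfolding Res_def
  by (rule closed_compactin_Inter[OF K(1)]) (use inv_open_self inv_open_compact[OF K(1,2)] compact_closed in blast)+

lemma Res_invariant: assumes g: "g \<in> carrier L" shows "g ` Res K = Res K"
proof -
  have "g ` (\<Inter>V\<in>{V. inv_open K V}. V) = (\<Inter>V\<in>{V. inv_open K V}. g ` V)"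
    by (rule act_image_INT[OF g]) (use inv_open_self inv_openD(1) subgroup.subset in blast)+
  also have "\<dots> = (\<Inter>V\<in>{V. inv_open K V}. V)"
    by (intro INF_cong refl) (use inv_openD(4) g in blast)
  finally show ?thesis unfolding Res_def by simp
qed

text \<open>
  An open invariant subgroup \<open>V\<close> of the residual \<open>R\<close> extends to an open invariant subgroup \<open>Y \<inter> V N\<close> of \<open>K\<close>: on an
  invariant open \<open>Y\<close> close enough to \<open>R\<close>, the subgroup \<open>V N\<close> is respected by the finitely many generators.
\<close>

theorem Res_no_proper_open:
  assumes td: "totally_disconnected_space T" and U: "compactin T U" "openin T U" "subgroup U G" "K \<subseteq> U"
    and S: "finite S" "S \<subseteq> carrier L" "carrier L = generate L S"
    and V: "inv_open (Res K) V"
  shows "V = Res K"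
proof
  note V' = inv_openD[OF V]
  show "V \<subseteq> Res K" using V' by blast
  let ?R = "Res K"
  have RU: "?R \<subseteq> U" "?R \<subseteq> carrier G" using Res_subset U(4) subgroup.subset[OF Res_subgroup] by blast+
  obtain \<Omega> where \<Omega>: "openin T \<Omega>" "V = \<Omega> \<inter> ?R" using V'(3) unfolding openin_subtopology by blast
  have 1: "\<one> \<in> \<Omega>" using subgroup.one_closed[OF V'(1)] \<Omega>(2) by blast
  obtain N where N: "subgroup N G" "openin T N" "N \<subseteq> U" "N \<subseteq> \<Omega>" "\<And>u x. \<lbrakk>u \<in> U; x \<in> N\<rbrakk> \<Longrightarrow> u \<otimes> x \<otimes> inv u \<in> N"
    using small_normal_open_subgroup[OF td U(1-3) \<Omega>(1) 1] by blast
  have NR: "N \<inter> ?R \<subseteq> V" using N(4) \<Omega>(2) by blast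
  have Nc: "N \<subseteq> carrier G" using subgroup.subset[OF N(1)] .
  define S' where "S' = S \<union> (\<lambda>s. inv\<^sub>L s) ` S"
  have S': "finite S'" "S' \<subseteq> carrier L" unfolding S'_def using S(1,2) by auto
  \<comment> \<open>Elements of \<open>N'\<close> lie in \<open>N\<close> and are mapped into
    \<open>N\<close> by every generator and every inverse of one; finiteness of \<open>S\<close>
    keeps \<open>N'\<close> open.\<close>
  define N' where "N' = \<Inter>(insert N ((\<lambda>s. (inv\<^sub>L s) ` N) ` S'))"
  have N': "openin T N'" unfolding N'_def
    by (rule openin_Inter) (use S' N(2) act_image_open in auto)
  have one': "\<one> \<in> N'" unfolding N'_def
    using subgroup.one_closed[OF N(1)] subgroup.one_closed[OF act_image_subgroup[OF _ N(1)]] S'(2) by auto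
  have N'N: "N' \<subseteq> N" unfolding N'_def by blast
  have RN': "?R \<subseteq> ?R <#> N'" using subset_set_mult_left[OF RU(2) one'] .
  obtain \<F> where \<F>: "finite \<F>" "\<F> \<subseteq> {V. inv_open K V}" "\<F> \<noteq> {}" "\<Inter>\<F> \<subseteq> ?R <#> N'"
  proof (rule compact_Inter_subset_open[OF _ _ open_set_mult_right[OF RU(2) N'], of "{V. inv_open K V}"])
    show "{V. inv_open K V} \<noteq> {}" using inv_open_self by blast
    show "\<And>C. C \<in> {V. inv_open K V} \<Longrightarrow> compactin T C" using inv_open_compact[OF K(1,2)] by blast
    show "\<Inter>{V. inv_open K V} \<subseteq> ?R <#> N'" using RN' unfolding Res_def .
  qed
  define Y where "Y = \<Inter>\<F>"
  have Y: "inv_open K Y" unfolding Y_def using inv_open_Inter \<F> by blast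
  note Y' = inv_openD[OF Y]
  have VN: "subgroup (V <#> N) G"
    using normalized_set_mult_subgroup[OF V'(1) N(1)] N(5) V'(2) RU by blast
  have VNR: "r \<in> V" if "r \<in> V <#> N" "r \<in> ?R" for r
  proof -
    obtain v n where vn: "v \<in> V" "n \<in> N" "r = v \<otimes> n" using \<open>r \<in> V <#> N\<close> unfolding set_mult_mem by blast
    have c: "v \<in> carrier G" "n \<in> carrier G" using vn Nc subgroup.subset[OF V'(1)] by auto
    have "n = inv v \<otimes> r" using vn c by (simp add: m_assoc[symmetric])
    then have "n \<in> ?R"
      using vn(1) V'(2) that subgroup.m_closed[OF Res_subgroup] subgroup.m_inv_closed[OF Res_subgroup] by blast
    then show ?thesis using vn NR subgroup.m_closed[OF V'(1)] by blast
  qed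
  define X where "X = Y \<inter> (V <#> N)"
  have Xc: "X \<subseteq> carrier G" unfolding X_def using subgroup.subset[OF VN] by blast
  have step: "s ` X \<subseteq> X" if s: "s \<in> S'" for s
  proof
    fix z assume "z \<in> s ` X"
    then obtain x where x: "x \<in> Y" "x \<in> V <#> N" "z = s x" unfolding X_def by blast
    have sL: "s \<in> carrier L" using s S' by blast
    obtain r w where rw: "r \<in> ?R" "w \<in> N'" "x = r \<otimes> w"
      using x(1) \<F>(4) unfolding Y_def using set_mult_mem by blast
    have c: "r \<in> carrier G" "w \<in> carrier G" using rw RU N'N Nc by auto
    have wV: "w \<in> V <#> N"
      using subset_set_mult_right[OF Nc subgroup.one_closed[OF V'(1)]] rw N'N by blast
    \<comment> \<open>As \<open>x\<close> is in \<open>V N\<close> and \<open>w\<close> in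
      \<open>N\<close>, the factor \<open>r\<close> lies in \<open>V N \<inter> Res K\<close>, that
      is, in \<open>V\<close>, and \<open>s\<close> preserves \<open>V\<close>.\<close>
    have "r = x \<otimes> inv w" using rw c by (simp add: m_assoc)
    then have "r \<in> V" using VNR rw(1) x(2) wV subgroup.m_closed[OF VN] subgroup.m_inv_closed[OF VN] by blast
    then have "s r \<in> V" using V'(4)[OF sL] by blast
    moreover have "w \<in> (inv\<^sub>L s) ` N" using rw(2) s unfolding N'_def by blast
    then have "s w \<in> N" using act_inv_image_mem_iff[OF sL Nc] by blast
    ultimately have "z \<in> V <#> N" using x(3) rw(3) c sL unfolding set_mult_mem by auto
    moreover have "z \<in> Y" using x Y'(4)[OF sL] by blast
    ultimately show "z \<in> X" unfolding X_def by blast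
  qed
  have "g ` X = X" if "g \<in> carrier L" for g
    by (rule invariant_if_gens[OF S(2,3) Xc _ _ that]) (use step in \<open>auto simp: S'_def\<close>)
  moreover have "subgroup X G" unfolding X_def using subgroups_Inter_pair[OF Y'(1) VN] .
  moreover have "openin (subtopology T K) X"
  proof -
    have "openin T (V <#> N)" using open_set_mult_right[OF subgroup.subset[OF V'(1)] N(2)] .
    then have "openin (subtopology T K) ((V <#> N) \<inter> K)" by (rule openin_subtopology_Int)
    moreover have "X = Y \<inter> ((V <#> N) \<inter> K)" unfolding X_def using Y'(2) by blast
    ultimately show ?thesis using openin_Int[OF Y'(3)] by simp
  qed
  moreover have "X \<subseteq> K" unfolding X_def using Y'(2) by blast
  ultimately have "inv_open K X" unfolding inv_open_def by blast
  then have "?R \<subseteq> X" unfolding Res_def by blast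
  then show "?R \<subseteq> V" using VNR unfolding X_def by blast
qed

end

end

section \<open>The nub as a residual\<close>

context taction begin

lemma Plus_plus_subgroup:
  assumes h: "h \<in> carrier L" and Q: "subgroup Q G" shows "subgroup (Plus_plus h Q) G"
proof (rule subgroupI)
  show "Plus_plus h Q \<subseteq> carrier G" unfolding Plus_plus_def by blast
  have "\<one> \<in> Plus_plus h Q" unfolding Plus_plus_def using h subgroup.one_closed[OF Q] by simp
  then show "Plus_plus h Q \<noteq> {}" by blast
  fix x assume x: "x \<in> Plus_plus h Q"
  then obtain m :: int where m: "x \<in> carrier G" "\<forall>i\<le>m. (h \<up> i) x \<in> Q" unfolding Plus_plus_def by auto
  then have "\<forall>i\<le>m. (h \<up> i) (inv x) \<in> Q" using h subgroup.m_inv_closed[OF Q] by simp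
  then show "inv x \<in> Plus_plus h Q" unfolding Plus_plus_def using m by auto
  fix y assume "y \<in> Plus_plus h Q"
  then obtain n :: int where n: "y \<in> carrier G" "\<forall>i\<le>n. (h \<up> i) y \<in> Q" unfolding Plus_plus_def by auto
  then have "\<forall>i\<le>min m n. (h \<up> i) (x \<otimes> y) \<in> Q" using m h subgroup.m_closed[OF Q] by simp
  then show "x \<otimes> y \<in> Plus_plus h Q" unfolding Plus_plus_def using m n by blast
qed

text \<open>Only finitely many backward iterates can lie outside \<open>W\<close>, so the backward
  orbit is bounded.\<close>

lemma tidy_Plus_plus_Int:
  assumes W: "W \<in> tidy_all" and h: "h \<in> carrier L" shows "Plus_plus h W \<inter> W \<subseteq> Plus h W"
proof
  note W' = tidy_allD[OF W]
  fix x assume x: "x \<in> Plus_plus h W \<inter> W"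
  then obtain m :: int where m: "x \<in> carrier G" "\<forall>i\<le>m. (h \<up> i) x \<in> W" unfolding Plus_plus_def by auto
  define C where "C = W \<union> (\<lambda>i. (h \<up> i) x) ` {m..0}"
  have "compactin T ((\<lambda>i. (h \<up> i) x) ` {m..0})"
    by (rule finite_imp_compactin) (use h m in auto)
  then have "compactin T C" unfolding C_def using W'(2) compactin_Un by blast
  moreover have "(h \<up> i) x \<in> C" if "i \<le> 0" for i :: int
    using m that unfolding C_def by (cases "i \<le> m") auto
  ultimately show "x \<in> Plus h W" using tidy_backward[OF W h] x by blast
qed

end

context flat_action begin

text \<open>The group \<open>K\<close> of the overview; it is the largest \<open>L\<close>-invariant
  subset of \<open>U\<close>.\<close>

definition fixed_part :: "'a set" where "fixed_part = translates_Int (carrier L)"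

lemma fixed_part_fam: "fixed_part \<in> translates_Ints"
  unfolding fixed_part_def translates_Ints_def using L.one_closed by blast

lemma fixed_part_invariant: assumes g: "g \<in> carrier L" shows "g ` fixed_part = fixed_part"
proof -
  have sub: "fixed_part \<subseteq> h ` fixed_part" if h: "h \<in> carrier L" for h
  proof -
    have "h ` fixed_part = (\<Inter>k\<in>carrier L. h ` k ` U)"
      unfolding fixed_part_def translates_Int_def
      by (rule act_image_INT[OF h]) (use act_image_closed U'(4) L.one_closed in blast)+
    also have "\<dots> = (\<Inter>k\<in>carrier L. (h \<otimes>\<^sub>L k) ` U)"
      by (intro INF_cong refl) (rule act_image_mult[OF h _ U'(4), symmetric])
    also have "\<dots> \<supseteq> fixed_part" unfolding fixed_part_def translates_Int_def using h by blast
    finally show ?thesis .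
  qed
  show ?thesis using act_image_invariant'[OF fam_carrier[OF fixed_part_fam] sub g] .
qed

lemma fixed_part_subset: "fixed_part \<subseteq> U"
  using act_image_one[OF U'(4)] L.one_closed unfolding fixed_part_def translates_Int_def by blast

lemma fixed_part_pw: "h \<in> carrier L \<Longrightarrow> x \<in> fixed_part \<Longrightarrow> (h \<up> i) x \<in> fixed_part"
  using fixed_part_invariant[of "h \<up> i"] by blast

text \<open>All orbits in the compact invariant group \<open>fixed_part\<close> are bounded, so
  tidiness of \<open>W\<close> makes the intersection invariant. This is the easy half of
  \<open>Inter_tidy_eq_Res\<close>: the residual lies in every tidy subgroup.\<close>

lemma tidy_Int_fixed_part:
  assumes W: "W \<in> tidy_all" shows "inv_open fixed_part (fixed_part \<inter> W)"
proof -
  note W' = tidy_allD[OF W] and Kc = fam_carrier[OF fixed_part_fam]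
  have sub: "g ` (fixed_part \<inter> W) \<subseteq> fixed_part \<inter> W" if g: "g \<in> carrier L" for g
  proof
    fix y assume "y \<in> g ` (fixed_part \<inter> W)"
    then obtain x where x: "x \<in> fixed_part" "x \<in> W" "y = g x" by blast
    have "x \<in> Minus g W"
      using tidy_forward[OF W g x(2) fam_compact[OF fixed_part_fam]] fixed_part_pw[OF g x(1)] by blast
    then have "(g \<up> 1) x \<in> W" using Minus_mem[OF g W'(4)] by force
    then show "y \<in> fixed_part \<inter> W" using x g fixed_part_invariant[OF g] by auto
  qed
  have "fixed_part \<inter> W \<subseteq> carrier G" using Kc by blast
  then have "g ` (fixed_part \<inter> W) = fixed_part \<inter> W" if "g \<in> carrier L" for g
    using act_image_invariant[OF _ sub that] by blast
  moreover have "openin (subtopology T fixed_part) (fixed_part \<inter> W)"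
    using openin_subtopology_Int2[OF W'(3)] .
  ultimately show ?thesis
    unfolding inv_open_def using subgroups_Inter_pair[OF fam_subgroup[OF fixed_part_fam] W'(1)] by blast
qed

end

context fg_flat_action begin

text \<open>
  Choose a small open \<open>N\<close> normalized by \<open>U\<close> and a tidy \<open>W\<close> contained in \<open>K N\<close>.  For the finitely many \<open>f\<close>
  in \<open>E\<close>, membership in \<open>X N\<close> does not change from \<open>x\<close> to \<open>f\<^sup>-\<^sup>1 x\<close>; walking along geodesics this extends to all
  \<open>h\<close> as long as \<open>x\<close> and \<open>h\<^sup>-\<^sup>1 x\<close> lie in \<open>W\<close>, and so \<open>W \<inter> X N\<close> inherits tidiness from \<open>W\<close>.
\<close>

theorem tidy_below_inv_open:
  assumes td: "totally_disconnected_space T"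
    and Su: "finite Su" "{g \<in> carrier L. g ` U = U} = generate L Su"
    and X: "inv_open fixed_part X"
  obtains W' where "W' \<in> tidy_all" "W' \<inter> fixed_part \<subseteq> X"
proof -
  let ?K = fixed_part
  note X' = inv_openD[OF X] and Kc = fam_carrier[OF fixed_part_fam] and Ks = fam_subgroup[OF fixed_part_fam]
  have Xc: "X \<subseteq> carrier G" and XU: "X \<subseteq> U" using X' Kc fixed_part_subset by blast+
  have SuL: "Su \<subseteq> {g \<in> carrier L. g ` U = U}" unfolding Su(2)
    by (rule subsetI, rule generate.incl)
  obtain \<Omega> where \<Omega>: "openin T \<Omega>" "X = \<Omega> \<inter> ?K" using X'(3) unfolding openin_subtopology by blast
  have 1: "\<one> \<in> \<Omega>" using subgroup.one_closed[OF X'(1)] \<Omega>(2) by blast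
  obtain N where N: "subgroup N G" "openin T N" "N \<subseteq> U" "N \<subseteq> \<Omega>" "\<And>u x. \<lbrakk>u \<in> U; x \<in> N\<rbrakk> \<Longrightarrow> u \<otimes> x \<otimes> inv u \<in> N"
    using small_normal_open_subgroup[OF td U'(2,3,1) \<Omega>(1) 1] by blast
  have Nc: "N \<subseteq> carrier G" using subgroup.subset[OF N(1)] .
  obtain F where F: "finite F" "F \<subseteq> {g \<in> carrier L. g ` U \<noteq> U}"
    "\<And>b. \<lbrakk>b \<in> carrier L; b ` U \<noteq> U\<rbrakk> \<Longrightarrow> \<exists>f\<in>F. between U f b"
    using finite_between by blast
  define E where "E = F \<union> Su"
  have E: "finite E" "E \<subseteq> carrier L" unfolding E_def using F(1,2) Su(1) SuL by blast+
  \<comment> \<open>\<open>E\<close> consists of the geodesic steps in \<open>F\<close> and the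
    generators in \<open>Su\<close>; the inverse of each of them maps \<open>N'\<close> into
    \<open>N\<close>.\<close>
  define N' where "N' = \<Inter>(insert N ((\<lambda>s. s ` N) ` E))"
  have N': "openin T N'" unfolding N'_def
    by (rule openin_Inter) (use E N(2) act_image_open in auto)
  have one': "\<one> \<in> N'" unfolding N'_def
    using subgroup.one_closed[OF N(1)] subgroup.one_closed[OF act_image_subgroup[OF _ N(1)]] E(2) by auto
  have N'N: "N' \<subseteq> N" unfolding N'_def by blast
  have KN': "?K \<subseteq> ?K <#> N'" using subset_set_mult_left[OF Kc one'] .
  \<comment> \<open>\<open>fixed_part\<close> is an intersection of compact translates, so the
    intersection of finitely many of them already lies in the open set \<open>?K <#> N'\<close>;
    together with \<open>U\<close> they make up the tidy group \<open>W\<close>.\<close>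
  obtain \<F> where \<F>: "finite \<F>" "\<F> \<subseteq> (\<lambda>g. g ` U) ` carrier L" "\<F> \<noteq> {}" "\<Inter>\<F> \<subseteq> ?K <#> N'"
  proof (rule compact_Inter_subset_open[OF _ _ open_set_mult_right[OF Kc N'], of "(\<lambda>g. g ` U) ` carrier L"])
    show "(\<lambda>g. g ` U) ` carrier L \<noteq> {}" using L.one_closed by blast
    show "\<And>C. C \<in> (\<lambda>g. g ` U) ` carrier L \<Longrightarrow> compactin T C" using act_image_compact[OF _ U'(2)] by blast
    show "\<Inter>((\<lambda>g. g ` U) ` carrier L) \<subseteq> ?K <#> N'" using KN' unfolding fixed_part_def translates_Int_def .
  qed
  then obtain J0 where J0: "finite J0" "J0 \<subseteq> carrier L" "\<F> = (\<lambda>g. g ` U) ` J0" by (meson finite_subset_image)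
  define J where "J = insert \<one>\<^bsub>L\<^esub> J0"
  have J: "finite J" "J \<noteq> {}" "J \<subseteq> carrier L" unfolding J_def using J0 by auto
  define W where "W = translates_Int J"
  have W: "W \<in> tidy_all" unfolding W_def using translates_Int_finite_tidy[OF J] .
  note W' = tidy_allD[OF W]
  have Wfam: "W \<in> translates_Ints" unfolding W_def translates_Ints_def using J by blast
  have WK: "W \<subseteq> ?K <#> N'" using \<F>(4) J0(3) unfolding W_def translates_Int_def J_def by blast
  have KW: "?K \<subseteq> W" unfolding W_def fixed_part_def translates_Int_def using J(3) by blast
  have WU: "W \<subseteq> U" unfolding W_def translates_Int_def J_def using act_image_one[OF U'(4)] by blast
  define Y where "Y = X <#> N"
  have Ys: "subgroup Y G" unfolding Y_def
    using normalized_set_mult_subgroup[OF X'(1) N(1)] N(5) XU by blast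
  have Yc: "Y \<subseteq> carrier G" using subgroup.subset[OF Ys] .
  have Yo: "openin T Y" unfolding Y_def using open_set_mult_right[OF Xc N(2)] .
  have NY: "N \<subseteq> Y" unfolding Y_def using subset_set_mult_right[OF Nc subgroup.one_closed[OF X'(1)]] .
  have KY: "k \<in> X" if "k \<in> ?K" "k \<in> Y" for k
  proof -
    obtain v n where vn: "v \<in> X" "n \<in> N" "k = v \<otimes> n" using \<open>k \<in> Y\<close> unfolding Y_def set_mult_mem by blast
    have c: "v \<in> carrier G" "n \<in> carrier G" using vn Nc Xc by auto
    have "n = inv v \<otimes> k" using vn c by (simp add: m_assoc[symmetric])
    then have "n \<in> ?K" using vn(1) X'(2) that subgroup.m_closed[OF Ks] subgroup.m_inv_closed[OF Ks] by blast
    then have "n \<in> X" using vn N(4) \<Omega>(2) by blast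
    then show ?thesis using vn subgroup.m_closed[OF X'(1)] by blast
  qed
  have prodY: "k \<otimes> w \<in> Y \<longleftrightarrow> k \<in> X" if "k \<in> ?K" "w \<in> N" for k w
  proof
    assume a: "k \<otimes> w \<in> Y"
    have c: "k \<in> carrier G" "w \<in> carrier G" using that Kc Nc by auto
    have "(k \<otimes> w) \<otimes> inv w \<in> Y" using a NY that subgroup.m_closed[OF Ys] subgroup.m_inv_closed[OF Ys] by blast
    then show "k \<in> X" using KY[OF that(1)] c by (simp add: m_assoc)
  next
    assume "k \<in> X" then show "k \<otimes> w \<in> Y" unfolding Y_def set_mult_mem using that by blast
  qed
  have WKN: "\<exists>k\<in>?K. \<exists>w\<in>N'. x = k \<otimes> w" if "x \<in> W" for x
    using WK that set_mult_mem[of x ?K N'] by blast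
  \<comment> \<open>With \<open>x = k w\<close>, both \<open>w\<close> and its image lie in
    \<open>N\<close>, so membership in \<open>Y\<close> depends on the factors from
    \<open>fixed_part\<close> only, and \<open>X\<close> is invariant.\<close>
  have agreeE: "x \<in> Y \<longleftrightarrow> (inv\<^sub>L f) x \<in> Y" if x: "x \<in> W" and f: "f \<in> E" for x f
  proof -
    have fL: "f \<in> carrier L" "inv\<^sub>L f \<in> carrier L" using f E by auto
    obtain k w where kw: "k \<in> ?K" "w \<in> N'" "x = k \<otimes> w" using WKN[OF x] by blast
    have c: "k \<in> carrier G" "w \<in> carrier G" using kw Kc N'N Nc by auto
    have "w \<in> f ` N" using kw(2) f unfolding N'_def by blast
    then have fw: "(inv\<^sub>L f) w \<in> N" using act_image_mem_iff[OF fL(1) Nc] by blast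
    have fk: "(inv\<^sub>L f) k \<in> ?K" using fixed_part_invariant[OF fL(2)] kw(1) by blast
    have "(inv\<^sub>L f) k \<in> X \<longleftrightarrow> k \<in> X"
      using act_inv_image_mem_iff[OF fL(1) Xc, of k] act_image_mem_iff[OF fL(1) Xc, of k] X'(4)[OF fL(1)] c by simp
    moreover have "(inv\<^sub>L f) x = (inv\<^sub>L f) k \<otimes> (inv\<^sub>L f) w" using kw c fL by simp
    ultimately show ?thesis using prodY[OF kw(1), of w] prodY[OF fk fw] kw N'N by auto
  qed
  have stabW: "u ` W = W" if "u \<in> carrier L" "u ` U = U" for u using stabilizer_fam[OF that Wfam] .
  \<comment> \<open>Uniscalar elements map \<open>W\<close> onto itself, so the points visited along
    a word in \<open>Su\<close> all stay in \<open>W\<close>.\<close>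
  have agreeU: "\<forall>x\<in>W. x \<in> Y \<longleftrightarrow> (inv\<^sub>L u) x \<in> Y" if u: "u \<in> generate L Su" for u
    using u
  proof (induction u rule: generate.induct)
    case one then show ?case using W'(4) by auto
  next
    case (incl s) then show ?case using agreeE unfolding E_def by blast
  next
    case (inv s)
    then have s: "s \<in> carrier L" "s ` U = U" using SuL by auto
    show ?case
    proof
      fix x assume x: "x \<in> W"
      then have "s x \<in> W" using stabW[OF s] by blast
      then have "s x \<in> Y \<longleftrightarrow> (inv\<^sub>L s) (s x) \<in> Y" using agreeE inv unfolding E_def by blast
      then show "x \<in> Y \<longleftrightarrow> (inv\<^sub>L (inv\<^sub>L s)) x \<in> Y" using s x W'(4) by auto
    qed
  next
    case (eng u1 u2)
    have u: "u1 \<in> carrier L" "u1 ` U = U" "u2 \<in> carrier L" using eng(1,2)[folded Su(2)] by simp_all+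
    show ?case
    proof
      fix x assume x: "x \<in> W"
      have "(inv\<^sub>L u1) x \<in> W" using x stabW[OF u(1,2)] act_image_mem_iff[OF u(1) W'(4)] by blast
      then have "x \<in> Y \<longleftrightarrow> (inv\<^sub>L u2) ((inv\<^sub>L u1) x) \<in> Y" using eng x by blast
      moreover have "(inv\<^sub>L (u1 \<otimes>\<^sub>L u2)) x = (inv\<^sub>L u2) ((inv\<^sub>L u1) x)"
        using u x W'(4) by (auto simp: L.inv_mult_group)
      ultimately show "x \<in> Y \<longleftrightarrow> (inv\<^sub>L (u1 \<otimes>\<^sub>L u2)) x \<in> Y" by simp
    qed
  qed
  \<comment> \<open>Peeling a geodesic step \<open>f\<close> off \<open>h\<close> lowers
    \<open>dist_id\<close>, and the visited point \<open>(inv\<^sub>L f) x\<close> is still in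
    \<open>W\<close>, so the induction hypothesis applies to it.\<close>
  have agree: "\<forall>x\<in>W. (inv\<^sub>L h) x \<in> W \<longrightarrow> (x \<in> Y \<longleftrightarrow> (inv\<^sub>L h) x \<in> Y)" if h: "h \<in> carrier L" for h
    using h
  proof (induction "dist_id h" arbitrary: h rule: less_induct)
    case less
    note h = less.prems
    show ?case
    proof (cases "h ` U = U")
      case True
      then show ?thesis using agreeU Su(2) h by blast
    next
      case False
      then obtain f where f: "f \<in> F" "between U f h" using F(3) h by blast
      then have fL: "f \<in> carrier L" "f ` U \<noteq> U" using F(2) by auto
      define b where "b = inv\<^sub>L f \<otimes>\<^sub>L h"
      have b: "b \<in> carrier L" unfolding b_def using fL h by simp
      have IH: "\<forall>x\<in>W. (inv\<^sub>L b) x \<in> W \<longrightarrow> (x \<in> Y \<longleftrightarrow> (inv\<^sub>L b) x \<in> Y)"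
        by (rule less.hyps[OF _ b]) (use dist_id_less[OF fL h f(2)] in \<open>simp add: b_def\<close>)
      \<comment> \<open>Betweenness is known for \<open>U\<close>; since translates commute, it
        passes to each \<open>g U\<close> and then to their intersection \<open>W\<close>.\<close>
      have WfW: "W \<inter> h ` W \<subseteq> f ` W"
      proof
        fix x assume x: "x \<in> W \<inter> h ` W"
        have "x \<in> f ` g ` U" if g: "g \<in> J" for g
        proof -
          have gL: "g \<in> carrier L" using g J by blast
          have "W \<subseteq> g ` U" unfolding W_def translates_Int_def using g by blast
          then have "x \<in> g ` U \<inter> h ` g ` U" using x by blast
          also have "g ` U \<inter> h ` g ` U = g ` (U \<inter> h ` U)"
            using fam_commute[OF h gL fam_U] act_image_Int[OF gL U'(4) act_image_closed[OF h U'(4)]] by simp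
          also have "\<dots> \<subseteq> g ` f ` U" using f(2) unfolding between_def by blast
          also have "\<dots> = f ` g ` U" using fam_commute[OF gL fL(1) fam_U] .
          finally show ?thesis .
        qed
        moreover have "f ` W = (\<Inter>g\<in>J. f ` g ` U)"
          unfolding W_def translates_Int_def by (rule act_image_INT[OF fL(1) J(2)]) (use J(3) act_image_closed U'(4) in blast)
        ultimately show "x \<in> f ` W" by blast
      qed
      show ?thesis
      proof (intro ballI impI)
        fix x assume x: "x \<in> W" "(inv\<^sub>L h) x \<in> W"
        have xc: "x \<in> carrier G" using x W' by blast
        have "x \<in> h ` W" using act_image_mem_iff[OF h W'(4)] x xc by blast
        then have fx: "(inv\<^sub>L f) x \<in> W" using WfW x act_image_mem_iff[OF fL(1) W'(4)] by blast
        have "(inv\<^sub>L b) ((inv\<^sub>L f) x) = (inv\<^sub>L h) x"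
          unfolding b_def using fL h xc by (simp add: L.inv_mult_group)
        then have "(inv\<^sub>L f) x \<in> Y \<longleftrightarrow> (inv\<^sub>L h) x \<in> Y" using IH fx x by metis
        then show "x \<in> Y \<longleftrightarrow> (inv\<^sub>L h) x \<in> Y" using agreeE[OF x(1)] f(1) unfolding E_def by blast
      qed
    qed
  qed
  define V where "V = W \<inter> Y"
  have Vs: "subgroup V G" unfolding V_def using subgroups_Inter_pair[OF W'(1) Ys] .
  have Vo: "openin T V" unfolding V_def using openin_Int[OF W'(3) Yo] .
  have Vcl: "compactin T V"
    unfolding V_def
    by (rule relatively_open_subgroup_compact[OF W'(2,1) subgroups_Inter_pair[OF W'(1) Ys] Int_lower1
          openin_subtopology_Int2[OF Yo]])
  have Vc: "V \<subseteq> carrier G" using subgroup.subset[OF Vs] .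
  have VW: "V \<subseteq> W" unfolding V_def by blast
  have "tidy_for h V" if h: "h \<in> carrier L" for h
  proof -
    have pw: "x \<in> V \<Longrightarrow> (h \<up> i) x \<in> W \<Longrightarrow> (h \<up> i) x \<in> V" for x and i :: int
      using agree[of "h \<up> (- i)"] inv_pw[OF h, of "- i"] h unfolding V_def by auto
    have VP: "V \<inter> Plus h W \<subseteq> Plus h V"
      using pw Plus_mem[OF h W'(4)] Plus_mem[OF h Vc] by blast
    have VM: "V \<inter> Minus h W \<subseteq> Minus h V"
      using pw Minus_mem[OF h W'(4)] Minus_mem[OF h Vc] by blast
    have "(h \<up> i) k \<in> W" if "k \<in> ?K" for k and i :: int
      using fixed_part_pw[OF h that, of i] KW by blast
    then have KPM: "?K \<subseteq> Plus h W" "?K \<subseteq> Minus h W"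
      using Kc by (auto simp: Plus_mem[OF h W'(4)] Minus_mem[OF h W'(4)])
    have "V \<subseteq> Plus h V <#> Minus h V"
    proof
      fix x assume x: "x \<in> V"
      then have "x \<in> W" using VW by blast
      then obtain a b where ab: "a \<in> Plus h W" "b \<in> Minus h W" "x = a \<otimes> b"
        using tidy_decomp[OF W h] set_mult_mem by metis
      have aW: "a \<in> W" "b \<in> W" using ab Plus_subset[OF h W'(4)] Minus_subset[OF h W'(4)] by blast+
      have "inv a \<in> W" using aW subgroup.m_inv_closed[OF W'(1)] by blast
      then obtain k w where kw: "k \<in> ?K" "w \<in> N'" "inv a = k \<otimes> w" using WKN by blast
      have c: "a \<in> carrier G" "b \<in> carrier G" "k \<in> carrier G" "w \<in> carrier G" using aW W' kw Kc N'N Nc by auto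
      \<comment> \<open>Elements of \<open>fixed_part\<close> lie in both \<open>Plus h W\<close>
        and \<open>Minus h W\<close>, so \<open>k\<close> may be moved from one factor to the other.
        The choice makes \<open>a'\<close> the inverse of \<open>w\<close>, hence an element of
        \<open>N\<close> and of \<open>Y\<close>.\<close>
      define a' where "a' = a \<otimes> k"
      have a'P: "a' \<in> Plus h W" unfolding a'_def using ab kw KPM subgroup.m_closed[OF Plus_subgroup[OF h W'(1)]] by blast
      have "a' = inv w"
      proof -
        have "a = inv (k \<otimes> w)" using kw(3) c by (metis inv_inv)
        then show ?thesis unfolding a'_def using c by (simp add: inv_mult_group m_assoc)
      qed
      then have "a' \<in> Y" using kw(2) N'N NY subgroup.m_inv_closed[OF Ys] by blast
      then have a'V: "a' \<in> V" unfolding V_def using a'P Plus_subset[OF h W'(4)] by blast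
      define b' where "b' = inv k \<otimes> b"
      have b'M: "b' \<in> Minus h W" unfolding b'_def
        using ab kw KPM subgroup.m_closed[OF Minus_subgroup[OF h W'(1)]] subgroup.m_inv_closed[OF Minus_subgroup[OF h W'(1)]] by blast
      have xab: "x = a' \<otimes> b'"
      proof -
        have "k \<otimes> (inv k \<otimes> b) = b" using c by (simp add: m_assoc[symmetric])
        then show ?thesis unfolding a'_def b'_def using ab(3) c by (simp add: m_assoc)
      qed
      have "b' = inv a' \<otimes> x"
      proof -
        have "a' \<in> carrier G" "b' \<in> carrier G" unfolding a'_def b'_def using c by auto
        then show ?thesis unfolding xab by (simp add: m_assoc[symmetric])
      qed
      then have "b' \<in> V" using a'V x subgroup.m_closed[OF Vs] subgroup.m_inv_closed[OF Vs] by simp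
      then have "a' \<in> Plus h V" "b' \<in> Minus h V" using VP VM a'P b'M a'V by blast+
      then show "x \<in> Plus h V <#> Minus h V" using xab unfolding set_mult_mem by blast
    qed
    then have dec: "V = Plus h V <#> Minus h V"
      using set_mult_subset[OF Vs Plus_subset[OF h Vc] Minus_subset[OF h Vc]] by blast
    have cl: "closedin T (Plus_plus h V)"
    proof -
      let ?E = "Plus_plus h W"
      have Ecl: "closedin T ?E" using tidy_forD(7)[OF tidy_all_tidy_for[OF W h]] .
      have Es: "subgroup ?E G" "subgroup (Plus_plus h V) G" using Plus_plus_subgroup[OF h] W'(1) Vs by blast+
      have Ec: "?E \<subseteq> carrier G" "Plus_plus h V \<subseteq> carrier G" using Es subgroup.subset by blast+
      have VE: "Plus_plus h V \<subseteq> ?E"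
      proof
        fix x assume "x \<in> Plus_plus h V"
        then obtain m :: int where m: "x \<in> carrier G" "\<forall>i\<le>m. (h \<up> i) x \<in> V" unfolding Plus_plus_def by auto
        then have "\<forall>i\<le>m. (h \<up> i) x \<in> W" using VW by blast
        then show "x \<in> ?E" unfolding Plus_plus_def using m by blast
      qed
      have PlusPP: "Plus h V \<subseteq> Plus_plus h V" using Plus_mem[OF h Vc] unfolding Plus_plus_def by blast
      \<comment> \<open>The part of the complement inside the closed \<open>Plus_plus h W\<close> is
        covered by cosets of the open \<open>V\<close>. None of them meets
        \<open>Plus_plus h V\<close>, since \<open>V \<inter> Plus_plus h W\<close> lies in
        \<open>Plus h V\<close>.\<close>
      have "carrier G - Plus_plus h V = (carrier G - ?E) \<union> (\<Union>x\<in>?E - Plus_plus h V. x <# V)"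
      proof
        show "carrier G - Plus_plus h V \<subseteq> (carrier G - ?E) \<union> (\<Union>x\<in>?E - Plus_plus h V. x <# V)"
          using lcoset_self[OF Vs] by blast
        have "y \<in> carrier G - Plus_plus h V" if x: "x \<in> ?E - Plus_plus h V" and y: "y \<in> x <# V" for x y
        proof -
          have xc: "x \<in> carrier G" using x Ec by blast
          have yc: "y \<in> carrier G" "inv x \<otimes> y \<in> V" using y l_coset_mem_iff[OF xc Vc] by auto
          have "y \<notin> Plus_plus h V"
          proof
            assume yV: "y \<in> Plus_plus h V"
            then have "inv x \<otimes> y \<in> ?E"
              using x VE subgroup.m_closed[OF Es(1)] subgroup.m_inv_closed[OF Es(1)] by blast
            then have "inv x \<otimes> y \<in> Plus h W" using tidy_Plus_plus_Int[OF W h] yc VW by blast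
            then have "inv x \<otimes> y \<in> Plus_plus h V" using VP yc PlusPP by blast
            then have "y \<otimes> inv (inv x \<otimes> y) \<in> Plus_plus h V"
              using yV subgroup.m_closed[OF Es(2)] subgroup.m_inv_closed[OF Es(2)] by blast
            then show False using x xc yc by (simp add: inv_mult_group m_assoc[symmetric])
          qed
          then show ?thesis using yc by blast
        qed
        then show "(carrier G - ?E) \<union> (\<Union>x\<in>?E - Plus_plus h V. x <# V) \<subseteq> carrier G - Plus_plus h V"
          using VE by blast
      qed
      moreover have "openin T (\<Union>x\<in>?E - Plus_plus h V. x <# V)" using open_lcoset[OF _ Vo] Ec by blast
      moreover have "openin T (carrier G - ?E)" using Ecl openin_closedin_eq unfolding closedin_def by simp
      ultimately show ?thesis unfolding closedin_def using Ec by (simp add: openin_Un)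
    qed
    show "tidy_for h V" unfolding tidy_for_def using Vs Vcl Vo dec cl by blast
  qed
  then have "V \<in> tidy_all" unfolding tidy_all_def by blast
  moreover have "V \<inter> ?K \<subseteq> X" using KY unfolding V_def by blast
  ultimately show thesis using that by blast
qed

theorem Inter_tidy_eq_Res:
  assumes td: "totally_disconnected_space T"
    and Su: "finite Su" "{g \<in> carrier L. g ` U = U} = generate L Su"
  shows "\<Inter>tidy_all = Res fixed_part"
proof
  have sub: "\<Inter>tidy_all \<subseteq> fixed_part" unfolding fixed_part_def translates_Int_def using act_image_tidy[OF U] by blast
  show "\<Inter>tidy_all \<subseteq> Res fixed_part"
  proof
    fix x assume x: "x \<in> \<Inter>tidy_all"
    have "x \<in> X" if X: "inv_open fixed_part X" for X
    proof -
      obtain W' where "W' \<in> tidy_all" "W' \<inter> fixed_part \<subseteq> X" using tidy_below_inv_open[OF td Su X] .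
      then show ?thesis using x sub by blast
    qed
    then show "x \<in> Res fixed_part" unfolding Res_def by blast
  qed
  show "Res fixed_part \<subseteq> \<Inter>tidy_all"
    using tidy_Int_fixed_part unfolding Res_def by blast
qed

end

section \<open>Ergodicity\<close>

locale haar_action = taction +
  fixes \<mu> :: "'a measure"
  assumes compact_T: "compact_space T"
    and td: "totally_disconnected_space T"
    and haar: "normalized_haar_measure G T \<mu>"
begin

lemma space_mu [simp]: "space \<mu> = carrier G"
  and sets_mu: "sets \<mu> = sigma_sets (carrier G) {U. openin T U}"
  and emeasure_carrier: "emeasure \<mu> (carrier G) = 1"
  and haar_invariant: "\<lbrakk>g \<in> carrier G; A \<in> sets \<mu>\<rbrakk> \<Longrightarrow> emeasure \<mu> (g <# A) = emeasure \<mu> A"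
  and haar_outer: "A \<in> sets \<mu> \<Longrightarrow> emeasure \<mu> A = (INF U\<in>{U. openin T U \<and> A \<subseteq> U}. emeasure \<mu> U)"
  using haar unfolding normalized_haar_measure_def by blast+

sublocale finite_measure \<mu>
  by standard (simp add: emeasure_carrier)

lemma open_sets: "openin T A \<Longrightarrow> A \<in> sets \<mu>"
  unfolding sets_mu by (simp add: sigma_sets.Basic)

lemma compact_carrier: "compactin T (carrier G)"
  using compact_T unfolding compact_space_def by simp

lemma open_carrier: "openin T (carrier G)"
  using openin_topspace[of T] by simp

lemma measure_carrier: "measure \<mu> (carrier G) = 1"
  using emeasure_carrier unfolding measure_def by simp

lemma measure_le_1: "measure \<mu> A \<le> 1"
  using bounded_measure[of A] measure_carrier by simp

lemma outer_approx:
  assumes A: "A \<in> sets \<mu>" and e: "e > 0"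
  obtains \<Omega> where "openin T \<Omega>" "A \<subseteq> \<Omega>" "measure \<mu> \<Omega> < measure \<mu> A + e"
proof -
  have "emeasure \<mu> A < emeasure \<mu> A + ennreal e" using e emeasure_finite[of A] by (simp add: ennreal_add_left_cancel_less less_top)
  then have "(INF U\<in>{U. openin T U \<and> A \<subseteq> U}. emeasure \<mu> U) < emeasure \<mu> A + ennreal e"
    using haar_outer[OF A] by simp
  then obtain \<Omega> where \<Omega>: "openin T \<Omega>" "A \<subseteq> \<Omega>" "emeasure \<mu> \<Omega> < emeasure \<mu> A + ennreal e"
    unfolding INF_less_iff by blast
  have "ennreal (measure \<mu> \<Omega>) < ennreal (measure \<mu> A + e)"
    using \<Omega>(3) e by (simp add: emeasure_eq_measure flip: ennreal_plus)
  then have "measure \<mu> \<Omega> < measure \<mu> A + e" by (simp add: ennreal_less_iff)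
  then show thesis using that \<Omega> by blast
qed

lemma lcoset_disjoint:
  assumes W: "subgroup W G" and c: "x \<in> carrier G" "y \<in> carrier G" and ne: "x <# W \<noteq> y <# W"
  shows "(x <# W) \<inter> (y <# W) = {}"
  using lcoset_eq[OF W _ c(1)] lcoset_eq[OF W _ c(2)] ne by blast

lemma measure_lcosets:
  assumes W: "subgroup W G" "openin T W" and D: "finite D" "D \<subseteq> carrier G" "inj_on (\<lambda>y. y <# W) D"
    and A: "A \<in> sets \<mu>"
  shows "measure \<mu> (A \<inter> (D <#> W)) = (\<Sum>y\<in>D. measure \<mu> (A \<inter> (y <# W)))"
proof -
  have "A \<inter> (D <#> W) = (\<Union>y\<in>D. A \<inter> (y <# W))" unfolding set_mult_eq_UN by blast
  moreover have "disjoint_family_on (\<lambda>y. A \<inter> (y <# W)) D"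
    unfolding disjoint_family_on_def
  proof (intro ballI impI)
    fix x y assume "x \<in> D" "y \<in> D" "x \<noteq> y"
    then have "(x <# W) \<inter> (y <# W) = {}" using lcoset_disjoint[OF W(1)] D by (meson inj_onD subsetD)
    then show "A \<inter> (x <# W) \<inter> (A \<inter> (y <# W)) = {}" by blast
  qed
  moreover have "(\<lambda>y. A \<inter> (y <# W)) ` D \<subseteq> sets \<mu>"
    using A open_sets[OF open_lcoset[OF _ W(2)]] D(2) by blast
  ultimately show ?thesis using finite_measure_finite_Union[OF D(1)] by (simp only:)
qed

lemma measure_lcoset: assumes "openin T W" "y \<in> carrier G" shows "measure \<mu> (y <# W) = measure \<mu> W"
  unfolding measure_def using haar_invariant[OF assms(2) open_sets[OF assms(1)]] by simp

lemma measure_union_lcosets: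
  assumes W: "subgroup W G" "openin T W" and D: "finite D" "D \<subseteq> carrier G" "inj_on (\<lambda>y. y <# W) D"
  shows "measure \<mu> (D <#> W) = real (card D) * measure \<mu> W"
proof -
  have c: "y <# W \<subseteq> carrier G" if "y \<in> D" for y
    using that D(2) l_coset_subset_G[OF subgroup.subset[OF W(1)]] by blast
  have "D <#> W \<subseteq> carrier G" using D(2) subgroup.subset[OF W(1)] set_mult_closed by blast
  then have "measure \<mu> (D <#> W) = (\<Sum>y\<in>D. measure \<mu> (carrier G \<inter> (y <# W)))"
    using measure_lcosets[OF assms open_sets[OF open_carrier]] by (simp add: Int_absorb1)
  also have "\<dots> = (\<Sum>y\<in>D. measure \<mu> W)"
    by (rule sum.cong) (use c D(2) measure_lcoset[OF W(2)] in \<open>auto simp: Int_absorb1 subset_iff\<close>)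
  finally show ?thesis by simp
qed

lemma transversal:
  assumes W: "subgroup W G" "openin T W"
  obtains Y where "finite Y" "Y \<subseteq> carrier G" "inj_on (\<lambda>y. y <# W) Y" "carrier G = Y <#> W"
    "real (card Y) * measure \<mu> W = 1"
proof -
  obtain Y where Y: "finite Y" "Y \<subseteq> carrier G" "carrier G \<subseteq> Y <#> W" "inj_on (\<lambda>y. y <# W) Y"
    using coset_reps[OF finite_cosets[OF compact_carrier W(2,1)] W(1) order_refl] by metis
  have eq: "carrier G = Y <#> W" using Y set_mult_closed[OF Y(2) subgroup.subset[OF W(1)]] by blast
  then have "real (card Y) * measure \<mu> W = 1" using measure_union_lcosets[OF W Y(1,2,4)] measure_carrier by simp
  then show thesis using that Y eq by blast
qed

lemma measure_open_subgroup_pos: assumes "subgroup W G" "openin T W" shows "measure \<mu> W > 0"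
  using transversal[OF assms] by (metis mult_zero_right measure_nonneg order_less_le zero_neq_one)

lemma act_inj_lcosets:
  assumes h: "h \<in> carrier L" and W: "subgroup W G" and D: "D \<subseteq> carrier G" "inj_on (\<lambda>y. y <# W) D"
  shows "inj_on (\<lambda>y. y <# h ` W) (h ` D)"
proof (rule inj_onI)
  fix x y assume xy: "x \<in> h ` D" "y \<in> h ` D" and eq: "x <# h ` W = y <# h ` W"
  obtain u v where uv: "u \<in> D" "v \<in> D" "x = h u" "y = h v" using xy by blast
  note Wc = subgroup.subset[OF W]
  have c: "u \<in> carrier G" "v \<in> carrier G" using uv D by auto
  have "h ` (u <# W) = h ` (v <# W)" using eq uv act_image_lcoset[OF h _ Wc] c by simp
  then have "u <# W = v <# W"
    using act_image_inv_left[OF h l_coset_subset_G[OF Wc c(1)]] act_image_inv_left[OF h l_coset_subset_G[OF Wc c(2)]] by metis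
  then show "x = y" using D(2) uv by (metis inj_onD)
qed

text \<open>The measure of an open subgroup is the reciprocal of its index, and automorphisms
  preserve the index. Invariance of Haar measure under automorphisms is built up from here, through
  open sets to all measurable ones.\<close>

lemma measure_act_subgroup:
  assumes h: "h \<in> carrier L" and W: "subgroup W G" "openin T W"
  shows "measure \<mu> (h ` W) = measure \<mu> W"
proof -
  obtain Y where Y: "finite Y" "Y \<subseteq> carrier G" "inj_on (\<lambda>y. y <# W) Y" "carrier G = Y <#> W"
    "real (card Y) * measure \<mu> W = 1" using transversal[OF W] .
  have hW: "subgroup (h ` W) G" "openin T (h ` W)" using act_image_subgroup[OF h W(1)] act_image_open[OF h W(2)] .
  have "h ` Y <#> h ` W = carrier G"
    using act_image_set_mult[OF h Y(2) subgroup.subset[OF W(1)]] Y(4) act_image_carrier[OF h] by simp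
  then have "real (card (h ` Y)) * measure \<mu> (h ` W) = 1"
    using measure_union_lcosets[OF hW _ _ act_inj_lcosets[OF h W(1) Y(2,3)]] Y(1) act_image_closed[OF h Y(2)]
      measure_carrier by simp
  moreover have "card (h ` Y) = card Y" using card_image inj_on_subset[OF act_inj[OF h] Y(2)] by blast
  ultimately have "real (card Y) * measure \<mu> (h ` W) = real (card Y) * measure \<mu> W" using Y(5) by simp
  moreover have "real (card Y) \<noteq> 0" using Y(5) by (metis mult_zero_left zero_neq_one)
  ultimately show ?thesis by simp
qed

definition nopen :: "'a set \<Rightarrow> bool" where
  "nopen W \<longleftrightarrow> subgroup W G \<and> openin T W \<and> (\<forall>u\<in>carrier G. \<forall>x\<in>W. u \<otimes> x \<otimes> inv u \<in> W)"

lemma nopenD: assumes "nopen W" shows "subgroup W G" "openin T W" "\<And>u x. \<lbrakk>u \<in> carrier G; x \<in> W\<rbrakk> \<Longrightarrow> u \<otimes> x \<otimes> inv u \<in> W"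
  using assms unfolding nopen_def by blast+

lemma nopen_act: assumes h: "h \<in> carrier L" and W: "nopen W" shows "nopen (h ` W)"
proof -
  note W' = nopenD[OF W] and Wc = subgroup.subset[OF nopenD(1)[OF W]]
  have "u \<otimes> x \<otimes> inv u \<in> h ` W" if u: "u \<in> carrier G" and x: "x \<in> h ` W" for u x
  proof -
    obtain w where w: "w \<in> W" "x = h w" using x by blast
    have "(inv\<^sub>L h) u \<otimes> w \<otimes> inv ((inv\<^sub>L h) u) \<in> W" using W'(3)[OF _ w(1)] h u by simp
    moreover have "h ((inv\<^sub>L h) u \<otimes> w \<otimes> inv ((inv\<^sub>L h) u)) = u \<otimes> x \<otimes> inv u" using h u w Wc by (auto simp: subset_iff)
    ultimately show ?thesis by (metis imageI)
  qed
  then show ?thesis unfolding nopen_def using act_image_subgroup[OF h W'(1)] act_image_open[OF h W'(2)] by blast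
qed

lemma nopen_Int: assumes "nopen V" "nopen W" shows "nopen (V \<inter> W)"
  using nopenD[OF assms(1)] nopenD[OF assms(2)] subgroups_Inter_pair openin_Int unfolding nopen_def by (metis Int_iff)

lemma nopen_Inter: assumes "finite \<F>" "\<F> \<noteq> {}" "\<And>V. V \<in> \<F> \<Longrightarrow> nopen V" shows "nopen (\<Inter>\<F>)"
  using assms
proof (induction rule: finite_ne_induct)
  case (insert V \<F>)
  then have "nopen (V \<inter> \<Inter>\<F>)" using nopen_Int by blast
  then show ?case by simp
qed simp

lemma nopen_set_mult: assumes V: "nopen V" and W: "nopen W" shows "nopen (V <#> W)"
proof -
  note V' = nopenD[OF V] and W' = nopenD[OF W]
  note Vc = subgroup.subset[OF V'(1)] and Wc = subgroup.subset[OF W'(1)]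
  have "subgroup (V <#> W) G" using normalized_set_mult_subgroup[OF V'(1) W'(1)] W'(3) Vc by blast
  moreover have "openin T (V <#> W)" using open_set_mult_right[OF Vc W'(2)] .
  moreover have "u \<otimes> x \<otimes> inv u \<in> V <#> W" if u: "u \<in> carrier G" and x: "x \<in> V <#> W" for u x
  proof -
    obtain v w where vw: "v \<in> V" "w \<in> W" "x = v \<otimes> w" using x unfolding set_mult_mem by blast
    have c: "v \<in> carrier G" "w \<in> carrier G" using vw Vc Wc by auto
    have "u \<otimes> x \<otimes> inv u = (u \<otimes> v \<otimes> inv u) \<otimes> (u \<otimes> w \<otimes> inv u)"
    proof -
      have "inv u \<otimes> (u \<otimes> (w \<otimes> inv u)) = w \<otimes> inv u" using u c by (simp add: m_assoc[symmetric])
      then show ?thesis using u c vw by (simp add: m_assoc)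
    qed
    then show ?thesis using V'(3)[OF u vw(1)] W'(3)[OF u vw(2)] unfolding set_mult_mem by blast
  qed
  ultimately show ?thesis unfolding nopen_def by blast
qed

text \<open>Outer regularity at the complement yields a compact \<open>C\<close> inside
  \<open>\<Omega>\<close> of almost the same measure. The tube lemma gives an open normal
  \<open>W\<close> with \<open>C W\<close> inside \<open>\<Omega>\<close>, and finitely many cosets
  of \<open>W\<close> cover \<open>C\<close>.\<close>

lemma inner_approx:
  assumes \<Omega>: "openin T \<Omega>" and e: "e > 0"
  obtains W D where "nopen W" "finite D" "D \<subseteq> carrier G" "inj_on (\<lambda>y. y <# W) D" "D <#> W \<subseteq> \<Omega>"
    "measure \<mu> \<Omega> < measure \<mu> (D <#> W) + e"
proof -
  note \<Omega>c = open_subset_carrier[OF \<Omega>]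
  have F: "carrier G - \<Omega> \<in> sets \<mu>" using open_sets[OF \<Omega>] sets.compl_sets by (metis space_mu)
  obtain O' where O': "openin T O'" "carrier G - \<Omega> \<subseteq> O'" "measure \<mu> O' < measure \<mu> (carrier G - \<Omega>) + e"
    using outer_approx[OF F e] .
  define C where "C = carrier G - O'"
  have "closedin T C" unfolding C_def using O'(1) closedin_diff[OF closedin_topspace, of T] by simp
  then have C: "compactin T C" using closed_compactin[OF compact_carrier] unfolding C_def by blast
  have C\<Omega>: "C \<subseteq> \<Omega>" "C \<subseteq> carrier G" unfolding C_def using O'(2) by blast+
  let ?W = "{z \<in> topspace (prod_topology T T). fst z \<otimes> snd z \<in> \<Omega>}"
  have "openin (prod_topology T T) ?W"
    by (intro openin_continuous_map_preimage[OF _ \<Omega>] continuous_mult continuous_map_fst continuous_map_snd)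
  moreover have "C \<times> {\<one>} \<subseteq> ?W" using C\<Omega> by (auto simp: subset_iff)
  ultimately obtain N where N: "openin T N" "\<one> \<in> N" "\<And>c x. \<lbrakk>c \<in> C; x \<in> N\<rbrakk> \<Longrightarrow> (c, x) \<in> ?W"
    using compact_nbhd_one[OF C] by blast
  obtain W where W: "subgroup W G" "openin T W" "W \<subseteq> N" "\<And>u x. \<lbrakk>u \<in> carrier G; x \<in> W\<rbrakk> \<Longrightarrow> u \<otimes> x \<otimes> inv u \<in> W"
    using small_normal_open_subgroup[OF td compact_carrier open_carrier subgroup_self N(1,2)] by metis
  obtain D where D: "finite D" "D \<subseteq> C" "C \<subseteq> D <#> W" "inj_on (\<lambda>y. y <# W) D"
    using coset_reps[OF finite_cosets[OF C W(2,1)] W(1) C\<Omega>(2)] by metis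
  have "c \<otimes> w \<in> \<Omega>" if "c \<in> D" "w \<in> W" for c w using N(3)[of c w] that D(2) W(3) by auto
  then have D\<Omega>: "D <#> W \<subseteq> \<Omega>" by (auto simp: set_mult_mem)
  have Dc: "D \<subseteq> carrier G" using D(2) C\<Omega> by blast
  have "measure \<mu> C \<le> measure \<mu> (D <#> W)"
    by (rule finite_measure_mono[OF D(3) open_sets[OF open_set_mult_right[OF Dc W(2)]]])
  moreover have "measure \<mu> C = 1 - measure \<mu> O'"
    unfolding C_def using finite_measure_compl[OF open_sets[OF O'(1)]] measure_carrier by simp
  moreover have "measure \<mu> (carrier G - \<Omega>) = 1 - measure \<mu> \<Omega>"
    using finite_measure_compl[OF open_sets[OF \<Omega>]] measure_carrier by simp
  ultimately have "measure \<mu> \<Omega> < measure \<mu> (D <#> W) + e" using O'(3) by linarith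
  moreover have "nopen W" unfolding nopen_def using W by blast
  ultimately show thesis using that D Dc D\<Omega> by blast
qed

lemma act_sets: assumes h: "h \<in> carrier L" and A: "A \<in> sets \<mu>" shows "h ` A \<in> sets \<mu>"
proof -
  have ih: "inv\<^sub>L h \<in> carrier L" using h by simp
  have "inv\<^sub>L h \<in> measurable \<mu> \<mu>"
  proof (rule measurable_sigma_sets[OF sets_mu])
    show "{U. openin T U} \<subseteq> Pow (carrier G)" using open_subset_carrier by blast
    show "inv\<^sub>L h \<in> space \<mu> \<rightarrow> carrier G" using ih by simp
    fix y assume "y \<in> {U. openin T U}"
    then have y: "openin T y" by simp
    have "(inv\<^sub>L h) -` y \<inter> space \<mu> = h ` y"
      using act_image_mem_iff[OF h open_subset_carrier[OF y]] by auto
    then show "(inv\<^sub>L h) -` y \<inter> space \<mu> \<in> sets \<mu>" using open_sets[OF act_image_open[OF h y]] by simp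
  qed
  then have "(inv\<^sub>L h) -` A \<inter> space \<mu> \<in> sets \<mu>" using A by (rule measurable_sets)
  moreover have "A \<subseteq> carrier G" using sets.sets_into_space[OF A] by simp
  then have "(inv\<^sub>L h) -` A \<inter> space \<mu> = h ` A"
    by (intro Set.set_eqI) (simp add: act_image_mem_iff[OF h] conj_commute)
  ultimately show ?thesis by simp
qed

text \<open>The inner approximation is taken for the image and pulled back: equally many cosets of a
  subgroup of the same measure then fit into \<open>\<Omega>\<close>.\<close>

lemma measure_act_open_le:
  assumes h: "h \<in> carrier L" and \<Omega>: "openin T \<Omega>" shows "measure \<mu> (h ` \<Omega>) \<le> measure \<mu> \<Omega>"
proof (rule field_le_epsilon)
  fix e :: real assume e: "e > 0"
  have ih: "inv\<^sub>L h \<in> carrier L" using h by simp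
  obtain W D where WD: "nopen W" "finite D" "D \<subseteq> carrier G" "inj_on (\<lambda>y. y <# W) D" "D <#> W \<subseteq> h ` \<Omega>"
    "measure \<mu> (h ` \<Omega>) < measure \<mu> (D <#> W) + e"
    using inner_approx[OF act_image_open[OF h \<Omega>] e] .
  note W = nopenD[OF WD(1)]
  have iW: "subgroup ((inv\<^sub>L h) ` W) G" "openin T ((inv\<^sub>L h) ` W)"
    using act_image_subgroup[OF ih W(1)] act_image_open[OF ih W(2)] .
  have "(inv\<^sub>L h) ` (D <#> W) \<subseteq> (inv\<^sub>L h) ` h ` \<Omega>" using WD(5) by (rule image_mono)
  then have sub: "(inv\<^sub>L h) ` D <#> (inv\<^sub>L h) ` W \<subseteq> \<Omega>"
    using act_image_set_mult[OF ih WD(3) subgroup.subset[OF W(1)]] act_image_inv_left[OF h open_subset_carrier[OF \<Omega>]] by simp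
  have card: "card ((inv\<^sub>L h) ` D) = card D" using card_image inj_on_subset[OF act_inj[OF ih] WD(3)] by blast
  have "measure \<mu> (D <#> W) = real (card D) * measure \<mu> W"
    using measure_union_lcosets[OF W(1,2) WD(2-4)] .
  also have "\<dots> = measure \<mu> ((inv\<^sub>L h) ` D <#> (inv\<^sub>L h) ` W)"
    using measure_union_lcosets[OF iW _ _ act_inj_lcosets[OF ih W(1) WD(3,4)]] WD(2) act_image_closed[OF ih WD(3)]
      measure_act_subgroup[OF ih W(1,2)] card by simp
  also have "\<dots> \<le> measure \<mu> \<Omega>" by (rule finite_measure_mono[OF sub open_sets[OF \<Omega>]])
  finally show "measure \<mu> (h ` \<Omega>) \<le> measure \<mu> \<Omega> + e" using WD(6) by linarith
qed

lemma measure_act_le: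
  assumes h: "h \<in> carrier L" and A: "A \<in> sets \<mu>" shows "measure \<mu> (h ` A) \<le> measure \<mu> A"
proof (rule field_le_epsilon)
  fix e :: real assume e: "e > 0"
  obtain \<Omega> where \<Omega>: "openin T \<Omega>" "A \<subseteq> \<Omega>" "measure \<mu> \<Omega> < measure \<mu> A + e" using outer_approx[OF A e] .
  have "measure \<mu> (h ` A) \<le> measure \<mu> (h ` \<Omega>)"
    by (rule finite_measure_mono[OF image_mono[OF \<Omega>(2)] open_sets[OF act_image_open[OF h \<Omega>(1)]]])
  then show "measure \<mu> (h ` A) \<le> measure \<mu> A + e" using measure_act_open_le[OF h \<Omega>(1)] \<Omega>(3) by linarith
qed

lemma measure_act:
  assumes h: "h \<in> carrier L" and A: "A \<in> sets \<mu>" shows "measure \<mu> (h ` A) = measure \<mu> A"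
proof (rule antisym[OF measure_act_le[OF h A]])
  have "A \<subseteq> carrier G" using sets.sets_into_space[OF A] by simp
  then have "(inv\<^sub>L h) ` h ` A = A" using act_image_inv_left[OF h] by blast
  then show "measure \<mu> A \<le> measure \<mu> (h ` A)" using measure_act_le[of "inv\<^sub>L h" "h ` A"] act_sets[OF h A] h by simp
qed


section \<open>Correlation of a measurable set with cosets of open subgroups\<close>

context
  fixes A
  assumes A: "A \<in> sets \<mu>"
begin

text \<open>The integral over \<open>B\<close> of the indicator of \<open>A\<close> minus its mean.
  It vanishes on all cosets of an open subgroup \<open>W\<close> iff \<open>A\<close> is
  equidistributed among them.\<close>

definition \<nu> :: "'a set \<Rightarrow> real" where
  "\<nu> B = measure \<mu> (A \<inter> B) - measure \<mu> A * measure \<mu> B"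

lemma \<nu>_carrier: "\<nu> (carrier G) = 0"
proof -
  have "A \<inter> carrier G = A" using sets.sets_into_space[OF A] by auto
  then show ?thesis unfolding \<nu>_def using measure_carrier by simp
qed

lemma \<nu>_abs_le: assumes "B \<in> sets \<mu>" shows "\<bar>\<nu> B\<bar> \<le> measure \<mu> B"
proof -
  have "measure \<mu> (A \<inter> B) \<le> measure \<mu> B" by (rule finite_measure_mono) (use assms in auto)
  moreover have "measure \<mu> A * measure \<mu> B \<le> 1 * measure \<mu> B" by (rule mult_right_mono[OF measure_le_1]) simp
  moreover have "0 \<le> measure \<mu> A * measure \<mu> B" by simp
  moreover have "0 \<le> measure \<mu> (A \<inter> B)" by simp
  ultimately show ?thesis unfolding \<nu>_def abs_le_iff by linarith
qed

lemma \<nu>_lcosets: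
  assumes W: "subgroup W G" "openin T W" and D: "finite D" "D \<subseteq> carrier G" "inj_on (\<lambda>y. y <# W) D"
  shows "\<nu> (D <#> W) = (\<Sum>y\<in>D. \<nu> (y <# W))"
proof -
  have "(\<Sum>y\<in>D. \<nu> (y <# W))
    = (\<Sum>y\<in>D. measure \<mu> (A \<inter> (y <# W)) - measure \<mu> A * measure \<mu> W)"
    unfolding \<nu>_def by (rule sum.cong) (use D(2) measure_lcoset[OF W(2)] in auto)
  also have "\<dots> = (\<Sum>y\<in>D. measure \<mu> (A \<inter> (y <# W))) - measure \<mu> A * (real (card D) * measure \<mu> W)"
    by (simp add: sum_subtractf)
  finally show ?thesis
    unfolding \<nu>_def measure_lcosets[OF W D A] measure_union_lcosets[OF W D] by simp
qed

text \<open>A zero-one argument: \<open>A\<close> is independent of every finite union of cosets of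
  an open normal subgroup, and such unions approximate \<open>A\<close>, so \<open>A\<close> is
  independent of itself and its measure equals its square.\<close>

lemma trivial_if_\<nu>_zero:
  assumes zero: "\<And>W x. \<lbrakk>nopen W; x \<in> carrier G\<rbrakk> \<Longrightarrow> \<nu> (x <# W) = 0"
  shows "measure \<mu> A = 0 \<or> measure \<mu> A = 1"
proof -
  let ?a = "measure \<mu> A"
  have a: "0 \<le> ?a" "?a \<le> 1" using measure_le_1 by auto
  have "?a \<le> ?a * ?a"
  proof (rule field_le_epsilon)
    fix e :: real assume e: "e > 0"
    then have e2: "e / 2 > 0" by simp
    obtain \<Omega> where \<Omega>: "openin T \<Omega>" "A \<subseteq> \<Omega>" "measure \<mu> \<Omega> < ?a + e / 2" using outer_approx[OF A e2] .
    obtain W D where WD: "nopen W" "finite D" "D \<subseteq> carrier G" "inj_on (\<lambda>y. y <# W) D" "D <#> W \<subseteq> \<Omega>"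
      "measure \<mu> \<Omega> < measure \<mu> (D <#> W) + e / 2"
      using inner_approx[OF \<Omega>(1) e2] .
    note W = nopenD[OF WD(1)]
    have DW: "D <#> W \<in> sets \<mu>" using open_sets[OF open_set_mult_right[OF WD(3) W(2)]] .
    have "\<nu> (D <#> W) = 0"
      unfolding \<nu>_lcosets[OF W(1,2) WD(2-4)] using zero[OF WD(1)] WD(3) by (intro sum.neutral) auto
    then have 1: "measure \<mu> (A \<inter> (D <#> W)) = ?a * measure \<mu> (D <#> W)" unfolding \<nu>_def by simp
    have "A \<subseteq> (A \<inter> (D <#> W)) \<union> (\<Omega> - (D <#> W))" using \<Omega>(2) by blast
    then have "?a \<le> measure \<mu> ((A \<inter> (D <#> W)) \<union> (\<Omega> - (D <#> W)))"
      by (rule finite_measure_mono) (use A DW open_sets[OF \<Omega>(1)] in auto)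
    also have "\<dots> \<le> measure \<mu> (A \<inter> (D <#> W)) + measure \<mu> (\<Omega> - (D <#> W))"
      by (rule measure_Un_le) (use A DW open_sets[OF \<Omega>(1)] in auto)
    also have "measure \<mu> (\<Omega> - (D <#> W)) = measure \<mu> \<Omega> - measure \<mu> (D <#> W)"
      by (rule finite_measure_Diff[OF open_sets[OF \<Omega>(1)] DW WD(5)])
    also have "measure \<mu> (A \<inter> (D <#> W)) + (measure \<mu> \<Omega> - measure \<mu> (D <#> W)) \<le> ?a * (?a + e / 2) + e / 2"
    proof -
      have "measure \<mu> (D <#> W) \<le> measure \<mu> \<Omega>" by (rule finite_measure_mono[OF WD(5) open_sets[OF \<Omega>(1)]])
      then have "?a * measure \<mu> (D <#> W) \<le> ?a * (?a + e / 2)" using \<Omega>(3) a by (intro mult_left_mono) linarith+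
      then show ?thesis using 1 WD(6) by linarith
    qed
    also have "\<dots> \<le> ?a * ?a + e"
    proof -
      have "?a * (e / 2) \<le> 1 * (e / 2)" using a e by (intro mult_right_mono) auto
      then show ?thesis by (simp add: distrib_left)
    qed
    finally show "?a \<le> ?a * ?a + e" .
  qed
  then have "?a * (1 - ?a) \<le> 0" by (simp add: algebra_simps)
  then show ?thesis using a by (smt (verit) mult_pos_pos)
qed

text \<open>Turns values on cosets of a larger group into finite sums over coset representatives of
  a small \<open>Z\<close>, so that \<open>bessel_bound\<close> deals with finite sums instead of
  integrals.\<close>

lemma sum_transversal:
  assumes Z: "subgroup Z G" "openin T Z" and Y: "finite Y" "Y \<subseteq> carrier G" "inj_on (\<lambda>y. y <# Z) Y" "carrier G = Y <#> Z"
    and M: "subgroup M G" "Z \<subseteq> M" and g: "g \<in> carrier G"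
  shows "(\<Sum>y\<in>Y \<inter> (g <# M). \<nu> (y <# Z)) = \<nu> (g <# M)"
    and "real (card (Y \<inter> (g <# M))) * measure \<mu> Z = measure \<mu> M"
proof -
  note Mc = subgroup.subset[OF M(1)] and Zc = subgroup.subset[OF Z(1)]
  let ?D = "Y \<inter> (g <# M)"
  have eq: "g <# M = ?D <#> Z"
  proof
    show "?D <#> Z \<subseteq> g <# M"
    proof
      fix x assume "x \<in> ?D <#> Z"
      then obtain y z where yz: "y \<in> Y" "y \<in> g <# M" "z \<in> Z" "x = y \<otimes> z" unfolding set_mult_mem by blast
      have c: "y \<in> carrier G" "z \<in> carrier G" "inv g \<otimes> y \<in> M" using yz Y(2) Zc l_coset_mem_iff[OF g Mc] by auto
      have "(inv g \<otimes> y) \<otimes> z \<in> M" using subgroup.m_closed[OF M(1) c(3)] yz(3) M(2) by blast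
      then show "x \<in> g <# M" unfolding l_coset_mem_iff[OF g Mc] using yz c g by (simp add: m_assoc)
    qed
    show "g <# M \<subseteq> ?D <#> Z"
    proof
      fix x assume x: "x \<in> g <# M"
      then have xc: "x \<in> carrier G" "inv g \<otimes> x \<in> M" using l_coset_mem_iff[OF g Mc] by auto
      obtain y z where yz: "y \<in> Y" "z \<in> Z" "x = y \<otimes> z" using xc(1) Y(4) set_mult_mem[of x Y Z] by blast
      have c: "y \<in> carrier G" "z \<in> carrier G" using yz Y(2) Zc by auto
      have "(inv g \<otimes> x) \<otimes> inv z \<in> M"
        using xc(2) yz(2) M subgroup.m_closed[OF M(1)] subgroup.m_inv_closed[OF M(1)] by blast
      moreover have "(inv g \<otimes> x) \<otimes> inv z = inv g \<otimes> y" using yz c g by (simp add: m_assoc)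
      ultimately have "y \<in> g <# M" unfolding l_coset_mem_iff[OF g Mc] using c by simp
      then show "x \<in> ?D <#> Z" using yz unfolding set_mult_mem by blast
    qed
  qed
  have D: "finite ?D" "?D \<subseteq> carrier G" "inj_on (\<lambda>y. y <# Z) ?D"
    using Y(1,2) inj_on_subset[OF Y(3)] by auto
  have Mo: "openin T M" using subgroup_open_if_nbhd[OF M(1) Z(2) subgroup.one_closed[OF Z(1)] M(2)] .
  show "(\<Sum>y\<in>?D. \<nu> (y <# Z)) = \<nu> (g <# M)"
    using \<nu>_lcosets[OF Z D] eq by simp
  show "real (card ?D) * measure \<mu> Z = measure \<mu> M"
    using measure_union_lcosets[OF Z D] eq measure_lcoset[OF Mo g] by simp
qed

text \<open>
  Bessel's inequality for the conditional expectations of the indicator of \<open>A\<close> with respect to the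
  subgroups in \<open>\<O>\<close>: they are pairwise orthogonal and of the same size, so \<open>\<O>\<close> cannot be large.
\<close>

lemma bessel_bound:
  assumes \<O>: "finite \<O>" "\<O> \<noteq> {}" "\<And>W. W \<in> \<O> \<Longrightarrow> nopen W" "\<And>W. W \<in> \<O> \<Longrightarrow> measure \<mu> W = m"
    and orth: "\<And>V W x. \<lbrakk>V \<in> \<O>; W \<in> \<O>; V \<noteq> W; x \<in> carrier G\<rbrakk> \<Longrightarrow> \<nu> (x <# (V <#> W)) = 0"
    and big: "\<And>W. W \<in> \<O> \<Longrightarrow> \<exists>x\<in>carrier G. \<delta> \<le> \<bar>\<nu> (x <# W)\<bar>" and \<delta>: "0 \<le> \<delta>"
  shows "real (card \<O>) * \<delta>\<^sup>2 \<le> 1"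
proof -
  define Z where "Z = \<Inter>\<O>"
  have Z: "nopen Z" unfolding Z_def using nopen_Inter[OF \<O>(1,2)] \<O>(3) by blast
  note Z' = nopenD[OF Z] and Zc = subgroup.subset[OF nopenD(1)[OF Z]]
  have W': "subgroup W G" "openin T W" "Z \<subseteq> W" "W \<subseteq> carrier G" if "W \<in> \<O>" for W
    using nopenD[OF \<O>(3)[OF that]] that subgroup.subset unfolding Z_def by blast+
  have Zp: "measure \<mu> Z > 0" using measure_open_subgroup_pos[OF Z'(1,2)] .
  obtain W0 where W0: "W0 \<in> \<O>" using \<O>(2) by blast
  have mp: "m > 0" using measure_open_subgroup_pos[OF W'(1,2)[OF W0]] \<O>(4)[OF W0] by simp
  have m1: "m \<le> 1" using \<O>(4)[OF W0] measure_le_1[of W0] by simp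
  \<comment> \<open>The index of \<open>Z\<close> in each member of \<open>\<O>\<close>; it is
    common to all of them because their measures agree.\<close>
  define k where "k = m / measure \<mu> Z"
  have kp: "k > 0" unfolding k_def using mp Zp by simp
  obtain Y where Y: "finite Y" "Y \<subseteq> carrier G" "inj_on (\<lambda>y. y <# Z) Y" "carrier G = Y <#> Z"
    "real (card Y) * measure \<mu> Z = 1" using transversal[OF Z'(1,2)] .
  note ST = sum_transversal[OF Z'(1,2) Y(1-4)]
  define a where "a y = \<nu> (y <# Z)" for y
  define b where "b W y = \<nu> (y <# W)" for W y
  have rel: "z \<in> y <# W \<longleftrightarrow> y \<in> z <# W" if "W \<in> \<O>" "y \<in> carrier G" "z \<in> carrier G" for W y z
    using lcoset_eq[OF W'(1)[OF that(1)]] lcoset_self[OF W'(1)[OF that(1)]] that by metis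
  have b_eq: "b W y = (\<Sum>z\<in>Y. if z \<in> y <# W then a z else 0)" if "W \<in> \<O>" "y \<in> Y" for W y
  proof -
    have "b W y = (\<Sum>z\<in>Y \<inter> (y <# W). a z)"
      unfolding b_def a_def using ST(1)[OF W'(1,3)[OF that(1)], of y] that(2) Y(2) by auto
    then show ?thesis by (simp add: sum.inter_restrict[OF Y(1)])
  qed
  have bb: "(\<Sum>y\<in>Y. b V y * b W y)
    = (\<Sum>z\<in>Y. \<Sum>v\<in>Y. a z * a v * real (card (Y \<inter> ((z <# V) \<inter> (v <# W)))))"
    if VW: "V \<in> \<O>" "W \<in> \<O>" for V W
  proof -
    have "(\<Sum>y\<in>Y. b V y * b W y)
      = (\<Sum>y\<in>Y. \<Sum>z\<in>Y. \<Sum>v\<in>Y. a z * a v * (if y \<in> (z <# V) \<inter> (v <# W) then 1 else 0))"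
    proof (rule sum.cong[OF refl])
      fix y assume y: "y \<in> Y"
      have "b V y * b W y = (\<Sum>z\<in>Y. \<Sum>v\<in>Y. (if z \<in> y <# V then a z else 0) * (if v \<in> y <# W then a v else 0))"
        unfolding b_eq[OF VW(1) y] b_eq[OF VW(2) y] sum_product ..
      also have "\<dots> = (\<Sum>z\<in>Y. \<Sum>v\<in>Y. a z * a v * (if y \<in> (z <# V) \<inter> (v <# W) then 1 else 0))"
      proof (intro sum.cong refl)
        fix z v assume "z \<in> Y" "v \<in> Y"
        then have "z \<in> y <# V \<longleftrightarrow> y \<in> z <# V" "v \<in> y <# W \<longleftrightarrow> y \<in> v <# W"
          using rel VW y Y(2) by (meson subsetD)+
        then show "(if z \<in> y <# V then a z else 0) * (if v \<in> y <# W then a v else 0)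
          = a z * a v * (if y \<in> (z <# V) \<inter> (v <# W) then 1 else 0)" by simp
      qed
      finally show "b V y * b W y = \<dots>" .
    qed
    also have "\<dots> = (\<Sum>z\<in>Y. \<Sum>y\<in>Y. \<Sum>v\<in>Y. a z * a v * (if y \<in> (z <# V) \<inter> (v <# W) then 1 else 0))"
      by (rule sum.swap)
    also have "\<dots> = (\<Sum>z\<in>Y. \<Sum>v\<in>Y. \<Sum>y\<in>Y. a z * a v * (if y \<in> (z <# V) \<inter> (v <# W) then 1 else 0))"
      by (intro sum.cong refl sum.swap)
    also have "\<dots> = (\<Sum>z\<in>Y. \<Sum>v\<in>Y. a z * a v * real (card (Y \<inter> ((z <# V) \<inter> (v <# W)))))"
    proof (intro sum.cong refl)
      fix z v
      have "(\<Sum>y\<in>Y. if y \<in> (z <# V) \<inter> (v <# W) then 1 else 0) = real (card (Y \<inter> ((z <# V) \<inter> (v <# W))))"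
        using sum.inter_restrict[OF Y(1), of "\<lambda>_. 1::real" "(z <# V) \<inter> (v <# W)"] by simp
      then show "(\<Sum>y\<in>Y. a z * a v * (if y \<in> (z <# V) \<inter> (v <# W) then 1 else 0))
        = a z * a v * real (card (Y \<inter> ((z <# V) \<inter> (v <# W))))"
        by (simp only: sum_distrib_left[symmetric])
    qed
    finally show ?thesis .
  qed
  have meet: "(z <# V) \<inter> (v <# W) = t <# (V \<inter> W)"
    if "V \<in> \<O>" "W \<in> \<O>" "z \<in> carrier G" "v \<in> carrier G" "t \<in> (z <# V) \<inter> (v <# W)" for V W z v t
  proof -
    have tc: "t \<in> carrier G" using that l_coset_subset_G[OF W'(4)] by blast
    have "t <# V = z <# V" "t <# W = v <# W"
      using lcoset_eq[OF W'(1)[OF that(1)], of t z] lcoset_eq[OF W'(1)[OF that(2)], of t v] that by auto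
    moreover have "(t <# V) \<inter> (t <# W) = t <# (V \<inter> W)"
      using tc W'(4)[OF that(1)] W'(4)[OF that(2)] l_coset_mem_iff[OF tc, of V] l_coset_mem_iff[OF tc, of W]
        l_coset_mem_iff[OF tc, of "V \<inter> W"] by (intro Set.set_eqI) (metis Int_iff le_infI1)
    ultimately show ?thesis by simp
  qed
  have self: "(\<Sum>y\<in>Y. b W y * b W y) = k * (\<Sum>y\<in>Y. a y * b W y)" if W: "W \<in> \<O>" for W
  proof -
    have "(\<Sum>y\<in>Y. b W y * b W y) = (\<Sum>z\<in>Y. \<Sum>v\<in>Y. a z * a v * (if v \<in> z <# W then k else 0))"
      unfolding bb[OF W W]
    proof (intro sum.cong refl)
      fix z v assume zv: "z \<in> Y" "v \<in> Y"
      then have c: "z \<in> carrier G" "v \<in> carrier G" using Y(2) by auto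
      have "real (card (Y \<inter> ((z <# W) \<inter> (v <# W)))) = (if v \<in> z <# W then k else 0)"
      proof (cases "v \<in> z <# W")
        case True
        then have "(z <# W) \<inter> (v <# W) = v <# W" using lcoset_eq[OF W'(1)[OF W] True c(1)] by simp
        then have "real (card (Y \<inter> ((z <# W) \<inter> (v <# W)))) = k"
          using ST(2)[OF W'(1,3)[OF W] c(2)] \<O>(4)[OF W] Zp unfolding k_def by (simp add: field_simps)
        then show ?thesis using True by simp
      next
        case False
        then have "z <# W \<noteq> v <# W" using lcoset_self[OF W'(1)[OF W] c(2)] by blast
        then have "(z <# W) \<inter> (v <# W) = {}" using lcoset_disjoint[OF W'(1)[OF W] c] by blast
        then show ?thesis using False by simp
      qed
      then show "a z * a v * real (card (Y \<inter> ((z <# W) \<inter> (v <# W))))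
        = a z * a v * (if v \<in> z <# W then k else 0)" by simp
    qed
    also have "\<dots> = (\<Sum>z\<in>Y. k * (a z * b W z))"
    proof (rule sum.cong[OF refl])
      fix z assume z: "z \<in> Y"
      show "(\<Sum>v\<in>Y. a z * a v * (if v \<in> z <# W then k else 0)) = k * (a z * b W z)"
        unfolding b_eq[OF W z] sum_distrib_left by (rule sum.cong) auto
    qed
    finally show ?thesis by (simp add: sum_distrib_left)
  qed
  \<comment> \<open>Two cosets \<open>z V\<close> and \<open>v W\<close> meet iff \<open>v\<close>
    lies in \<open>z V W\<close>, and then in a coset of \<open>V \<inter> W\<close>, always with
    the same number \<open>j\<close> of representatives. The inner sum is thus a multiple of the
    value of \<nu> on a coset of \<open>V W\<close>, which is zero.\<close>
  have cross: "(\<Sum>y\<in>Y. b V y * b W y) = 0" if VW: "V \<in> \<O>" "W \<in> \<O>" "V \<noteq> W" for V W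
  proof -
    have VWs: "subgroup (V <#> W) G" "Z \<subseteq> V <#> W" "V <#> W \<subseteq> carrier G"
    proof -
      show s: "subgroup (V <#> W) G" using nopenD(1)[OF nopen_set_mult] \<O>(3) VW by blast
      then show "V <#> W \<subseteq> carrier G" by (rule subgroup.subset)
      show "Z \<subseteq> V <#> W"
        using subset_set_mult_right[OF W'(4)[OF VW(2)] subgroup.one_closed[OF W'(1)[OF VW(1)]]] W'(3)[OF VW(2)] by blast
    qed
    have VIW: "subgroup (V \<inter> W) G" "Z \<subseteq> V \<inter> W"
      using subgroups_Inter_pair[OF W'(1)[OF VW(1)] W'(1)[OF VW(2)]] W'(3) VW by blast+
    define j where "j = measure \<mu> (V \<inter> W) / measure \<mu> Z"
    have "(\<Sum>y\<in>Y. b V y * b W y) = (\<Sum>z\<in>Y. \<Sum>v\<in>Y. a z * a v * (if v \<in> z <# (V <#> W) then j else 0))"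
      unfolding bb[OF VW(1,2)]
    proof (intro sum.cong refl)
      fix z v assume zv: "z \<in> Y" "v \<in> Y"
      then have c: "z \<in> carrier G" "v \<in> carrier G" using Y(2) by auto
      have ne: "(z <# V) \<inter> (v <# W) \<noteq> {} \<longleftrightarrow> v \<in> z <# (V <#> W)"
      proof
        assume "(z <# V) \<inter> (v <# W) \<noteq> {}"
        then obtain x y where xy: "x \<in> V" "y \<in> W" "z \<otimes> x = v \<otimes> y" unfolding l_coset_eq_image by blast
        have d: "x \<in> carrier G" "y \<in> carrier G" using xy W'(4) VW by blast+
        have "v = (z \<otimes> x) \<otimes> inv y" using xy(3) c d by (simp add: m_assoc)
        then have "v = z \<otimes> (x \<otimes> inv y)" using c d by (simp add: m_assoc)
        moreover have "x \<otimes> inv y \<in> V <#> W"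
          using xy subgroup.m_inv_closed[OF W'(1)[OF VW(2)]] unfolding set_mult_mem by blast
        ultimately show "v \<in> z <# (V <#> W)" unfolding l_coset_eq_image by blast
      next
        assume "v \<in> z <# (V <#> W)"
        then obtain x y where xy: "x \<in> V" "y \<in> W" "v = z \<otimes> (x \<otimes> y)" unfolding l_coset_eq_image set_mult_def by blast
        have d: "x \<in> carrier G" "y \<in> carrier G" using xy W'(4) VW by blast+
        have "v \<otimes> inv y = z \<otimes> x" using xy c d by (simp add: m_assoc)
        moreover have "v \<otimes> inv y \<in> v <# W"
          using subgroup.m_inv_closed[OF W'(1)[OF VW(2)] xy(2)] unfolding l_coset_eq_image by blast
        moreover have "z \<otimes> x \<in> z <# V" using xy unfolding l_coset_eq_image by blast
        ultimately show "(z <# V) \<inter> (v <# W) \<noteq> {}" by auto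
      qed
      have "real (card (Y \<inter> ((z <# V) \<inter> (v <# W)))) = (if v \<in> z <# (V <#> W) then j else 0)"
      proof (cases "v \<in> z <# (V <#> W)")
        case True
        then obtain t where t: "t \<in> (z <# V) \<inter> (v <# W)" using ne by blast
        have tc: "t \<in> carrier G" using t l_coset_subset_G[OF W'(4)[OF VW(1)] c(1)] by blast
        have "real (card (Y \<inter> (t <# (V \<inter> W)))) = j"
          using ST(2)[OF VIW tc] Zp unfolding j_def by (simp add: field_simps)
        then show ?thesis using True meet[OF VW(1,2) c t] by simp
      next
        case False
        then show ?thesis using ne by auto
      qed
      then show "a z * a v * real (card (Y \<inter> ((z <# V) \<inter> (v <# W))))
        = a z * a v * (if v \<in> z <# (V <#> W) then j else 0)" by simp
    qed
    also have "\<dots> = (\<Sum>z\<in>Y. 0)"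
    proof (rule sum.cong[OF refl])
      fix z assume z: "z \<in> Y"
      then have zc: "z \<in> carrier G" using Y(2) by blast
      have "(\<Sum>v\<in>Y. if v \<in> z <# (V <#> W) then a v else 0) = (\<Sum>v\<in>Y \<inter> (z <# (V <#> W)). a v)"
        by (simp add: sum.inter_restrict[OF Y(1)])
      also have "\<dots> = 0" unfolding a_def using ST(1)[OF VWs(1,2) zc] orth[OF VW zc] by simp
      finally have 0: "(\<Sum>v\<in>Y. if v \<in> z <# (V <#> W) then a v else 0) = 0" .
      have "(\<Sum>v\<in>Y. a z * a v * (if v \<in> z <# (V <#> W) then j else 0))
        = (a z * j) * (\<Sum>v\<in>Y. if v \<in> z <# (V <#> W) then a v else 0)"
        unfolding sum_distrib_left by (rule sum.cong) auto
      then show "(\<Sum>v\<in>Y. a z * a v * (if v \<in> z <# (V <#> W) then j else 0)) = 0" using 0 by simp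
    qed
    finally show ?thesis by simp
  qed
  define q where "q W = (\<Sum>y\<in>Y. a y * b W y)" for W
  have q_ge: "\<delta>\<^sup>2 \<le> q W" if W: "W \<in> \<O>" for W
  proof -
    obtain x where x: "x \<in> carrier G" "\<delta> \<le> \<bar>\<nu> (x <# W)\<bar>" using big[OF W] by blast
    have kc: "real (card (Y \<inter> (x <# W))) = k"
      using ST(2)[OF W'(1,3)[OF W] x(1)] \<O>(4)[OF W] Zp unfolding k_def by (simp add: field_simps)
    have "k * \<delta>\<^sup>2 = (\<Sum>y\<in>Y \<inter> (x <# W). \<delta>\<^sup>2)" using kc by simp
    also have "\<dots> \<le> (\<Sum>y\<in>Y \<inter> (x <# W). b W y * b W y)"
    proof (rule sum_mono)
      fix y assume "y \<in> Y \<inter> (x <# W)"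
      then have "b W y = \<nu> (x <# W)" unfolding b_def using lcoset_eq[OF W'(1)[OF W] _ x(1)] by simp
      then show "\<delta>\<^sup>2 \<le> b W y * b W y" using x(2) \<delta> power_mono[OF x(2) \<delta>, of 2] by (simp add: power2_eq_square)
    qed
    also have "\<dots> \<le> (\<Sum>y\<in>Y. b W y * b W y)" by (rule sum_mono2) (use Y(1) in auto)
    also have "\<dots> = k * q W" unfolding q_def using self[OF W] .
    finally show ?thesis using kp by simp
  qed
  \<comment> \<open>Divided by \<open>k\<close>, \<open>b W\<close> is the orthogonal projection of
    \<open>a\<close> to the functions constant on cosets of \<open>W\<close>. The square is that of
    the component of \<open>a\<close> orthogonal to all these projections, scaled by
    \<open>k\<close>.\<close>
  have "0 \<le> (\<Sum>y\<in>Y. (k * a y - (\<Sum>W\<in>\<O>. b W y))\<^sup>2)" by (rule sum_nonneg) simp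
  also have "\<dots> = (\<Sum>y\<in>Y. k\<^sup>2 * (a y * a y) - 2 * k * (\<Sum>W\<in>\<O>. a y * b W y) + (\<Sum>V\<in>\<O>. \<Sum>W\<in>\<O>. b V y * b W y))"
  proof (rule sum.cong[OF refl])
    fix y
    have "(\<Sum>V\<in>\<O>. \<Sum>W\<in>\<O>. b V y * b W y) = (\<Sum>W\<in>\<O>. b W y) * (\<Sum>W\<in>\<O>. b W y)" by (simp add: sum_product)
    moreover have "(\<Sum>W\<in>\<O>. a y * b W y) = a y * (\<Sum>W\<in>\<O>. b W y)" by (simp add: sum_distrib_left)
    ultimately show "(k * a y - (\<Sum>W\<in>\<O>. b W y))\<^sup>2
      = k\<^sup>2 * (a y * a y) - 2 * k * (\<Sum>W\<in>\<O>. a y * b W y) + (\<Sum>V\<in>\<O>. \<Sum>W\<in>\<O>. b V y * b W y)"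
      by (simp add: power2_eq_square algebra_simps)
  qed
  also have "\<dots> = k\<^sup>2 * (\<Sum>y\<in>Y. a y * a y) - 2 * k * (\<Sum>y\<in>Y. \<Sum>W\<in>\<O>. a y * b W y)
      + (\<Sum>y\<in>Y. \<Sum>V\<in>\<O>. \<Sum>W\<in>\<O>. b V y * b W y)"
    by (simp add: sum.distrib sum_subtractf sum_distrib_left)
  also have "(\<Sum>y\<in>Y. \<Sum>W\<in>\<O>. a y * b W y) = (\<Sum>W\<in>\<O>. q W)" unfolding q_def by (rule sum.swap)
  also have "(\<Sum>y\<in>Y. \<Sum>V\<in>\<O>. \<Sum>W\<in>\<O>. b V y * b W y) = k * (\<Sum>W\<in>\<O>. q W)"
  proof -
    have "(\<Sum>y\<in>Y. \<Sum>V\<in>\<O>. \<Sum>W\<in>\<O>. b V y * b W y) = (\<Sum>V\<in>\<O>. \<Sum>y\<in>Y. \<Sum>W\<in>\<O>. b V y * b W y)" by (rule sum.swap)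
    also have "\<dots> = (\<Sum>V\<in>\<O>. \<Sum>W\<in>\<O>. \<Sum>y\<in>Y. b V y * b W y)" by (intro sum.cong refl sum.swap)
    also have "\<dots> = (\<Sum>V\<in>\<O>. \<Sum>W\<in>\<O>. if W = V then k * q V else 0)"
      by (intro sum.cong refl) (use cross self in \<open>auto simp: q_def\<close>)
    also have "\<dots> = (\<Sum>V\<in>\<O>. k * q V)" using \<O>(1) by simp
    finally show ?thesis by (simp add: sum_distrib_left)
  qed
  finally have "k * (\<Sum>W\<in>\<O>. q W) \<le> k * (k * (\<Sum>y\<in>Y. a y * a y))" by (simp add: power2_eq_square algebra_simps)
  then have 1: "(\<Sum>W\<in>\<O>. q W) \<le> k * (\<Sum>y\<in>Y. a y * a y)" using kp by simp
  have "(\<Sum>y\<in>Y. a y * a y) \<le> (\<Sum>y\<in>Y. measure \<mu> Z * measure \<mu> Z)"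
  proof (rule sum_mono)
    fix y assume "y \<in> Y"
    then have yc: "y \<in> carrier G" using Y(2) by blast
    have "\<bar>a y\<bar> \<le> measure \<mu> Z"
      unfolding a_def using \<nu>_abs_le[OF open_sets[OF open_lcoset[OF yc Z'(2)]]] measure_lcoset[OF Z'(2) yc] by simp
    then have "\<bar>a y\<bar> * \<bar>a y\<bar> \<le> measure \<mu> Z * measure \<mu> Z" by (intro mult_mono) auto
    then show "a y * a y \<le> measure \<mu> Z * measure \<mu> Z" by (simp flip: abs_mult)
  qed
  also have "\<dots> = (real (card Y) * measure \<mu> Z) * measure \<mu> Z" by simp
  also have "\<dots> = measure \<mu> Z" unfolding Y(5) by simp
  finally have "k * (\<Sum>y\<in>Y. a y * a y) \<le> k * measure \<mu> Z" using kp by simp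
  also have "\<dots> = m" unfolding k_def using Zp by simp
  finally have "(\<Sum>W\<in>\<O>. q W) \<le> 1" using 1 m1 by simp
  moreover have "real (card \<O>) * \<delta>\<^sup>2 \<le> (\<Sum>W\<in>\<O>. q W)"
    using sum_mono[of \<O> "\<lambda>_. \<delta>\<^sup>2" q] q_ge by simp
  ultimately show ?thesis by simp
qed

text \<open>Members of the orbit of a minimal bad \<open>W\<close> have equal measure, so the
  product of two distinct ones is strictly larger, has smaller index and is not bad: this is the
  orthogonality that \<open>bessel_bound\<close> requires. A finite orbit would intersect in an open
  invariant subgroup, forcing \<open>W\<close> to be the whole group, where \<nu> vanishes.\<close>

theorem ergodic_set:
  assumes noinv: "\<And>V. \<lbrakk>subgroup V G; openin T V; \<And>g. g \<in> carrier L \<Longrightarrow> g ` V = V\<rbrakk> \<Longrightarrow> V = carrier G"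
    and inv: "\<And>g. g \<in> carrier L \<Longrightarrow> g ` A = A"
  shows "measure \<mu> A = 0 \<or> measure \<mu> A = 1"
proof (rule ccontr)
  assume not: "\<not> ?thesis"
  define bad where "bad W \<longleftrightarrow> nopen W \<and> (\<exists>x\<in>carrier G. \<nu> (x <# W) \<noteq> 0)" for W
  have "\<exists>W. bad W" using not trivial_if_\<nu>_zero unfolding bad_def by blast
  then obtain W where W: "bad W" and min: "\<And>V. bad V \<Longrightarrow> cidx W (carrier G) \<le> cidx V (carrier G)"
    using ex_has_least_nat[of bad _ "\<lambda>W. cidx W (carrier G)"] by blast
  have Wn: "nopen W" using W unfolding bad_def by blast
  note W' = nopenD[OF Wn] and Wc = subgroup.subset[OF nopenD(1)[OF Wn]]
  obtain x0 where x0: "x0 \<in> carrier G" "\<nu> (x0 <# W) \<noteq> 0" using W unfolding bad_def by blast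
  define \<delta> where "\<delta> = \<bar>\<nu> (x0 <# W)\<bar>"
  have \<delta>: "\<delta> > 0" unfolding \<delta>_def using x0 by simp
  have Ac: "A \<subseteq> carrier G" using sets.sets_into_space[OF A] by simp
  have \<nu>_act: "\<nu> (h ` B) = \<nu> B" if h: "h \<in> carrier L" and B: "B \<in> sets \<mu>" for h B
  proof -
    have "B \<subseteq> carrier G" using sets.sets_into_space[OF B] by simp
    then have "A \<inter> h ` B = h ` (A \<inter> B)" using act_image_Int[OF h Ac] inv[OF h] by simp
    then show ?thesis unfolding \<nu>_def using measure_act[OF h] A B by (simp add: sets.Int)
  qed
  define \<O> where "\<O> = (\<lambda>h. h ` W) ` carrier L"
  have \<O>n: "nopen V" if "V \<in> \<O>" for V using that nopen_act[OF _ Wn] unfolding \<O>_def by blast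
  have \<O>m: "measure \<mu> V = measure \<mu> W" if "V \<in> \<O>" for V
    using that measure_act_subgroup[OF _ W'(1,2)] unfolding \<O>_def by blast
  have \<O>big: "\<exists>x\<in>carrier G. \<delta> \<le> \<bar>\<nu> (x <# V)\<bar>" if V: "V \<in> \<O>" for V
  proof -
    obtain h where h: "h \<in> carrier L" "V = h ` W" using V unfolding \<O>_def by blast
    have "h x0 <# V = h ` (x0 <# W)" using act_image_lcoset[OF h(1) x0(1) Wc] h by simp
    then have "\<nu> (h x0 <# V) = \<nu> (x0 <# W)"
      using \<nu>_act[OF h(1) open_sets[OF open_lcoset[OF x0(1) W'(2)]]] by simp
    then show ?thesis using h x0 unfolding \<delta>_def by (intro bexI[of _ "h x0"]) auto
  qed
  have cidx_measure: "real (cidx V (carrier G)) * measure \<mu> V = 1" if "nopen V" for V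
  proof -
    note V = nopenD[OF that]
    obtain Y where Y: "finite Y" "Y \<subseteq> carrier G" "inj_on (\<lambda>y. y <# V) Y" "carrier G = Y <#> V"
      "real (card Y) * measure \<mu> V = 1" using transversal[OF V(1,2)] .
    have "(\<lambda>y. y <# V) ` carrier G = (\<lambda>y. y <# V) ` Y"
    proof
      show "(\<lambda>y. y <# V) ` carrier G \<subseteq> (\<lambda>y. y <# V) ` Y"
      proof (rule image_subsetI)
        fix x assume "x \<in> carrier G"
        then have "x \<in> (\<Union>a\<in>Y. a <# V)" using Y(4) unfolding set_mult_eq_UN by blast
        then obtain y where "y \<in> Y" "x \<in> y <# V" by blast
        then show "x <# V \<in> (\<lambda>y. y <# V) ` Y" using lcoset_eq[OF V(1)] Y(2) by blast
      qed
    qed (use Y(2) in blast)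
    then have "cidx V (carrier G) = card Y" unfolding cidx_def using card_image[OF Y(3)] by simp
    then show ?thesis using Y(5) by simp
  qed
  have orth: "\<nu> (x <# (V <#> V')) = 0"
    if V: "V \<in> \<O>" "V' \<in> \<O>" "V \<noteq> V'" and x: "x \<in> carrier G" for V V' x
  proof (rule ccontr)
    assume nz: "\<nu> (x <# (V <#> V')) \<noteq> 0"
    let ?P = "V <#> V'"
    have P: "nopen ?P" using nopen_set_mult \<O>n V by blast
    then have "bad ?P" unfolding bad_def using nz x by blast
    then have "cidx W (carrier G) \<le> cidx ?P (carrier G)" by (rule min)
    then have "real (cidx W (carrier G)) * measure \<mu> ?P \<le> real (cidx ?P (carrier G)) * measure \<mu> ?P"
      by (intro mult_right_mono) auto
    also have "\<dots> = real (cidx W (carrier G)) * measure \<mu> W" using cidx_measure[OF P] cidx_measure[OF Wn] by simp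
    finally have "measure \<mu> ?P \<le> measure \<mu> W"
      using cidx_measure[OF Wn] by (metis mult_le_cancel_left_pos mult_zero_left of_nat_0_le_iff order_less_le zero_neq_one)
    then have le: "measure \<mu> ?P \<le> measure \<mu> V" "measure \<mu> ?P \<le> measure \<mu> V'" using \<O>m V by auto
    \<comment> \<open>A proper open subgroup has at least two disjoint cosets in \<open>?P\<close>,
      hence at most half of its measure.\<close>
    have eqP: "Q = ?P" if Q: "nopen Q" "Q \<subseteq> ?P" "measure \<mu> ?P \<le> measure \<mu> Q" for Q
    proof (rule ccontr)
      assume "Q \<noteq> ?P"
      then obtain p where p: "p \<in> ?P" "p \<notin> Q" using Q(2) by blast
      note Q' = nopenD[OF Q(1)] and P' = nopenD[OF P]
      have pc: "p \<in> carrier G" using p subgroup.subset[OF P'(1)] by blast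
      have inj: "inj_on (\<lambda>y. y <# Q) {\<one>, p}"
        using lcoset_eq_iff[OF Q'(1) one_closed pc] p(2) pc by (auto simp: inj_on_def)
      have "\<one> \<noteq> p" using p(2) subgroup.one_closed[OF Q'(1)] by blast
      then have "measure \<mu> ({\<one>, p} <#> Q) = 2 * measure \<mu> Q"
        using measure_union_lcosets[OF Q'(1,2) _ _ inj] pc by simp
      moreover have "{\<one>, p} <#> Q \<subseteq> ?P"
        using set_mult_subset[OF P'(1) _ Q(2)] p subgroup.one_closed[OF P'(1)] by simp
      then have "measure \<mu> ({\<one>, p} <#> Q) \<le> measure \<mu> ?P" by (rule finite_measure_mono[OF _ open_sets[OF P'(2)]])
      ultimately show False using Q(3) measure_open_subgroup_pos[OF Q'(1,2)] by linarith
    qed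
    note Vn = \<O>n[OF V(1)] and V'n = \<O>n[OF V(2)]
    have "V \<subseteq> ?P"
      using subset_set_mult_left[OF subgroup.subset subgroup.one_closed] nopenD(1)[OF Vn] nopenD(1)[OF V'n] by blast
    moreover have "V' \<subseteq> ?P"
      using subset_set_mult_right[OF subgroup.subset subgroup.one_closed] nopenD(1)[OF Vn] nopenD(1)[OF V'n] by blast
    ultimately have "V = ?P" "V' = ?P" using eqP Vn V'n le by blast+
    then show False using V(3) by simp
  qed
  have "infinite \<O>"
  proof
    assume fin: "finite \<O>"
    have ne: "\<O> \<noteq> {}" unfolding \<O>_def using L.one_closed by blast
    have I: "nopen (\<Inter>\<O>)" using nopen_Inter[OF fin ne] \<O>n by blast
    have IW: "\<Inter>\<O> \<subseteq> W"
    proof -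
      have "\<one>\<^bsub>L\<^esub> ` W \<in> \<O>" unfolding \<O>_def using L.one_closed by blast
      then show ?thesis using act_image_one[OF Wc] by auto
    qed
    have sub: "\<Inter>\<O> \<subseteq> g ` \<Inter>\<O>" if g: "g \<in> carrier L" for g
    proof -
      have "g ` (\<Inter>h\<in>carrier L. h ` W) = (\<Inter>h\<in>carrier L. g ` h ` W)"
        by (rule act_image_INT[OF g]) (use act_image_closed[OF _ Wc] L.one_closed in blast)+
      also have "\<dots> = (\<Inter>h\<in>carrier L. (g \<otimes>\<^sub>L h) ` W)"
        by (intro INF_cong refl) (rule act_image_mult[OF g _ Wc, symmetric])
      also have "\<dots> \<supseteq> \<Inter>\<O>" unfolding \<O>_def using g by blast
      finally show ?thesis unfolding \<O>_def .
    qed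
    have "\<Inter>\<O> \<subseteq> carrier G" using IW Wc by blast
    then have "g ` \<Inter>\<O> = \<Inter>\<O>" if "g \<in> carrier L" for g using act_image_invariant'[OF _ sub that] by blast
    then have "\<Inter>\<O> = carrier G" using noinv nopenD(1,2)[OF I] by blast
    then have "W = carrier G" using IW Wc by blast
    moreover have "x0 <# carrier G = carrier G" using l_coset_mem_iff[OF x0(1) order_refl] x0(1) by (intro Set.set_eqI) auto
    ultimately show False using x0(2) \<nu>_carrier by simp
  qed
  obtain n :: nat where n: "1 < real n * \<delta>\<^sup>2" using \<delta> reals_Archimedean3[of "\<delta>\<^sup>2"] by auto
  then have n0: "n > 0" by (cases n) auto
  obtain \<P> where \<P>: "\<P> \<subseteq> \<O>" "finite \<P>" "card \<P> = n" using infinite_arbitrarily_large[OF \<open>infinite \<O>\<close>] by metis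
  have "real (card \<P>) * \<delta>\<^sup>2 \<le> 1"
  proof (rule bessel_bound[of \<P> "measure \<mu> W"])
    show "\<P> \<noteq> {}" using \<P>(3) n0 by auto
  qed (use \<P> \<O>n \<O>m orth \<O>big \<delta> in \<open>auto simp: subset_iff\<close>)
  then show False using n \<P>(3) by simp
qed

end

end

section \<open>The nub of the nub\<close>

lemma top_auto_subgroup: "subgroup (top_auto G T) (BijGroup (carrier G))"
  if "group G" and top: "topspace T = carrier G" for G (structure) and T
proof -
  interpret group G by fact
  interpret B: group "BijGroup (carrier G)" by (rule group_BijGroup)
  interpret A: subgroup "auto G" "BijGroup (carrier G)" by (rule subgroup_auto)
  have Bij: "f \<in> Bij (carrier G)" if "f \<in> top_auto G T" for f
    using that unfolding top_auto_def auto_def by blast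
  show ?thesis
  proof (rule B.subgroupI)
    show "top_auto G T \<subseteq> carrier (BijGroup (carrier G))"
      using A.subset unfolding top_auto_def by blast
    have "homeomorphic_map T T (\<lambda>x\<in>carrier G. x)"
      using homeomorphic_map_eq[OF homeomorphic_map_id[THEN iffD2, OF refl], of T "\<lambda>x\<in>carrier G. x"] top by simp
    then have "(\<lambda>x\<in>carrier G. x) \<in> top_auto G T" unfolding top_auto_def using id_in_auto by simp
    then show "top_auto G T \<noteq> {}" by blast
    fix f assume f: "f \<in> top_auto G T"
    have fA: "f \<in> auto G" "homeomorphic_map T T f" using f unfolding top_auto_def by auto
    have inv: "inv\<^bsub>BijGroup (carrier G)\<^esub> f = (\<lambda>x\<in>carrier G. inv_into (carrier G) f x)"
      by (rule inv_BijGroup[OF Bij[OF f]])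
    obtain g where g: "homeomorphic_maps T T f g" using fA(2) homeomorphic_map_maps by blast
    have "g x = (inv\<^bsub>BijGroup (carrier G)\<^esub> f) x" if x: "x \<in> topspace T" for x
    proof -
      have gx: "g x \<in> carrier G" "f (g x) = x"
        using g x top unfolding homeomorphic_maps_def continuous_map_def by auto
      moreover have "inj_on f (carrier G)" using Bij[OF f] unfolding Bij_def bij_betw_def by blast
      ultimately have "inv_into (carrier G) f x = g x" by (metis inv_into_f_f)
      then show ?thesis unfolding inv using x top by simp
    qed
    moreover have "homeomorphic_map T T g" using g unfolding homeomorphic_maps_map by blast
    ultimately have "homeomorphic_map T T (inv\<^bsub>BijGroup (carrier G)\<^esub> f)"
      by (rule homeomorphic_map_eq[rotated])
    then show "inv\<^bsub>BijGroup (carrier G)\<^esub> f \<in> top_auto G T"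
      unfolding top_auto_def using A.m_inv_closed[OF fA(1)] by simp
    fix g assume g: "g \<in> top_auto G T"
    have gA: "g \<in> auto G" "homeomorphic_map T T g" using g unfolding top_auto_def by auto
    have eq: "f \<otimes>\<^bsub>BijGroup (carrier G)\<^esub> g = compose (carrier G) f g"
      unfolding BijGroup_def using Bij f g by simp
    have "homeomorphic_map T T (f \<circ> g)" using homeomorphic_map_compose[OF gA(2) fA(2)] .
    then have "homeomorphic_map T T (compose (carrier G) f g)"
      by (rule homeomorphic_map_eq) (simp add: top compose_def)
    then show "f \<otimes>\<^bsub>BijGroup (carrier G)\<^esub> g \<in> top_auto G T"
      unfolding top_auto_def using A.m_closed[OF fA(1) gA(1)] eq by simp
  qed
qed

lemma TopAutoGroup_eq: "TopAutoGroup G T = (BijGroup (carrier G))\<lparr>carrier := top_auto G T\<rparr>"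
  unfolding TopAutoGroup_def AutoGroup_def by simp

lemma TopAutoGroup_mult:
  assumes "f \<in> top_auto G T" "g \<in> top_auto G T" "x \<in> carrier G"
  shows "(f \<otimes>\<^bsub>TopAutoGroup G T\<^esub> g) x = f (g x)"
proof -
  have "f \<in> Bij (carrier G)" "g \<in> Bij (carrier G)" using assms unfolding top_auto_def auto_def by auto
  then show ?thesis unfolding TopAutoGroup_eq BijGroup_def using assms(3) by (simp add: compose_def)
qed

lemma TopAutoGroup_one: "x \<in> carrier G \<Longrightarrow> \<one>\<^bsub>TopAutoGroup G T\<^esub> x = x"
  unfolding TopAutoGroup_eq BijGroup_def by simp

lemma TopAutoGroup_carrier [simp]: "carrier (TopAutoGroup G T) = top_auto G T"
  unfolding TopAutoGroup_def by simp

lemma topological_groupD: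
  assumes "topological_group G T"
  shows "group G" "topspace T = carrier G" "Hausdorff_space T"
    "continuous_map (prod_topology T T) T (\<lambda>(x, y). x \<otimes>\<^bsub>G\<^esub> y)" "continuous_map T T (\<lambda>x. inv\<^bsub>G\<^esub> x)"
  using assms unfolding topological_group_def by blast+

lemma TopAutoGroup_group: assumes "topological_group G T" shows "group (TopAutoGroup G T)"
  unfolding TopAutoGroup_eq
  using top_auto_subgroup[OF topological_groupD(1,2)[OF assms]] group_BijGroup
  by (rule subgroup.subgroup_is_group)

lemma taction_subgroup:
  assumes GT: "topological_group G T" and H: "subgroup H (TopAutoGroup G T)"
  shows "taction G ((TopAutoGroup G T)\<lparr>carrier := H\<rparr>) T"
proof -
  note G = topological_groupD[OF GT]
  interpret group G by (rule G(1))
  have HT: "H \<subseteq> top_auto G T" using subgroup.subset[OF H] by simp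
  have "group ((TopAutoGroup G T)\<lparr>carrier := H\<rparr>)"
    using subgroup.subgroup_is_group[OF H TopAutoGroup_group[OF GT]] .
  then interpret L: group "(TopAutoGroup G T)\<lparr>carrier := H\<rparr>" .
  show ?thesis
  proof (unfold_locales)
    show "topspace T = carrier G" "Hausdorff_space T" "continuous_map (prod_topology T T) T (\<lambda>(x, y). x \<otimes>\<^bsub>G\<^esub> y)"
      "continuous_map T T (\<lambda>x. inv\<^bsub>G\<^esub> x)" by (rule G)+
    fix g assume "g \<in> carrier ((TopAutoGroup G T)\<lparr>carrier := H\<rparr>)"
    then have g: "g \<in> top_auto G T" using HT by auto
    then show "g \<in> hom G G" "continuous_map T T g"
      unfolding top_auto_def auto_def using homeomorphic_imp_continuous_map by blast+
    fix h x assume "h \<in> carrier ((TopAutoGroup G T)\<lparr>carrier := H\<rparr>)" and x: "x \<in> carrier G"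
    then have h: "h \<in> top_auto G T" using HT by auto
    show "(g \<otimes>\<^bsub>(TopAutoGroup G T)\<lparr>carrier := H\<rparr>\<^esub> h) x = g (h x)" using TopAutoGroup_mult[OF g h x] by simp
  next
    fix x assume "x \<in> carrier G"
    then show "\<one>\<^bsub>(TopAutoGroup G T)\<lparr>carrier := H\<rparr>\<^esub> x = x" using TopAutoGroup_one[of x G T] by simp
  qed
qed

section \<open>Passing between the given definitions and the abstract action\<close>

context taction begin

lemma topological_group: "topological_group G T"
  unfolding topological_group_def using is_group topspace_T Hausdorff_T mult_cont inv_cont by blast

lemma pw_agree:
  assumes \<beta>: "\<beta> \<in> top_auto G T" and g: "g \<in> carrier L" and eq: "\<And>x. x \<in> carrier G \<Longrightarrow> \<beta> x = g x" and x: "x \<in> carrier G"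
  shows "(\<beta> [^]\<^bsub>TopAutoGroup G T\<^esub> (i::int)) x = (g [^]\<^bsub>L\<^esub> i) x"
proof -
  interpret A: group "TopAutoGroup G T" by (rule TopAutoGroup_group[OF topological_group])
  have nat: "(\<beta> [^]\<^bsub>TopAutoGroup G T\<^esub> int n) y = (g [^]\<^bsub>L\<^esub> int n) y" if "y \<in> carrier G" for n y
    using that
  proof (induction n arbitrary: y)
    case 0
    then show ?case using TopAutoGroup_one[of y G T] by simp
  next
    case (Suc n)
    have "(\<beta> [^]\<^bsub>TopAutoGroup G T\<^esub> int (Suc n)) y = (\<beta> [^]\<^bsub>TopAutoGroup G T\<^esub> int n \<otimes>\<^bsub>TopAutoGroup G T\<^esub> \<beta>) y"
      by (simp add: int_pow_int del: of_nat_Suc)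
    also have "\<dots> = (\<beta> [^]\<^bsub>TopAutoGroup G T\<^esub> int n) (\<beta> y)"
      by (rule TopAutoGroup_mult) (use \<beta> Suc.prems A.int_pow_closed[of \<beta>] in auto)
    also have "\<dots> = (g [^]\<^bsub>L\<^esub> int n) (g y)" using Suc eq g by simp
    also have "\<dots> = (g [^]\<^bsub>L\<^esub> int (Suc n)) y" using pw_add[OF g Suc.prems, of "int n" 1] g by (simp add: add.commute)
    finally show ?case .
  qed
  show ?thesis
  proof (cases i rule: int_cases2)
    case (nonneg n)
    then show ?thesis using nat[OF x] by simp
  next
    case (nonpos n)
    define y where "y = (g [^]\<^bsub>L\<^esub> (- int n)) x"
    have y: "y \<in> carrier G" "(g [^]\<^bsub>L\<^esub> int n) y = x" unfolding y_def using g x by (simp_all add: pw_add)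
    have "(\<beta> [^]\<^bsub>TopAutoGroup G T\<^esub> (- int n)) ((\<beta> [^]\<^bsub>TopAutoGroup G T\<^esub> int n) y)
      = (\<beta> [^]\<^bsub>TopAutoGroup G T\<^esub> (- int n) \<otimes>\<^bsub>TopAutoGroup G T\<^esub> \<beta> [^]\<^bsub>TopAutoGroup G T\<^esub> int n) y"
      by (rule TopAutoGroup_mult[symmetric]) (use \<beta> y A.int_pow_closed[of \<beta>] in auto)
    also have "\<dots> = y"
      using A.int_pow_mult[of \<beta> "- int n" "int n"] \<beta> TopAutoGroup_one[OF y(1), of T] by simp
    finally have "(\<beta> [^]\<^bsub>TopAutoGroup G T\<^esub> (- int n)) x = y" using nat[OF y(1)] y(2) by simp
    then show ?thesis using nonpos unfolding y_def by simp
  qed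
qed

lemma tidy_iff_tidy_for:
  assumes \<beta>: "\<beta> \<in> top_auto G T" and g: "g \<in> carrier L" and eq: "\<And>x. x \<in> carrier G \<Longrightarrow> \<beta> x = g x"
  shows "tidy G T \<beta> U \<longleftrightarrow> tidy_for g U"
proof (cases "compact_open_subgroup G T U")
  case False
  then show ?thesis unfolding tidy_def tidy_for_def compact_open_subgroup_def by blast
next
  case True
  then have Uc: "U \<subseteq> carrier G" unfolding compact_open_subgroup_def using subgroup.subset by blast
  note agree = pw_agree[OF \<beta> g eq]
  have im: "(\<beta> [^]\<^bsub>TopAutoGroup G T\<^esub> i) ` U = (g [^]\<^bsub>L\<^esub> i) ` U" for i :: int
    by (rule image_cong[OF refl]) (use agree Uc in blast)
  have P: "U_plus G T \<beta> U = Plus g U" unfolding U_plus_def Plus_def im ..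
  have M: "U_minus G T \<beta> U = Minus g U"
  proof -
    have "{..0::int} = uminus ` {0..}" by (simp add: image_uminus_atLeast)
    then show ?thesis unfolding U_minus_def Minus_def Plus_def im pw_minus[OF g] by (simp only: image_image)
  qed
  have "U_plus_plus G T \<beta> U = Plus_plus g U" unfolding U_plus_plus_def Plus_plus_def using agree by (auto cong: conj_cong)
  then show ?thesis
    using True unfolding tidy_def tidy_for_def P M compact_open_subgroup_def by simp
qed

text \<open>\<open>H'\<close> and \<open>L\<close> only have to induce the same maps on the carrier.
  This covers \<open>H\<close> itself and also restrictions to an invariant subgroup, where
  different elements of \<open>L\<close> may have the same restriction.\<close>

lemma tidy_subgroups_eq:
  assumes 1: "\<And>\<beta>. \<beta> \<in> H' \<Longrightarrow> \<beta> \<in> top_auto G T \<and> (\<exists>g\<in>carrier L. \<forall>x\<in>carrier G. \<beta> x = g x)"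
    and 2: "\<And>g. g \<in> carrier L \<Longrightarrow> \<exists>\<beta>\<in>H'. \<forall>x\<in>carrier G. \<beta> x = g x"
  shows "tidy_subgroups G T H' = tidy_all"
proof (rule Set.set_eqI)
  fix U
  have "(\<forall>\<beta>\<in>H'. tidy G T \<beta> U) \<longleftrightarrow> (\<forall>g\<in>carrier L. tidy_for g U)"
    using 1 2 tidy_iff_tidy_for by meson
  moreover have "(\<forall>g\<in>carrier L. tidy_for g U) \<Longrightarrow> compact_open_subgroup G T U"
    using tidy_forD[of "\<one>\<^bsub>L\<^esub>" U] unfolding compact_open_subgroup_def by blast
  ultimately show "U \<in> tidy_subgroups G T H' \<longleftrightarrow> U \<in> tidy_all"
    unfolding tidy_subgroups_def tidy_all_def by blast
qed

lemma taction_restrict: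
  assumes N: "subgroup N G" and inv: "\<And>g. g \<in> carrier L \<Longrightarrow> g ` N = N"
  shows "taction (G\<lparr>carrier := N\<rparr>) L (subtopology T N)"
proof -
  have Nc: "N \<subseteq> carrier G" using subgroup.subset[OF N] .
  have gr: "group (G\<lparr>carrier := N\<rparr>)" using subgroup.subgroup_is_group[OF N is_group] .
  interpret N: group "G\<lparr>carrier := N\<rparr>" by (rule gr)
  have top: "topspace (subtopology T N) = N" using Nc by (simp add: inf_absorb2)
  have minv: "inv\<^bsub>G\<lparr>carrier := N\<rparr>\<^esub> x = inv x" if "x \<in> N" for x using m_inv_consistent[OF N that] .
  show ?thesis
  proof (unfold_locales)
    show "topspace (subtopology T N) = carrier (G\<lparr>carrier := N\<rparr>)" using top by simp
    show "Hausdorff_space (subtopology T N)" by (simp add: Hausdorff_T Hausdorff_space_subtopology)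
    have "continuous_map (prod_topology (subtopology T N) (subtopology T N)) T (\<lambda>(x, y). x \<otimes> y)"
      using continuous_map_from_subtopology[OF mult_cont, of "N \<times> N"] by (simp add: subtopology_Times)
    then show "continuous_map (prod_topology (subtopology T N) (subtopology T N)) (subtopology T N)
        (\<lambda>(x, y). x \<otimes>\<^bsub>G\<lparr>carrier := N\<rparr>\<^esub> y)"
      using top subgroup.m_closed[OF N] by (auto simp: continuous_map_in_subtopology)
    have "continuous_map (subtopology T N) (subtopology T N) (\<lambda>x. inv x)"
      using continuous_map_from_subtopology[OF inv_cont, of N] top subgroup.m_inv_closed[OF N]
      by (auto simp: continuous_map_in_subtopology)
    then show "continuous_map (subtopology T N) (subtopology T N) (\<lambda>x. inv\<^bsub>G\<lparr>carrier := N\<rparr>\<^esub> x)"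
      by (rule continuous_map_eq) (use top minv in auto)
    fix g assume g: "g \<in> carrier L"
    show "g \<in> hom (G\<lparr>carrier := N\<rparr>) (G\<lparr>carrier := N\<rparr>)"
      using g inv[OF g] Nc by (auto simp: hom_def subset_iff)
    show "continuous_map (subtopology T N) (subtopology T N) g"
      using continuous_map_from_subtopology[OF act_cont[OF g], of N] top inv[OF g]
      by (auto simp: continuous_map_in_subtopology)
    fix h x assume "h \<in> carrier L" "x \<in> carrier (G\<lparr>carrier := N\<rparr>)"
    then show "(g \<otimes>\<^bsub>L\<^esub> h) x = g (h x)" using g Nc by auto
  next
    fix x assume "x \<in> carrier (G\<lparr>carrier := N\<rparr>)"
    then show "\<one>\<^bsub>L\<^esub> x = x" using Nc by auto
  qed
qed

lemma restrict_top_auto: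
  assumes N: "subgroup N G" and inv: "\<And>g. g \<in> carrier L \<Longrightarrow> g ` N = N" and g: "g \<in> carrier L"
  shows "restrict g N \<in> top_auto (G\<lparr>carrier := N\<rparr>) (subtopology T N)"
proof -
  interpret N: taction "G\<lparr>carrier := N\<rparr>" L "subtopology T N" by (rule taction_restrict[OF N inv])
  have gi: "inv\<^bsub>L\<^esub> g \<in> carrier L" using g by simp
  have "homeomorphic_maps (subtopology T N) (subtopology T N) g (inv\<^bsub>L\<^esub> g)"
    unfolding homeomorphic_maps_def using N.act_cont g gi N.act_inv_left[OF g] N.act_inv_right[OF g] by simp
  then have "homeomorphic_map (subtopology T N) (subtopology T N) g" using homeomorphic_map_maps by blast
  then have "homeomorphic_map (subtopology T N) (subtopology T N) (restrict g N)"
    by (rule homeomorphic_map_eq) auto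
  moreover have "restrict g N \<in> hom (G\<lparr>carrier := N\<rparr>) (G\<lparr>carrier := N\<rparr>)"
    using N.act_hom[OF g] subgroup.m_closed[OF N] by (auto simp: hom_def)
  moreover have "bij_betw (restrict g N) N N"
    using N.act_inj[OF g] inv[OF g] by (auto simp: bij_betw_def inj_on_def)
  ultimately show ?thesis unfolding top_auto_def auto_def Bij_def by simp
qed

text \<open>The whole group is tidy and fixed by every automorphism, so
  \<open>tidy_fixes_transfer\<close> makes each tidy subgroup invariant. Conversely, for an
  invariant \<open>V\<close> all of \<open>Plus\<close>, \<open>Minus\<close> and
  \<open>Plus_plus\<close> are just \<open>V\<close>, and an open subgroup is closed.\<close>

lemma tidy_all_compact:
  assumes comp: "compact_space T"
  shows "tidy_all = {V. subgroup V G \<and> openin T V \<and> (\<forall>g\<in>carrier L. g ` V = V)}"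
proof -
  have inv: "V \<in> tidy_all" if V: "subgroup V G" "openin T V" "\<And>g. g \<in> carrier L \<Longrightarrow> g ` V = V" for V
  proof -
    note Vc = subgroup.subset[OF V(1)]
    have "inv_open (carrier G) V" unfolding inv_open_def using V Vc subtopology_topspace[of T] by simp
    then have Vcomp: "compactin T V"
      using inv_open_compact[OF _ subgroup_self] comp unfolding compact_space_def by simp
    have "tidy_for h V" if h: "h \<in> carrier L" for h
    proof -
      have pw: "(h [^]\<^bsub>L\<^esub> (i::int)) ` V = V" for i using V(3) h by simp
      have P: "Plus h V = V" "Minus h V = V" unfolding Minus_def Plus_def using pw V(3) h by (simp_all add: pw_minus)
      have pwx: "(h [^]\<^bsub>L\<^esub> (i::int)) x \<in> V \<longleftrightarrow> x \<in> V" if "x \<in> carrier G" for i :: int and x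
        using act_inv_image_mem_iff[of "h [^]\<^bsub>L\<^esub> i" V x] V(3)[of "inv\<^bsub>L\<^esub> (h [^]\<^bsub>L\<^esub> i)"] h Vc that by simp
      have "Plus_plus h V = V" unfolding Plus_plus_def using pwx Vc by auto
      moreover have "V <#> V = V"
      proof
        show "V <#> V \<subseteq> V" using set_mult_subset[OF V(1)] by blast
        show "V \<subseteq> V <#> V" using subset_set_mult_left[OF Vc subgroup.one_closed[OF V(1)]] .
      qed
      ultimately show ?thesis unfolding tidy_for_def using V Vcomp P compact_closed by simp
    qed
    then show ?thesis unfolding tidy_all_def by blast
  qed
  have "carrier G \<in> tidy_all"
    by (rule inv) (use subgroup_self openin_topspace[of T] act_image_carrier in auto)
  then have fixes_V: "g ` V = V" if "V \<in> tidy_all" "g \<in> carrier L" for g V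
    using tidy_fixes_transfer[OF _ that act_image_carrier[OF that(2)]] by blast
  show ?thesis
  proof (rule Set.set_eqI)
    fix V
    show "V \<in> tidy_all \<longleftrightarrow> V \<in> {V. subgroup V G \<and> openin T V \<and> (\<forall>g\<in>carrier L. g ` V = V)}"
      using inv[of V] tidy_allD(1,3)[of V] fixes_V[of V] by blast
  qed
qed

lemma inv_open_restrict_iff:
  assumes N: "subgroup N G"
  shows "subgroup V (G\<lparr>carrier := N\<rparr>) \<and> openin (subtopology T N) V \<and> (\<forall>g\<in>carrier L. g ` V = V) \<longleftrightarrow> inv_open N V"
proof
  assume a: "subgroup V (G\<lparr>carrier := N\<rparr>) \<and> openin (subtopology T N) V \<and> (\<forall>g\<in>carrier L. g ` V = V)"
  then have "V \<subseteq> N" using subgroup.subset by force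
  then show "inv_open N V" unfolding inv_open_def using a incl_subgroup[OF N] by blast
next
  assume "inv_open N V"
  then show "subgroup V (G\<lparr>carrier := N\<rparr>) \<and> openin (subtopology T N) V \<and> (\<forall>g\<in>carrier L. g ` V = V)"
    unfolding inv_open_def using subgroup_incl[OF _ N] by blast
qed

lemma restrict_action_compact_eq:
  assumes N: "compactin T N" "subgroup N G" "\<And>g. g \<in> carrier L \<Longrightarrow> g ` N = N"
  shows "nub (G\<lparr>carrier := N\<rparr>) (subtopology T N) (restrict_action (carrier L) N) = Res N"
proof -
  interpret N: taction "G\<lparr>carrier := N\<rparr>" L "subtopology T N" by (rule taction_restrict[OF N(2,3)])
  have "compact_space (subtopology T N)" using N(1) compact_space_subtopology by blast
  have "tidy_subgroups (G\<lparr>carrier := N\<rparr>) (subtopology T N) (restrict_action (carrier L) N) = N.tidy_all"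
    by (rule N.tidy_subgroups_eq) (use restrict_top_auto[OF N(2,3)] in \<open>auto simp: restrict_action_def\<close>)
  also have "\<dots> = {V. inv_open N V}"
    unfolding N.tidy_all_compact[OF \<open>compact_space (subtopology T N)\<close>] using inv_open_restrict_iff[OF N(2)] by blast
  finally show ?thesis
    unfolding nub_def Res_def using inv_open_self[OF N] by auto
qed

lemma ergodic_restrict:
  assumes td: "totally_disconnected_space T"
    and R: "compactin T R" "subgroup R G" "\<And>g. g \<in> carrier L \<Longrightarrow> g ` R = R"
    and noinv: "\<And>V. inv_open R V \<Longrightarrow> V = R"
  shows "ergodic_action (G\<lparr>carrier := R\<rparr>) (subtopology T R) (restrict_action (carrier L) R)"
  unfolding ergodic_action_def
proof (intro allI impI ballI)
  fix \<mu> A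
  assume \<mu>: "normalized_haar_measure (G\<lparr>carrier := R\<rparr>) (subtopology T R) \<mu>" and A: "A \<in> sets \<mu>"
    and inv: "\<forall>\<alpha>\<in>restrict_action (carrier L) R. \<alpha> ` A = A"
  interpret R: taction "G\<lparr>carrier := R\<rparr>" L "subtopology T R" by (rule taction_restrict[OF R(2,3)])
  have "totally_disconnected_space (subtopology T R)"
    using td unfolding totally_disconnected_space_def connectedin_subtopology by blast
  moreover have "compact_space (subtopology T R)" using R(1) compact_space_subtopology by blast
  ultimately interpret R: haar_action "G\<lparr>carrier := R\<rparr>" L "subtopology T R" \<mu>
    by unfold_locales (use \<mu> in auto)
  have AR: "A \<subseteq> R" using sets.sets_into_space[OF A] by simp
  have "measure \<mu> A = 0 \<or> measure \<mu> A = 1"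
  proof (rule R.ergodic_set[OF A])
    fix V assume "subgroup V (G\<lparr>carrier := R\<rparr>)" "openin (subtopology T R) V" "\<And>g. g \<in> carrier L \<Longrightarrow> g ` V = V"
    then have "inv_open R V" using inv_open_restrict_iff[OF R(2)] by blast
    then show "V = carrier (G\<lparr>carrier := R\<rparr>)" using noinv by simp
  next
    fix g assume "g \<in> carrier L"
    then have "restrict g R ` A = A" using inv unfolding restrict_action_def by blast
    moreover have "restrict g R ` A = g ` A" by (rule image_cong[OF refl]) (use AR in auto)
    ultimately show "g ` A = A" by simp
  qed
  then show "emeasure \<mu> A = 0 \<or> emeasure \<mu> A = 1" unfolding R.emeasure_eq_measure by auto
qed

end

theorem corollary1p10:
  fixes G :: "('a, 'b) monoid_scheme" and T :: "'a topology" and H :: "('a \<Rightarrow> 'a) set"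
  assumes "tdlc_group G T"
    and "flat_group G T H"
    and "finitely_generated_subgroup (TopAutoGroup G T) H"
  shows "ergodic_action (G\<lparr>carrier := nub2 G T H\<rparr>) (subtopology T (nub2 G T H))
           (restrict_action H (nub2 G T H)) \<and>
         (finitely_generated_subgroup (TopAutoGroup G T) (uniscalar_part G T H) \<longrightarrow>
            nub2 G T H = nub G T H)"
proof -
  have GT: "topological_group G T" and td: "totally_disconnected_space T"
    using assms(1) unfolding tdlc_group_def by blast+
  have H: "subgroup H (TopAutoGroup G T)" and ne: "tidy_subgroups G T H \<noteq> {}"
    using assms(2) unfolding flat_group_def by blast+
  interpret Aut: group "TopAutoGroup G T" by (rule TopAutoGroup_group[OF GT])
  define L where "L = (TopAutoGroup G T)\<lparr>carrier := H\<rparr>"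
  have LH: "carrier L = H" unfolding L_def by simp
  interpret taction G L T unfolding L_def by (rule taction_subgroup[OF GT H])
  have HT: "H \<subseteq> top_auto G T" using subgroup.subset[OF H] by simp
  have tidy_eq: "tidy_subgroups G T H = tidy_all"
    by (rule tidy_subgroups_eq) (use HT in \<open>auto simp: LH\<close>)
  then obtain U where U: "U \<in> tidy_all" using ne by blast
  have gen: "generate L S = generate (TopAutoGroup G T) S" if "S \<subseteq> H" for S
    unfolding L_def using Aut.generate_consistent[OF that H] .
  obtain S where S: "finite S" "S \<subseteq> H" "H = generate (TopAutoGroup G T) S"
    using assms(3) unfolding finitely_generated_subgroup_def by blast
  interpret fg_flat_action G L T U S
    by unfold_locales (use U S gen[OF S(2)] in \<open>auto simp: LH\<close>)
  define N where "N = \<Inter>tidy_all"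
  have NU: "N \<subseteq> U" unfolding N_def using U by blast
  have nub: "nub G T H = N" unfolding nub_def tidy_eq N_def using U U'(4) by blast
  have Nc: "compactin T N"
    unfolding N_def by (rule closed_compactin_Inter[OF U'(2) U]) (rule tidy_allD(5))
  have Ns: "subgroup N G"
    unfolding N_def by (rule subgroups_Inter) (use U tidy_allD(1) in auto)
  have NcG: "N \<subseteq> carrier G" using subgroup.subset[OF Ns] .
  have Nsub: "g ` N \<subseteq> N" if g: "g \<in> carrier L" for g
  proof
    fix y assume "y \<in> g ` N"
    then obtain x where x: "x \<in> N" "y = g x" by blast
    have "y \<in> W" if W: "W \<in> tidy_all" for W
    proof -
      have "(inv\<^bsub>L\<^esub> g) ` W \<in> tidy_all" using act_image_tidy[OF W, of "inv\<^bsub>L\<^esub> g"] g by simp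
      then have "x \<in> (inv\<^bsub>L\<^esub> g) ` W" using x unfolding N_def by blast
      then show ?thesis using act_inv_image_mem_iff[OF g tidy_allD(4)[OF W]] x by blast
    qed
    then show "y \<in> N" unfolding N_def by blast
  qed
  note Ninv = act_image_invariant[OF NcG Nsub]
  have nub2: "nub2 G T H = Res N"
    unfolding nub2_def nub Let_def using restrict_action_compact_eq[OF Nc Ns Ninv] by (simp add: LH)
  have "ergodic_action (G\<lparr>carrier := Res N\<rparr>) (subtopology T (Res N)) (restrict_action (carrier L) (Res N))"
  proof (rule ergodic_restrict[OF td])
    show "compactin T (Res N)" "subgroup (Res N) G" "\<And>g. g \<in> carrier L \<Longrightarrow> g ` Res N = Res N"
      using Res_compact[OF Nc Ns Ninv] Res_subgroup[OF Nc Ns Ninv] Res_invariant[OF Nc Ns Ninv] by blast+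
    show "\<And>V. inv_open (Res N) V \<Longrightarrow> V = Res N"
      using Res_no_proper_open[OF Nc Ns Ninv td U'(2,3,1) NU fg_flat_action.S[OF fg_flat_action_axioms]] by blast
  qed
  moreover have "nub2 G T H = nub G T H" if fg: "finitely_generated_subgroup (TopAutoGroup G T) (uniscalar_part G T H)"
  proof -
    \<comment> \<open>The definition asks for some tidy subgroup that is left invariant;
      \<open>tidy_fixes_transfer\<close> lets the chosen \<open>U\<close> stand for it.\<close>
    have uni: "uniscalar_part G T H = {g \<in> carrier L. g ` U = U}"
      unfolding uniscalar_part_def tidy_eq using U tidy_fixes_transfer[OF _ U] by (auto simp: LH)
    obtain Su where Su: "finite Su" "Su \<subseteq> uniscalar_part G T H" "uniscalar_part G T H = generate (TopAutoGroup G T) Su"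
      using fg unfolding finitely_generated_subgroup_def by blast
    have SuH: "Su \<subseteq> H" using Su(2) unfolding uni by (auto simp: LH)
    have "N = Res fixed_part"
      unfolding N_def by (rule Inter_tidy_eq_Res[OF td Su(1)]) (use Su(3) uni gen[OF SuH] in simp)
    \<comment> \<open>The nub is now itself a residual and so has no proper open invariant subgroup;
      hence its own residual is all of it.\<close>
    moreover have "V = Res fixed_part" if "inv_open (Res fixed_part) V" for V
      using Res_no_proper_open[OF fam_compact[OF fixed_part_fam] fam_subgroup[OF fixed_part_fam] fixed_part_invariant
          td U'(2,3,1) fixed_part_subset fg_flat_action.S[OF fg_flat_action_axioms] that] .
    ultimately have "V = N" if "inv_open N V" for V using that by simp
    then have "Res N = N" unfolding Res_def using inv_open_self[OF Nc Ns Ninv] by blast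
    then show ?thesis using nub nub2 by simp
  qed
  ultimately show ?thesis using nub2 by (simp add: LH)
qed

end
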